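(* Let $2\le N\le 9$, $\Omega\subset\mathbb{R}^N$ a bounded domain, $F,Q$ as in the context. Let $\lambda^*:=\sup\{\lambda>0: -Qu=\lambda e^u\text{ in }\Omega,\ u=0\text{ on }\partial\Omega\text{ has a solution}\}$ and let $u^*$ be the extremal solution, i.e. the limit in $W_0^{1,2}(\Omega)$ of the minimal solutions $\underline u_n$ of $-Qu=\lambda_n e^u$, $u=0$ on $\partial\Omega$, along an increasing sequence $\lambda_n\to\lambda^*$ (a weak solution of the problem with $\lambda=\lambda^*$). Then $u^*$ is regular, i.e. $e^{u^*}\in L^\infty(\Omega)$.
   Context: Standing assumptions on $F$: $F:\mathbb{R}^N\to[0,\infty)$ is convex, $F\in C^2(\mathbb{R}^N\setminus\{0\})$, $F(t\xi)=|t|F(\xi)$, $F(\xi)>0$ for $\xi\neq0$; $a|\xi|\le F(\xi)\le b|\xi|$ for constants $0<a\le b$; and $\mu^2|V|^2\le\sum_{i,j}F_{\xi_i\xi_j}(\xi)V_iV_j\le\Lambda|V|^2$ for all unit $\xi$ and all $V\perp\xi$. $Qu:=\sum_i\partial_{x_i}(F(\nabla u)F_{\xi_i}(\nabla u))$. Solutions are weak solutions in $W_0^{1,2}(\Omega)$; a solution $\underline u$ is minimal if $u\ge\underline u$ for every supersolution $u$ ($-Qu\ge\lambda e^u$ weakly in $\Omega$, $u\ge0$ on $\partial\Omega$). *)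

theory Defs
  imports "HOL-Analysis.Analysis"
begin

definition pd :: "'n::finite \<Rightarrow> (real^'n \<Rightarrow> real) \<Rightarrow> real^'n \<Rightarrow> real" where
  "pd i f x = frechet_derivative f (at x) (axis i 1)"

definition grad :: "(real^'n::finite \<Rightarrow> real) \<Rightarrow> real^'n \<Rightarrow> real^'n" where
  "grad f x = (\<chi> i. pd i f x)"

definition smooth :: "(real^'n::finite \<Rightarrow> real) \<Rightarrow> bool" where
  "smooth f \<longleftrightarrow> (\<forall>is x. (fold (\<lambda>i g. pd i g) is f) differentiable (at x))"

definition test_fun :: "(real^'n::finite) set \<Rightarrow> (real^'n \<Rightarrow> real) \<Rightarrow> bool" where
  "test_fun \<Omega> \<phi> \<longleftrightarrow> smooth \<phi> \<and> compact (closure {x. \<phi> x \<noteq> 0})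
      \<and> closure {x. \<phi> x \<noteq> 0} \<subseteq> \<Omega>"

definition L2 :: "(real^'n::finite) set \<Rightarrow> (real^'n \<Rightarrow> real) \<Rightarrow> bool" where
  "L2 \<Omega> u \<longleftrightarrow> u \<in> borel_measurable (lebesgue_on \<Omega>) \<and> integrable (lebesgue_on \<Omega>) (\<lambda>x. (u x)^2)"

definition weak_grad :: "(real^'n::finite) set \<Rightarrow> (real^'n \<Rightarrow> real) \<Rightarrow> (real^'n \<Rightarrow> real^'n) \<Rightarrow> bool" where
  "weak_grad \<Omega> u g \<longleftrightarrow> L2 \<Omega> u \<and> (\<forall>i. L2 \<Omega> (\<lambda>x. g x $ i)) \<and>
     (\<forall>\<phi> i. test_fun \<Omega> \<phi> \<longrightarrow>
        integral\<^sup>L (lebesgue_on \<Omega>) (\<lambda>x. u x * pd i \<phi> x)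
          = - integral\<^sup>L (lebesgue_on \<Omega>) (\<lambda>x. g x $ i * \<phi> x))"

definition W012 :: "(real^'n::finite) set \<Rightarrow> (real^'n \<Rightarrow> real) \<Rightarrow> (real^'n \<Rightarrow> real^'n) \<Rightarrow> bool" where
  "W012 \<Omega> u g \<longleftrightarrow> weak_grad \<Omega> u g \<and>
     (\<exists>\<phi>s. (\<forall>k. test_fun \<Omega> (\<phi>s k)) \<and>
        (\<lambda>k. integral\<^sup>L (lebesgue_on \<Omega>) (\<lambda>x. (\<phi>s k x - u x)^2)
            + integral\<^sup>L (lebesgue_on \<Omega>) (\<lambda>x. (norm (grad (\<phi>s k) x - g x))^2))
        \<longlonglongrightarrow> 0)"

(* F(xi) F_xi(xi) . V ; at xi = 0 this is 0 since F 0 = 0 *)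
definition Qflux :: "(real^'n::finite \<Rightarrow> real) \<Rightarrow> real^'n \<Rightarrow> real^'n \<Rightarrow> real" where
  "Qflux F \<xi> V = F \<xi> * frechet_derivative F (at \<xi>) V"

definition weak_sol :: "(real^'n::finite) set \<Rightarrow> (real^'n \<Rightarrow> real) \<Rightarrow> real \<Rightarrow> (real^'n \<Rightarrow> real) \<Rightarrow> bool" where
  "weak_sol \<Omega> F lam u \<longleftrightarrow> (\<exists>g. W012 \<Omega> u g \<and>
     integrable (lebesgue_on \<Omega>) (\<lambda>x. exp (u x)) \<and>
     (\<forall>\<phi>. test_fun \<Omega> \<phi> \<longrightarrow>
        integral\<^sup>L (lebesgue_on \<Omega>) (\<lambda>x. Qflux F (g x) (grad \<phi> x))
          = lam * integral\<^sup>L (lebesgue_on \<Omega>) (\<lambda>x. exp (u x) * \<phi> x)))"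

(* weak supersolution: -Qu >= lambda e^u weakly in Omega, u >= 0 on the boundary
   (i.e. min(u,0) in W_0^{1,2}(Omega)) *)
definition weak_supersol :: "(real^'n::finite) set \<Rightarrow> (real^'n \<Rightarrow> real) \<Rightarrow> real \<Rightarrow> (real^'n \<Rightarrow> real) \<Rightarrow> bool" where
  "weak_supersol \<Omega> F lam u \<longleftrightarrow> (\<exists>g. weak_grad \<Omega> u g \<and>
     integrable (lebesgue_on \<Omega>) (\<lambda>x. exp (u x)) \<and>
     (\<exists>h. W012 \<Omega> (\<lambda>x. min (u x) 0) h) \<and>
     (\<forall>\<phi>. test_fun \<Omega> \<phi> \<longrightarrow> (\<forall>x. \<phi> x \<ge> 0) \<longrightarrow>
        integral\<^sup>L (lebesgue_on \<Omega>) (\<lambda>x. Qflux F (g x) (grad \<phi> x))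
          \<ge> lam * integral\<^sup>L (lebesgue_on \<Omega>) (\<lambda>x. exp (u x) * \<phi> x)))"

definition minimal_sol :: "(real^'n::finite) set \<Rightarrow> (real^'n \<Rightarrow> real) \<Rightarrow> real \<Rightarrow> (real^'n \<Rightarrow> real) \<Rightarrow> bool" where
  "minimal_sol \<Omega> F lam u \<longleftrightarrow> weak_sol \<Omega> F lam u \<and>
     (\<forall>v. weak_supersol \<Omega> F lam v \<longrightarrow> (AE x in lebesgue_on \<Omega>. u x \<le> v x))"

definition lambda_star :: "(real^'n::finite) set \<Rightarrow> (real^'n \<Rightarrow> real) \<Rightarrow> real" where
  "lambda_star \<Omega> F = Sup {lam. lam > 0 \<and> (\<exists>u. weak_sol \<Omega> F lam u)}"

definition W012_conv :: "(real^'n::finite) set \<Rightarrow> (nat \<Rightarrow> real^'n \<Rightarrow> real) \<Rightarrow> (real^'n \<Rightarrow> real) \<Rightarrow> bool" where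
  "W012_conv \<Omega> us u \<longleftrightarrow> (\<exists>gs g. (\<forall>n. W012 \<Omega> (us n) (gs n)) \<and> W012 \<Omega> u g \<and>
     (\<lambda>n. integral\<^sup>L (lebesgue_on \<Omega>) (\<lambda>x. (us n x - u x)^2)
         + integral\<^sup>L (lebesgue_on \<Omega>) (\<lambda>x. (norm (gs n x - g x))^2)) \<longlonglongrightarrow> 0)"

definition admissible_F :: "(real^'n::finite \<Rightarrow> real) \<Rightarrow> real \<Rightarrow> real \<Rightarrow> real \<Rightarrow> real \<Rightarrow> bool" where
  "admissible_F F a b \<mu> \<Lambda> \<longleftrightarrow>
     (\<forall>\<xi>. F \<xi> \<ge> 0) \<and> convex_on UNIV F \<and>
     (\<forall>\<xi>. \<xi> \<noteq> 0 \<longrightarrow> F differentiable (at \<xi>)) \<and>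
     (\<forall>i \<xi>. \<xi> \<noteq> 0 \<longrightarrow> pd i F differentiable (at \<xi>)) \<and>
     (\<forall>i j. continuous_on (UNIV - {0}) (pd j (pd i F))) \<and>
     (\<forall>t \<xi>. F (t *\<^sub>R \<xi>) = \<bar>t\<bar> * F \<xi>) \<and>
     (\<forall>\<xi>. \<xi> \<noteq> 0 \<longrightarrow> F \<xi> > 0) \<and>
     0 < a \<and> a \<le> b \<and> (\<forall>\<xi>. a * norm \<xi> \<le> F \<xi> \<and> F \<xi> \<le> b * norm \<xi>) \<and>
     0 < \<mu> \<and>
     (\<forall>\<xi> V. norm \<xi> = 1 \<longrightarrow> \<xi> \<bullet> V = 0 \<longrightarrow>
        \<mu>^2 * (norm V)^2 \<le> (\<Sum>i\<in>UNIV. \<Sum>j\<in>UNIV. pd j (pd i F) \<xi> * V $ i * V $ j) \<and>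
        (\<Sum>i\<in>UNIV. \<Sum>j\<in>UNIV. pd j (pd i F) \<xi> * V $ i * V $ j) \<le> \<Lambda> * (norm V)^2)"

end

theory Submission
  imports Defs
begin

text \<open>
Write \<open>E = F\<^sup>2 / 2\<close>, a uniformly convex function. If \<open>u\<close> is the minimal solution for \<open>\<lambda>\<close> and \<open>0 \<le> w \<le> u\<close>,
solve \<open>- Q w' = \<lambda> e\<^sup>w\<close> repeatedly, starting from \<open>w\<close>. The iterates stay below \<open>u\<close>, above the iterates
started at \<open>0\<close>, and the functional \<open>J w = \<integral> E (\<nabla>w) - \<lambda> \<integral> e\<^sup>w\<close> decreases along them; by minimality the
iterates started at \<open>0\<close> increase to \<open>u\<close>. Hence \<open>J u \<le> J w\<close>, and the second variation along
\<open>u - t p(u)\<close> is the stability inequality, which for \<open>p = e\<^bsup>\<alpha>u\<^esup> - 1\<close> with \<open>\<alpha> < 2\<close> bounds \<open>e\<^sup>u\<close> in \<open>L\<^sup>q\<close>,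
\<open>q = 1 + 2\<alpha> < 5\<close>, by a constant depending on \<open>|\<Omega>|\<close> only. As \<open>N / 2 < 5\<close>, one can take \<open>q > N / 2\<close>, and
Stampacchia's level set iteration bounds \<open>u\<close> itself, uniformly in the sequence.

Functions in \<open>W\<^sub>0\<^sup>1\<^sup>,\<^sup>2\<close> are handled as pairs of a function and a gradient, both limits of the same test
functions, so uniqueness of weak gradients is never needed.
\<close>

section \<open>Smooth test functions\<close>

text \<open>The solutions are only weak and may be unbounded, \<open>e^u\<close> is a priori merely
  integrable, and \<open>F^2 / 2\<close> need not have a second derivative at 0. Three devices deal
  with this. A nonnegative right-hand side of a weak equation automatically acts boundedly on the
  Sobolev space, and so does every smaller one; hence all problems met in the iteration are solvable
  without any further integrability of \<open>e^u\<close>. Minimality of the functional on the order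
  interval from 0 to u takes the place of a linearised operator. Finally, only functions of u serve
  as variations: their gradients are scalar multiples of that of u, so the 2-homogeneity of E makes
  the energy an explicit quadratic polynomial in t. The restriction \<alpha> < 2 arises as follows.
  The equation tested with (\<alpha>/2)(e^(2\<alpha>u) - 1) and the stability inequality for
  e^(\<alpha>u) - 1 contain the same gradient integral. Eliminating it bounds the integral of e^u
  (e^(\<alpha>u) - 1)^2 by \<alpha>/2 times that of e^u (e^(2\<alpha>u) - 1), and the leading term
  can be absorbed when \<alpha>/2 < 1.\<close>

lemma has_derivative_pd:
  fixes f :: "real^'n::finite \<Rightarrow> real"
  assumes "f differentiable (at x)"
  shows "(f has_derivative (\<lambda>h. grad f x \<bullet> h)) (at x)"
proof -
  have d: "(f has_derivative frechet_derivative f (at x)) (at x)"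
    using assms by (simp add: frechet_derivative_works)
  have "frechet_derivative f (at x) h = grad f x \<bullet> h" for h
  proof -
    have "linear (frechet_derivative f (at x))"
      using d has_derivative_linear by blast
    then have "frechet_derivative f (at x) (\<Sum>i\<in>UNIV. h $ i *\<^sub>R axis i 1)
        = (\<Sum>i\<in>UNIV. h $ i *\<^sub>R frechet_derivative f (at x) (axis i 1))"
      by (simp add: linear_sum linear_cmul)
    moreover have "(\<Sum>i\<in>UNIV. h $ i *\<^sub>R axis i (1::real)) = h"
      using basis_expansion[of h] by (simp add: scalar_mult_eq_scaleR)
    ultimately show ?thesis
      by (simp add: grad_def pd_def inner_vec_def mult.commute)
  qed
  then have "frechet_derivative f (at x) = (\<lambda>h. grad f x \<bullet> h)" by (rule ext)
  then show ?thesis using d by simp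
qed

lemma pd_eqI:
  fixes f :: "real^'n::finite \<Rightarrow> real"
  assumes "(f has_derivative f') (at x)"
  shows "pd i f x = f' (axis i 1)"
  using frechet_derivative_at[OF assms] by (simp add: pd_def)

lemma grad_eqI:
  fixes f :: "real^'n::finite \<Rightarrow> real"
  assumes "(f has_derivative (\<lambda>h. g \<bullet> h)) (at x)"
  shows "grad f x = g"
  using pd_eqI[OF assms] by (simp add: grad_def vec_eq_iff inner_axis)

lemma DERIV_along_line:
  fixes f :: "'a::real_normed_vector \<Rightarrow> real"
  assumes "(f has_derivative f') (at (x + t *\<^sub>R v))"
  shows "((\<lambda>t. f (x + t *\<^sub>R v)) has_real_derivative f' v) (at t)"
proof -
  have g: "((\<lambda>t. x + t *\<^sub>R v) has_derivative (\<lambda>h. h *\<^sub>R v)) (at t)"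
    by (auto intro!: derivative_eq_intros)
  have "((\<lambda>t. f (x + t *\<^sub>R v)) has_derivative (\<lambda>h. f' (h *\<^sub>R v))) (at t)"
    using has_derivative_compose[OF g assms] .
  moreover have "f' (h *\<^sub>R v) = f' v * h" for h
    using linear_cmul[OF has_derivative_linear[OF assms]] by simp
  ultimately show ?thesis by (simp add: has_field_derivative_def)
qed

lemma pd_mult:
  fixes f g :: "real^'n::finite \<Rightarrow> real"
  assumes "f differentiable (at x)" "g differentiable (at x)"
  shows "pd i (\<lambda>x. f x * g x) x = f x * pd i g x + pd i f x * g x"
proof -
  have "((\<lambda>x. f x * g x) has_derivative (\<lambda>h. f x * (grad g x \<bullet> h) + (grad f x \<bullet> h) * g x)) (at x)"
    by (rule has_derivative_mult[OF has_derivative_pd[OF assms(1)] has_derivative_pd[OF assms(2)]])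
  from pd_eqI[OF this, of i] show ?thesis by (simp add: grad_def inner_axis)
qed

lemma grad_add:
  fixes f g :: "real^'n::finite \<Rightarrow> real"
  assumes "f differentiable (at x)" "g differentiable (at x)"
  shows "grad (\<lambda>x. f x + g x) x = grad f x + grad g x"
  by (rule grad_eqI) (auto intro!: derivative_eq_intros has_derivative_pd[OF assms(1)]
      has_derivative_pd[OF assms(2)] simp: inner_add_left)

lemma grad_cmult:
  fixes f :: "real^'n::finite \<Rightarrow> real"
  assumes "f differentiable (at x)"
  shows "grad (\<lambda>x. c * f x) x = c *\<^sub>R grad f x"
  by (rule grad_eqI) (auto intro!: derivative_eq_intros has_derivative_pd[OF assms(1)])

lemma grad_comp:
  fixes f :: "real^'n::finite \<Rightarrow> real"
  assumes "f differentiable (at x)" "(p has_real_derivative d) (at (f x))"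
  shows "grad (\<lambda>x. p (f x)) x = d *\<^sub>R grad f x"
proof (rule grad_eqI)
  have "(p has_derivative (\<lambda>h. d * h)) (at (f x))"
    using assms(2) by (simp add: has_field_derivative_def)
  from has_derivative_compose[OF has_derivative_pd[OF assms(1)] this]
  show "((\<lambda>x. p (f x)) has_derivative (\<bullet>) (d *\<^sub>R grad f x)) (at x)"
    by (simp only: inner_scaleR_left[abs_def])
qed

lemma differentiable_comp_real:
  fixes f :: "'a::real_normed_vector \<Rightarrow> real"
  assumes "f differentiable (at x)" "(p has_real_derivative d) (at (f x))"
  shows "(\<lambda>x. p (f x)) differentiable (at x)"
proof -
  have "p differentiable (at (f x))" using assms(2) real_differentiable_def by blast
  from differentiable_chain_at[OF assms(1) this] show ?thesis by (simp add: o_def)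
qed

lemma grad_nth [simp]: "grad f x $ i = pd i f x"
  by (simp add: grad_def)

text \<open>\<open>smooth\<close> speaks of all finite lists of indices at once. Recording the order
  as a number turns the Leibniz and chain rules into inductions, since the derivative of a product
  or a composition is built from functions of which one order less is demanded.\<close>

fun diff_upto :: "nat \<Rightarrow> (real^'n::finite \<Rightarrow> real) \<Rightarrow> bool" where
  "diff_upto 0 f \<longleftrightarrow> (\<forall>x. f differentiable (at x))"
| "diff_upto (Suc n) f \<longleftrightarrow> (\<forall>x. f differentiable (at x)) \<and> (\<forall>i. diff_upto n (pd i f))"

lemma diff_upto_diff: "diff_upto n f \<Longrightarrow> f differentiable (at x)"
  by (cases n) auto

lemma diff_upto_Suc_D: "diff_upto (Suc n) f \<Longrightarrow> diff_upto n f"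
  by (induction n arbitrary: f) auto

lemma diff_upto_iff:
  "diff_upto n f \<longleftrightarrow> (\<forall>is x. length is \<le> n \<longrightarrow> fold (\<lambda>i g. pd i g) is f differentiable (at x))"
proof (induction n arbitrary: f)
  case (Suc n)
  show ?case
  proof
    assume L: "diff_upto (Suc n) f"
    show "\<forall>is x. length is \<le> Suc n \<longrightarrow> fold (\<lambda>i g. pd i g) is f differentiable (at x)"
    proof (intro allI impI)
      fix "is" :: "'a list" and x
      assume "length is \<le> Suc n"
      then show "fold (\<lambda>i g. pd i g) is f differentiable (at x)"
        using L Suc.IH by (cases "is") auto
    qed
  next
    assume R: "\<forall>is x. length is \<le> Suc n \<longrightarrow> fold (\<lambda>i g. pd i g) is f differentiable (at x)"
    have "f differentiable (at x)" for x
      using R[rule_format, of "[]"] by simp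
    moreover have "diff_upto n (pd i f)" for i
      unfolding Suc.IH using R[rule_format, of "i # _"] by simp
    ultimately show "diff_upto (Suc n) f" by simp
  qed
qed auto

lemma smooth_iff_diff_upto: "smooth f \<longleftrightarrow> (\<forall>n. diff_upto n f)"
  unfolding smooth_def diff_upto_iff by auto

lemma diff_upto_const: "diff_upto n (\<lambda>x. c)"
proof (induction n arbitrary: c)
  case (Suc n)
  have "pd i (\<lambda>x. c) = (\<lambda>x. 0)" for i :: 'a
    by (auto simp: pd_def)
  then show ?case using Suc by auto
qed auto

lemma diff_upto_add: "diff_upto n f \<Longrightarrow> diff_upto n g \<Longrightarrow> diff_upto n (\<lambda>x. f x + g x)"
proof (induction n arbitrary: f g)
  case (Suc n)
  have "pd i (\<lambda>x. f x + g x) = (\<lambda>x. pd i f x + pd i g x)" for i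
    using grad_add[of f _ g] Suc.prems by (auto simp: vec_eq_iff)
  then show ?case using Suc by auto
qed auto

lemma diff_upto_mult: "diff_upto n f \<Longrightarrow> diff_upto n g \<Longrightarrow> diff_upto n (\<lambda>x. f x * g x)"
proof (induction n arbitrary: f g)
  case (Suc n)
  have "pd i (\<lambda>x. f x * g x) = (\<lambda>x. f x * pd i g x + pd i f x * g x)" for i
    using pd_mult[of f _ g] Suc.prems by auto
  moreover have "diff_upto n f" "diff_upto n g" using Suc.prems diff_upto_Suc_D by blast+
  ultimately show ?case using Suc by (auto intro!: diff_upto_add)
qed auto

text \<open>Infinite differentiability in one variable, certified by a set closed under passing to
  derivatives. For an explicit function it is enough to exhibit such a family, instead of a formula
  for the n-th derivative.\<close>

definition smooth1 :: "(real \<Rightarrow> real) \<Rightarrow> bool" where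
  "smooth1 p \<longleftrightarrow> (\<exists>S. p \<in> S \<and> (\<forall>q\<in>S. \<exists>q'\<in>S. \<forall>s. (q has_real_derivative q' s) (at s)))"

lemma smooth1_deriv:
  assumes "smooth1 p"
  obtains p' where "smooth1 p'" "\<And>s. (p has_real_derivative p' s) (at s)"
  using assms unfolding smooth1_def by blast

lemma smooth1_affine:
  assumes "smooth1 p" shows "smooth1 (\<lambda>s. A * p s + B)"
proof -
  obtain S where S: "p \<in> S" "\<forall>q\<in>S. \<exists>q'\<in>S. \<forall>s. (q has_real_derivative q' s) (at s)"
    using assms unfolding smooth1_def by blast
  let ?S = "{\<lambda>s. A * q s + B' | q B'. q \<in> S}"
  have "\<exists>q'\<in>?S. \<forall>s. (q has_real_derivative q' s) (at s)" if q: "q \<in> ?S" for q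
  proof -
    obtain r B' where r: "r \<in> S" "q = (\<lambda>s. A * r s + B')" using q by auto
    obtain r' where r': "r' \<in> S" "\<forall>s. (r has_real_derivative r' s) (at s)" using S(2) r(1) by blast
    have "\<forall>s. (q has_real_derivative A * r' s + 0) (at s)"
      unfolding r(2) using r'(2) by (auto intro!: derivative_eq_intros)
    then show ?thesis by (rule bexI[where x = "\<lambda>s. A * r' s + 0"]) (use r'(1) in blast)
  qed
  then show ?thesis unfolding smooth1_def by (intro exI[of _ ?S]) (use S(1) in blast)
qed

text \<open>The induction has to vary \<open>p\<close>: the outer factor of the derivative is
  \<open>p'\<close> composed with \<open>f\<close>, and \<open>p'\<close> comes from the same closed
  family.\<close>

lemma diff_upto_comp: "smooth1 p \<Longrightarrow> diff_upto n f \<Longrightarrow> diff_upto n (\<lambda>x. p (f x))"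
proof (induction n arbitrary: p f)
  case 0
  then show ?case
    by (metis diff_upto.simps(1) differentiable_comp_real smooth1_deriv)
next
  case (Suc n)
  obtain p' where p': "smooth1 p'" "\<And>s. (p has_real_derivative p' s) (at s)"
    using smooth1_deriv[OF Suc.prems(1)] by blast
  have "pd i (\<lambda>x. p (f x)) = (\<lambda>x. p' (f x) * pd i f x)" for i
    using grad_comp[of f _ p] p'(2) Suc.prems by (auto simp: vec_eq_iff)
  moreover have "diff_upto n f" using Suc.prems diff_upto_Suc_D by blast
  moreover have "(\<lambda>x. p (f x)) differentiable (at x)" for x
    using Suc.prems p'(2) differentiable_comp_real diff_upto_diff by metis
  ultimately show ?case using Suc p' by (auto intro!: diff_upto_mult)
qed

lemma test_funI:
  assumes "\<And>n. diff_upto n h" "compact K" "K \<subseteq> \<Omega>" "{x. h x \<noteq> 0} \<subseteq> K"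
  shows "test_fun \<Omega> h"
proof -
  have sub: "closure {x. h x \<noteq> 0} \<subseteq> K"
    using assms(2,4) by (simp add: closure_minimal compact_imp_closed)
  have "compact (K \<inter> closure {x. h x \<noteq> 0})" by (rule compact_Int_closed[OF assms(2) closed_closure])
  then show ?thesis using assms sub by (auto simp: test_fun_def smooth_iff_diff_upto inf_absorb2)
qed

lemma test_fun_diff_upto: "test_fun \<Omega> f \<Longrightarrow> diff_upto n f"
  by (simp add: test_fun_def smooth_iff_diff_upto)

lemma test_fun_support:
  assumes "test_fun \<Omega> f"
  obtains K where "compact K" "K \<subseteq> \<Omega>" "{x. f x \<noteq> 0} \<subseteq> K"
  by (rule that[of "closure {x. f x \<noteq> 0}"]) (use assms closure_subset[of "{x. f x \<noteq> 0}"] in \<open>simp_all add: test_fun_def\<close>)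

lemma test_fun_zero: "test_fun \<Omega> (\<lambda>x. 0)"
  by (rule test_funI[of _ "{}"]) (auto simp: diff_upto_const)

lemma test_fun_mult:
  assumes "\<And>n. diff_upto n f" "test_fun \<Omega> g" shows "test_fun \<Omega> (\<lambda>x. f x * g x)"
proof -
  obtain K where K: "compact K" "K \<subseteq> \<Omega>" "{x. g x \<noteq> 0} \<subseteq> K" by (rule test_fun_support[OF assms(2)])
  show ?thesis
    by (rule test_funI[OF diff_upto_mult[OF assms(1) test_fun_diff_upto[OF assms(2)]] K(1,2)]) (use K(3) in auto)
qed

lemma test_fun_cmult: "test_fun \<Omega> f \<Longrightarrow> test_fun \<Omega> (\<lambda>x. c * f x)"
  by (rule test_fun_mult[OF diff_upto_const])

lemma test_fun_add:
  assumes "test_fun \<Omega> f" "test_fun \<Omega> g" shows "test_fun \<Omega> (\<lambda>x. f x + g x)"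
proof -
  obtain K where K: "compact K" "K \<subseteq> \<Omega>" "{x. f x \<noteq> 0} \<subseteq> K" by (rule test_fun_support[OF assms(1)])
  obtain L where L: "compact L" "L \<subseteq> \<Omega>" "{x. g x \<noteq> 0} \<subseteq> L" by (rule test_fun_support[OF assms(2)])
  have "{x. f x + g x \<noteq> 0} \<subseteq> {x. f x \<noteq> 0} \<union> {x. g x \<noteq> 0}" by auto
  then have "{x. f x + g x \<noteq> 0} \<subseteq> K \<union> L" using K(3) L(3) by blast
  then show ?thesis
    by (rule test_funI[OF diff_upto_add[OF test_fun_diff_upto[OF assms(1)] test_fun_diff_upto[OF assms(2)]] compact_Un[OF K(1) L(1)], rotated])
      (use K L in auto)
qed

lemma test_fun_comp:
  assumes "test_fun \<Omega> f" "smooth1 p" "p 0 = 0" shows "test_fun \<Omega> (\<lambda>x. p (f x))"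
proof -
  obtain K where K: "compact K" "K \<subseteq> \<Omega>" "{x. f x \<noteq> 0} \<subseteq> K" by (rule test_fun_support[OF assms(1)])
  show ?thesis
    by (rule test_funI[OF diff_upto_comp[OF assms(2) test_fun_diff_upto[OF assms(1)]] K(1,2)]) (use K(3) assms(3) in auto)
qed

lemma LIMSEQ_one_over_Suc: "(\<lambda>k. 1 / real (Suc k)) \<longlonglongrightarrow> 0"
  using LIMSEQ_inverse_real_of_nat by (simp add: inverse_eq_divide)

section \<open>The sigmoid and the soft plus function\<close>

definition sigmoid :: "real \<Rightarrow> real" where "sigmoid s = 1 / (1 + exp (- s))"

lemma sigmoid_bounds: "0 < sigmoid s" "sigmoid s < 1"
  by (auto simp: sigmoid_def field_simps add_pos_pos)

lemma sigmoid_0 [simp]: "sigmoid 0 = 1/2" by (simp add: sigmoid_def)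

lemma DERIV_sigmoid: "(sigmoid has_real_derivative sigmoid s * (1 - sigmoid s)) (at s)"
proof -
  have p: "1 + exp (- s) > 0" by (simp add: add_pos_pos)
  have "((\<lambda>s. 1 / (1 + exp (- s))) has_real_derivative exp (- s) / (1 + exp (- s))^2) (at s)"
    using p by (auto intro!: derivative_eq_intros simp: power2_eq_square)
  moreover have "exp (- s) / (1 + exp (- s))^2 = sigmoid s * (1 - sigmoid s)"
    using p unfolding sigmoid_def by (simp add: field_simps power2_eq_square)
  ultimately show ?thesis by (simp add: sigmoid_def[abs_def])
qed

text \<open>The derivative of \<open>sigmoid\<close> is \<open>sigmoid * (1 - sigmoid)\<close>, so
  polynomials in the sigmoid times this exponential form a family closed under differentiation. It
  contains the derivative of the soft plus function (k = 0) and, up to a constant factor, the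
  exponentials of the truncation \<open>tau\<close>.\<close>

lemma smooth1_sigmoid_exp:
  "smooth1 (\<lambda>s. poly P (sigmoid (c * s + d)) * exp (k * sigmoid (c * s + d)))"
proof -
  let ?S = "{\<lambda>s. poly P (sigmoid (c * s + d)) * exp (k * sigmoid (c * s + d)) |P. True}"
  have "\<exists>q'\<in>?S. \<forall>s. (q has_real_derivative q' s) (at s)" if q: "q \<in> ?S" for q
  proof -
    obtain P where P: "q = (\<lambda>s. poly P (sigmoid (c * s + d)) * exp (k * sigmoid (c * s + d)))" using q by auto
    let ?P' = "smult c ((pderiv P + smult k P) * ([:0, 1:] * [:1, -1:]))"
    have "(q has_real_derivative poly ?P' (sigmoid (c * s + d)) * exp (k * sigmoid (c * s + d))) (at s)" for s
    proof -
      have s: "((\<lambda>s. sigmoid (c * s + d)) has_real_derivative c * (sigmoid (c * s + d) * (1 - sigmoid (c * s + d)))) (at s)"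
      proof -
        have "((\<lambda>s. c * s + d) has_real_derivative c) (at s)" by (auto intro!: derivative_eq_intros)
        from DERIV_chain2[where f = sigmoid and g = "\<lambda>s. c * s + d", OF DERIV_sigmoid this]
        show ?thesis by (simp add: mult.commute)
      qed
      have "((\<lambda>s. poly P (sigmoid (c * s + d))) has_real_derivative poly (pderiv P) (sigmoid (c * s + d)) * (c * (sigmoid (c * s + d) * (1 - sigmoid (c * s + d))))) (at s)"
        using DERIV_chain2[OF poly_DERIV s] .
      then show ?thesis unfolding P using s
        by (auto intro!: derivative_eq_intros simp: algebra_simps)
    qed
    then have "\<forall>s. (q has_real_derivative poly ?P' (sigmoid (c * s + d)) * exp (k * sigmoid (c * s + d))) (at s)"
      by (rule allI)
    then show ?thesis
      by (rule bexI[where x = "\<lambda>s. poly ?P' (sigmoid (c * s + d)) * exp (k * sigmoid (c * s + d))"]) blast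
  qed
  then show ?thesis unfolding smooth1_def by (intro exI[of _ ?S]) blast
qed

text \<open>A smooth approximation of the positive part with error at most \<open>e * ln 2\<close>,
  whose derivative is a rescaled sigmoid and so stays between 0 and 1.\<close>

definition softplus :: "real \<Rightarrow> real \<Rightarrow> real" where
  "softplus e s = e * ln (1 + exp (s / e))"

lemma DERIV_softplus:
  assumes "e > 0"
  shows "((\<lambda>s. softplus e (s - k) + c) has_real_derivative sigmoid ((s - k) / e)) (at s)"
proof -
  have p: "1 + exp t > 0" for t::real by (simp add: add_pos_pos)
  have "exp t / (1 + exp t) = sigmoid t" for t
    using p[of t] p[of "-t"] by (simp add: sigmoid_def field_simps exp_minus)
  then show ?thesis using p[of "(s-k)/e"] assms unfolding softplus_def
    by (auto intro!: derivative_eq_intros simp: divide_simps)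
qed

lemma smooth1_softplus:
  assumes "e > 0"
  shows "smooth1 (\<lambda>s. softplus e (s - k) + c)"
proof -
  have "smooth1 (\<lambda>s. poly [:0,1:] (sigmoid ((1/e) * s + (-k/e))) * exp (0 * sigmoid ((1/e) * s + (-k/e))))"
    by (rule smooth1_sigmoid_exp)
  then have "smooth1 (\<lambda>s. sigmoid ((s - k) / e))" by (simp add: diff_divide_distrib)
  then obtain S where S: "(\<lambda>s. sigmoid ((s - k) / e)) \<in> S" "\<forall>q\<in>S. \<exists>q'\<in>S. \<forall>s. (q has_real_derivative q' s) (at s)"
    unfolding smooth1_def by blast
  show ?thesis unfolding smooth1_def
  proof (intro exI[of _ "insert (\<lambda>s. softplus e (s - k) + c) S"] conjI ballI)
    fix q assume "q \<in> insert (\<lambda>s. softplus e (s - k) + c) S"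
    then show "\<exists>q'\<in>insert (\<lambda>s. softplus e (s - k) + c) S. \<forall>s. (q has_real_derivative q' s) (at s)"
    proof
      assume "q = (\<lambda>s. softplus e (s - k) + c)"
      then have "\<forall>s. (q has_real_derivative sigmoid ((s - k) / e)) (at s)"
        using DERIV_softplus[OF assms] by simp
      then show ?thesis by (rule bexI[where x = "\<lambda>s. sigmoid ((s - k) / e)"]) (use S(1) in simp)
    qed (use S(2) in blast)
  qed simp
qed

lemma softplus_bounds:
  assumes "e > 0"
  shows "max s 0 \<le> softplus e s" "softplus e s \<le> max s 0 + e * ln 2"
proof -
  have "exp (s/e) \<le> 1 + exp (s/e)" "1 \<le> 1 + exp (s/e)" by auto
  then have "s/e \<le> ln (1 + exp (s/e))" "0 \<le> ln (1 + exp (s/e))"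
    by (simp_all add: ln_ge_iff add_pos_pos)
  then show "max s 0 \<le> softplus e s" using assms by (simp add: softplus_def field_simps)
  have "1 + exp (s/e) \<le> 2 * exp (max s 0 / e)"
    using assms by (cases "s \<ge> 0") (auto simp: max_def divide_nonpos_pos)
  then have "ln (1 + exp (s/e)) \<le> ln (2 * exp (max s 0 / e))"
    by (subst ln_le_cancel_iff) (auto simp: add_pos_pos)
  also have "\<dots> = ln 2 + max s 0 / e" by (simp add: ln_mult)
  finally show "softplus e s \<le> max s 0 + e * ln 2"
    using assms by (simp add: softplus_def field_simps)
qed

section \<open>Finsler norms\<close>

locale finsler =
  fixes F :: "real^'n::finite \<Rightarrow> real" and a b \<mu> \<Lambda> :: real
  assumes F_admissible: "admissible_F F a b \<mu> \<Lambda>"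
begin

text \<open>The gradient of \<open>F^2 / 2\<close>. At 0 the value of \<open>grad F\<close> is
  arbitrary, but it is multiplied by \<open>F 0 = 0\<close>, which gives the correct gradient
  there.\<close>

definition flux :: "real^'n \<Rightarrow> real^'n" where "flux \<xi> = F \<xi> *\<^sub>R grad F \<xi>"

lemma F_hom: "F (t *\<^sub>R \<xi>) = \<bar>t\<bar> * F \<xi>"
  and ab_pos: "0 < a" "a \<le> b" "0 < b" and mu_pos: "0 < \<mu>"
  and F_ge: "a * norm \<xi> \<le> F \<xi>" and F_le: "F \<xi> \<le> b * norm \<xi>"
  and F_nonneg: "0 \<le> F \<xi>"
  and F_diff: "\<xi> \<noteq> 0 \<Longrightarrow> F differentiable (at \<xi>)"
  and pd_F_diff: "\<xi> \<noteq> 0 \<Longrightarrow> pd i F differentiable (at \<xi>)"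
  and F_convex: "convex_on UNIV F"
  using F_admissible unfolding admissible_F_def by (meson order_less_le_trans)+

lemma F_0 [simp]: "F 0 = 0" using F_hom[of 0 0] by simp

lemma F_hess: "norm \<xi> = 1 \<Longrightarrow> \<xi> \<bullet> V = 0 \<Longrightarrow>
   \<mu>^2 * (norm V)^2 \<le> (\<Sum>i\<in>UNIV. \<Sum>j\<in>UNIV. pd j (pd i F) \<xi> * V $ i * V $ j)"
  using F_admissible unfolding admissible_F_def by blast

lemma F_has_derivative: "\<xi> \<noteq> 0 \<Longrightarrow> (F has_derivative (\<lambda>h. grad F \<xi> \<bullet> h)) (at \<xi>)"
  by (rule has_derivative_pd[OF F_diff])

lemma Qflux_eq: "Qflux F \<xi> V = flux \<xi> \<bullet> V"
proof (cases "\<xi> = 0")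
  case False
  then show ?thesis using frechet_derivative_at[OF F_has_derivative[OF False]]
    by (metis Qflux_def flux_def inner_scaleR_left)
qed (simp add: Qflux_def flux_def)

lemma flux_0 [simp]: "flux 0 = 0" by (simp add: flux_def)

lemma F_subadd: "F (x + y) \<le> F x + F y"
proof -
  have "F ((1/2) *\<^sub>R (2 *\<^sub>R x) + (1/2) *\<^sub>R (2 *\<^sub>R y)) \<le> (1/2) * F (2 *\<^sub>R x) + (1/2) * F (2 *\<^sub>R y)"
    using convex_onD[OF F_convex, of "1/2" "2 *\<^sub>R x" "2 *\<^sub>R y"] by simp
  then show ?thesis using F_hom[of 2 x] F_hom[of 2 y] by simp
qed

text \<open>Subadditivity and homogeneity bound every difference quotient of \<open>F\<close> in
  direction \<open>h\<close> by \<open>F h\<close>. In other words, the gradient lies in the unit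
  ball of the norm dual to \<open>F\<close>.\<close>

lemma grad_F_inner_le:
  assumes "\<xi> \<noteq> 0" shows "grad F \<xi> \<bullet> h \<le> F h"
proof -
  have d: "((\<lambda>t. F (\<xi> + t *\<^sub>R h)) has_real_derivative grad F \<xi> \<bullet> h) (at 0)"
    using DERIV_along_line[where x = \<xi> and t = 0 and v = h and f = F and f' = "\<lambda>h. grad F \<xi> \<bullet> h"] F_has_derivative[OF assms] assms by simp
  then have "((\<lambda>t. (F (\<xi> + t *\<^sub>R h) - F \<xi>) / t) \<longlongrightarrow> grad F \<xi> \<bullet> h) (at 0)"
    unfolding has_field_derivative_iff by simp
  then have lim: "((\<lambda>t. (F (\<xi> + t *\<^sub>R h) - F \<xi>) / t) \<longlongrightarrow> grad F \<xi> \<bullet> h) (at_right 0)"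
    by (rule tendsto_mono[rotated]) (simp add: at_le)
  show ?thesis
  proof (rule tendsto_upperbound[OF lim])
    show "\<forall>\<^sub>F t in at_right 0. (F (\<xi> + t *\<^sub>R h) - F \<xi>) / t \<le> F h"
    proof (rule eventually_at_rightI[of 0 1])
      fix t :: real assume "t \<in> {0<..<1}"
      then show "(F (\<xi> + t *\<^sub>R h) - F \<xi>) / t \<le> F h"
        using F_subadd[of \<xi> "t *\<^sub>R h"] F_hom[of t h] by (simp add: field_simps)
    qed simp
  qed simp
qed

lemma grad_F_norm: "\<xi> \<noteq> 0 \<Longrightarrow> norm (grad F \<xi>) \<le> b"
proof -
  assume "\<xi> \<noteq> 0"
  then have "norm (grad F \<xi>) * norm (grad F \<xi>) \<le> b * norm (grad F \<xi>)"
    using grad_F_inner_le[of \<xi> "grad F \<xi>"] F_le[of "grad F \<xi>"] 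
    by (simp add: dot_square_norm power2_eq_square[symmetric])
  then show ?thesis using ab_pos by (cases "grad F \<xi> = 0") auto
qed

lemma euler:
  assumes "\<xi> \<noteq> 0" shows "grad F \<xi> \<bullet> \<xi> = F \<xi>"
proof -
  have "((\<lambda>t. F (\<xi> + t *\<^sub>R \<xi>)) has_real_derivative grad F \<xi> \<bullet> \<xi>) (at 0)"
    using DERIV_along_line[where x = \<xi> and t = 0 and v = \<xi> and f = F and f' = "\<lambda>h. grad F \<xi> \<bullet> h"] F_has_derivative[OF assms] assms by simp
  moreover have "((\<lambda>t. F (\<xi> + t *\<^sub>R \<xi>)) has_real_derivative F \<xi>) (at 0)"
  proof (rule has_field_derivative_transform_within_open[of "\<lambda>t. (1 + t) * F \<xi>" _ _ "{-1<..<1}"])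
    fix t :: real assume "t \<in> {-1<..<1}"
    then show "(1 + t) * F \<xi> = F (\<xi> + t *\<^sub>R \<xi>)"
      using F_hom[of "1 + t" \<xi>] by (simp add: scaleR_add_left)
  qed (auto intro!: derivative_eq_intros)
  ultimately show ?thesis using DERIV_unique by blast
qed

lemma grad_F_hom:
  assumes "\<xi> \<noteq> 0" "r > 0" shows "grad F (r *\<^sub>R \<xi>) = grad F \<xi>"
proof -
  have "((\<lambda>x. r *\<^sub>R x) has_derivative (\<lambda>h. r *\<^sub>R h)) (at \<xi>)"
    by (auto intro!: derivative_eq_intros)
  from has_derivative_compose[OF this, of F "\<lambda>h. grad F (r *\<^sub>R \<xi>) \<bullet> h"] F_has_derivative[of "r *\<^sub>R \<xi>"] assms
  have 1: "((\<lambda>x. F (r *\<^sub>R x)) has_derivative (\<lambda>h. (r *\<^sub>R grad F (r *\<^sub>R \<xi>)) \<bullet> h)) (at \<xi>)" by simp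
  have 2: "((\<lambda>x. F (r *\<^sub>R x)) has_derivative (\<lambda>h. (r *\<^sub>R grad F \<xi>) \<bullet> h)) (at \<xi>)"
    using has_derivative_mult_right[OF F_has_derivative[OF assms(1)], of r] assms by (simp add: F_hom)
  have "r *\<^sub>R grad F (r *\<^sub>R \<xi>) = r *\<^sub>R grad F \<xi>"
    using grad_eqI[OF 1] grad_eqI[OF 2] by (rule trans[OF sym])
  then show ?thesis using assms by simp
qed

section \<open>Second derivatives of F and uniform convexity of its square\<close>

definition D2 :: "real^'n \<Rightarrow> real^'n \<Rightarrow> real^'n \<Rightarrow> real" where
  "D2 \<xi> V W = (\<Sum>i\<in>UNIV. \<Sum>j\<in>UNIV. pd j (pd i F) \<xi> * V $ i * W $ j)"

lemma D2_simps:
  "D2 \<xi> (V + V') W = D2 \<xi> V W + D2 \<xi> V' W" "D2 \<xi> V (W + W') = D2 \<xi> V W + D2 \<xi> V W'"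
  "D2 \<xi> (c *\<^sub>R V) W = c * D2 \<xi> V W" "D2 \<xi> V (c *\<^sub>R W) = c * D2 \<xi> V W"
  by (simp_all add: D2_def algebra_simps sum.distrib sum_distrib_left)

lemma grad_F_has_derivative:
  assumes "\<xi> \<noteq> 0"
  shows "((\<lambda>x. grad F x \<bullet> V) has_derivative (\<lambda>h. D2 \<xi> V h)) (at \<xi>)"
proof -
  have "((\<lambda>x. \<Sum>i\<in>UNIV. pd i F x * V $ i) has_derivative (\<lambda>h. \<Sum>i\<in>UNIV. (grad (pd i F) \<xi> \<bullet> h) * V $ i)) (at \<xi>)"
    by (intro has_derivative_sum has_derivative_mult_left has_derivative_pd pd_F_diff assms)
  then show ?thesis
    by (simp add: inner_vec_def D2_def sum_distrib_left sum_distrib_right mult_ac)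
qed

lemma D2_hom:
  assumes "\<xi> \<noteq> 0" "r > 0" shows "D2 (r *\<^sub>R \<xi>) V W = D2 \<xi> V W / r"
proof -
  have "((\<lambda>x. r *\<^sub>R x) has_derivative (\<lambda>h. r *\<^sub>R h)) (at \<xi>)"
    by (auto intro!: derivative_eq_intros)
  from has_derivative_compose[OF this, of "\<lambda>x. grad F x \<bullet> V"] grad_F_has_derivative[of "r *\<^sub>R \<xi>" V] assms
  have 1: "((\<lambda>x. grad F (r *\<^sub>R x) \<bullet> V) has_derivative (\<lambda>h. D2 (r *\<^sub>R \<xi>) V (r *\<^sub>R h))) (at \<xi>)" by simp
  have "((\<lambda>x. grad F (r *\<^sub>R x) \<bullet> V) has_derivative (\<lambda>h. D2 \<xi> V h)) (at \<xi>)"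
    by (rule has_derivative_transform_within_open[OF grad_F_has_derivative[OF assms(1)], of "- {0}"])
      (use assms grad_F_hom in auto)
  from has_derivative_unique[OF 1 this] have "D2 (r *\<^sub>R \<xi>) V (r *\<^sub>R W) = D2 \<xi> V W" by metis
  then show ?thesis using assms by (simp add: D2_simps field_simps)
qed

text \<open>In the second slot this holds because \<open>grad F\<close> is constant along rays. In
  the first slot it is what remains after Euler's identity has been differentiated in direction
  \<open>W\<close> and the terms \<open>grad F \<xi> \<bullet> W\<close> on both sides have been
  cancelled.\<close>

lemma D2_radial:
  assumes "\<xi> \<noteq> 0" shows "D2 \<xi> V \<xi> = 0" "D2 \<xi> \<xi> W = 0"
proof -
  have "((\<lambda>t. grad F (\<xi> + t *\<^sub>R \<xi>) \<bullet> V) has_real_derivative D2 \<xi> V \<xi>) (at 0)"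
    using DERIV_along_line[where x = \<xi> and t = 0 and v = \<xi> and f = "\<lambda>x. grad F x \<bullet> V" and f' = "\<lambda>h. D2 \<xi> V h"] grad_F_has_derivative[OF assms] assms by simp
  moreover have "((\<lambda>t. grad F (\<xi> + t *\<^sub>R \<xi>) \<bullet> V) has_real_derivative 0) (at 0)"
  proof (rule has_field_derivative_transform_within_open[of "\<lambda>t. grad F \<xi> \<bullet> V" _ _ "{-1<..<1}"])
    fix t :: real assume "t \<in> {-1<..<1}"
    then show "grad F \<xi> \<bullet> V = grad F (\<xi> + t *\<^sub>R \<xi>) \<bullet> V"
      using grad_F_hom[OF assms, of "1 + t"] by (simp add: scaleR_add_left)
  qed (auto intro!: derivative_eq_intros)
  ultimately show "D2 \<xi> V \<xi> = 0" using DERIV_unique by blast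
  have pdd: "((\<lambda>x. \<Sum>i\<in>UNIV. pd i F x * x $ i) has_derivative
     (\<lambda>h. \<Sum>i\<in>UNIV. pd i F \<xi> * h $ i + (grad (pd i F) \<xi> \<bullet> h) * \<xi> $ i)) (at \<xi>)"
    by (intro has_derivative_sum has_derivative_mult has_derivative_pd pd_F_diff assms
       bounded_linear_imp_has_derivative bounded_linear_vec_nth)
  have "(F has_derivative (\<lambda>h. \<Sum>i\<in>UNIV. pd i F \<xi> * h $ i + (grad (pd i F) \<xi> \<bullet> h) * \<xi> $ i)) (at \<xi>)"
  proof (rule has_derivative_transform_within_open[OF pdd, of "- {0}"])
    fix x :: "real^'n" assume "x \<in> - {0}"
    then show "(\<Sum>i\<in>UNIV. pd i F x * x $ i) = F x" using euler[of x] by (simp add: inner_vec_def)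
  qed (use assms in auto)
  from has_derivative_unique[OF this F_has_derivative[OF assms]]
  have "(\<Sum>i\<in>UNIV. pd i F \<xi> * W $ i + (grad (pd i F) \<xi> \<bullet> W) * \<xi> $ i) = grad F \<xi> \<bullet> W" by metis
  then show "D2 \<xi> \<xi> W = 0"
    by (simp add: inner_vec_def D2_def sum.distrib sum_distrib_left sum_distrib_right mult_ac)
qed

text \<open>The right-hand side is the second derivative of \<open>F^2 / 2\<close> in direction
  \<open>V\<close>. Ellipticity of \<open>F\<close> is assumed only orthogonally to \<xi>, so
  \<open>V\<close> is split into a radial part \<open>s *\<^sub>R \<xi>\<close> and an orthogonal
  part \<open>W\<close>. The Hessian of \<open>F\<close> sees only \<open>W\<close>, and Euler's
  identity recovers \<open>s\<close> from \<open>grad F \<xi> \<bullet> V\<close>. The bound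
  \<open>c \<le> a^2 / 2\<close> prepares for segments through the origin, where no second
  derivative exists.\<close>

lemma hess_lower:
  obtains c where "0 < c" "c \<le> a^2 / 2"
    "\<And>\<xi> V. \<xi> \<noteq> 0 \<Longrightarrow> 2 * c * (norm V)^2 \<le> (grad F \<xi> \<bullet> V)^2 + F \<xi> * D2 \<xi> V V"
proof -
  \<comment> \<open>The summand \<open>2 / a^2\<close> pays for the radial part in terms of
    \<open>X^2\<close>. The other is the factor in front of \<open>(norm W)^2\<close> divided by the
    constant \<open>a * \<mu>^2\<close> of the orthogonal estimate \<open>FD\<close>.\<close>
  define C where "C = 2 / a^2 + (2 * b^2 / a^2 + 1) / (a * \<mu>^2)"
  have C: "C > 0" unfolding C_def using ab_pos mu_pos by (intro add_pos_pos divide_pos_pos) (auto intro: add_nonneg_pos)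
  have main: "(norm V)^2 \<le> C * ((grad F \<xi> \<bullet> V)^2 + F \<xi> * D2 \<xi> V V)" if x: "\<xi> \<noteq> 0" for \<xi> V
  proof -
    define s where "s = (V \<bullet> \<xi>) / (\<xi> \<bullet> \<xi>)"
    define W where "W = V - s *\<^sub>R \<xi>"
    have V: "V = s *\<^sub>R \<xi> + W" by (simp add: W_def)
    have orth: "\<xi> \<bullet> W = 0" using x by (simp add: W_def s_def inner_diff_right inner_commute)
    define X where "X = grad F \<xi> \<bullet> V"
    have nV: "(norm V)^2 = s^2 * (norm \<xi>)^2 + (norm W)^2"
      unfolding V using orth
      by (simp only: power2_norm_eq_inner) (simp add: inner_add_left inner_add_right inner_commute power2_eq_square)
    have DV: "D2 \<xi> V V = D2 \<xi> W W"
      unfolding V using D2_radial[OF x] by (simp add: D2_simps)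
    define e where "e = (1 / norm \<xi>) *\<^sub>R \<xi>"
    have e: "norm e = 1" "e \<bullet> W = 0" "\<xi> = norm \<xi> *\<^sub>R e" "e \<noteq> 0" using x orth by (auto simp: e_def)
    have "\<mu>^2 * (norm W)^2 / norm \<xi> \<le> D2 e W W / norm \<xi>"
      using F_hess[OF e(1,2)] by (intro divide_right_mono) (auto simp: D2_def)
    also have "\<dots> = D2 \<xi> W W" using D2_hom[of e "norm \<xi>"] e x by simp
    finally have D: "\<mu>^2 * (norm W)^2 / norm \<xi> \<le> D2 \<xi> V V" using DV by simp
    have "(a * norm \<xi>) * (\<mu>^2 * (norm W)^2 / norm \<xi>) \<le> F \<xi> * D2 \<xi> V V"
      using F_ge D ab_pos by (intro mult_mono) (auto simp: F_nonneg)
    then have FD: "a * \<mu>^2 * (norm W)^2 \<le> F \<xi> * D2 \<xi> V V" using x by simp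
    have X: "X = s * F \<xi> + grad F \<xi> \<bullet> W"
      unfolding X_def V using euler[OF x] by (simp add: inner_add_right)
    have gW: "\<bar>grad F \<xi> \<bullet> W\<bar> \<le> b * norm W"
      using Cauchy_Schwarz_ineq2[of "grad F \<xi>" W] mult_right_mono[OF grad_F_norm[OF x], of "norm W"] by simp
    have "(a * norm \<xi>)^2 \<le> (F \<xi>)^2" using F_ge ab_pos by (intro power_mono) auto
    then have "s^2 * (a * norm \<xi>)^2 \<le> s^2 * (F \<xi>)^2" by (intro mult_left_mono) auto
    also have "\<dots> = (X - grad F \<xi> \<bullet> W)^2" using X by (simp add: power_mult_distrib)
    also have "\<dots> \<le> 2 * X^2 + 2 * (grad F \<xi> \<bullet> W)^2"
      using sum_squares_bound[of X "- (grad F \<xi> \<bullet> W)"] by (simp add: power2_diff)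
    also have "(grad F \<xi> \<bullet> W)^2 \<le> (b * norm W)^2"
      using gW by (metis abs_ge_zero power2_abs power_mono)
    finally have "a^2 * (s^2 * (norm \<xi>)^2) \<le> 2 * X^2 + 2 * b^2 * (norm W)^2"
      by (simp add: power_mult_distrib mult_ac)
    then have "s^2 * (norm \<xi>)^2 \<le> 2 / a^2 * X^2 + 2 * b^2 / a^2 * (norm W)^2"
      using ab_pos by (simp add: field_simps)
    then have "(norm V)^2 \<le> 2 / a^2 * X^2 + (2 * b^2 / a^2 + 1) * (norm W)^2"
      unfolding nV by (simp add: algebra_simps)
    also have "\<dots> = 2 / a^2 * X^2 + (2 * b^2 / a^2 + 1) / (a * \<mu>^2) * (a * \<mu>^2 * (norm W)^2)"
      using ab_pos mu_pos by simp
    also have "\<dots> \<le> C * X^2 + C * (F \<xi> * D2 \<xi> V V)"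
    proof (rule add_mono)
      show "2 / a^2 * X^2 \<le> C * X^2" using ab_pos mu_pos by (intro mult_right_mono) (auto simp: C_def)
      have 1: "(2 * b^2 / a^2 + 1) / (a * \<mu>^2) \<le> C" using ab_pos mu_pos by (auto simp: C_def)
      show "(2 * b^2 / a^2 + 1) / (a * \<mu>^2) * (a * \<mu>^2 * (norm W)^2) \<le> C * (F \<xi> * D2 \<xi> V V)"
        by (rule mult_mono[OF 1 FD]) (use C ab_pos in auto)
    qed
    finally show ?thesis by (simp add: X_def algebra_simps)
  qed
  define c where "c = min (1 / (2 * C)) (a^2 / 2)"
  show thesis
  proof (rule that[of c])
    show "0 < c" "c \<le> a^2 / 2" using C ab_pos by (auto simp: c_def)
    fix \<xi> V :: "real^'n" assume x: "\<xi> \<noteq> 0"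
    have "2 * c * (norm V)^2 \<le> (1 / C) * (norm V)^2" 
      using C by (intro mult_right_mono) (auto simp: c_def min_def field_simps)
    also have "\<dots> \<le> (grad F \<xi> \<bullet> V)^2 + F \<xi> * D2 \<xi> V V"
      using main[OF x, of V] C by (simp add: field_simps)
    finally show "2 * c * (norm V)^2 \<le> (grad F \<xi> \<bullet> V)^2 + F \<xi> * D2 \<xi> V V" .
  qed
qed

definition energy :: "real^'n \<Rightarrow> real" where "energy \<xi> = (F \<xi>)^2 / 2"

text \<open>Away from 0 this is Taylor's formula along the segment from x to y, with the second
  derivative bounded below by \<open>hess_lower\<close>. A segment meeting 0 is collinear with the
  origin, and homogeneity makes every term explicit.\<close>

lemma energy_strong:
  obtains c where "0 < c" "\<And>x y. energy x + flux x \<bullet> (y - x) + c * (norm (y - x))^2 \<le> energy y"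
proof -
  obtain c where c: "0 < c" "c \<le> a^2 / 2"
    "\<And>\<xi> V. \<xi> \<noteq> 0 \<Longrightarrow> 2 * c * (norm V)^2 \<le> (grad F \<xi> \<bullet> V)^2 + F \<xi> * D2 \<xi> V V"
    using hess_lower by blast
  have lower: "c * (norm x)^2 \<le> energy x" for x
  proof -
    have "(a * norm x)^2 \<le> (F x)^2" using F_ge ab_pos by (intro power_mono) auto
    then have "a^2 / 2 * (norm x)^2 \<le> energy x" by (simp add: energy_def power_mult_distrib)
    moreover have "c * (norm x)^2 \<le> a^2 / 2 * (norm x)^2" using c by (intro mult_right_mono) auto
    ultimately show ?thesis by simp
  qed
  have "energy x + flux x \<bullet> (y - x) + c * (norm (y - x))^2 \<le> energy y" for x y
  proof (cases "\<exists>t\<in>{0..1}. x + t *\<^sub>R (y - x) = 0")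
    case True
    then obtain t where t: "0 \<le> t" "t \<le> 1" "x + t *\<^sub>R (y - x) = 0" by auto
    show ?thesis
    proof (cases "x = 0")
      case True
      then show ?thesis using lower[of y] by (simp add: energy_def)
    next
      case False
      then have t0: "t > 0" using t by (cases "t = 0") auto
      \<comment> \<open>The end point y equals -s times x. With this s the left-over
        \<open>energy y - energy x - flux x \<bullet> (y - x)\<close> is exactly (1 + s)^2 times
        \<open>energy x\<close>.\<close>
      define s where "s = (1 - t) / t"
      have s: "s \<ge> 0" using t t0 by (simp add: s_def)
      have "t *\<^sub>R y = (t - 1) *\<^sub>R x" using t(3) by (simp add: algebra_simps)
      then have "(1 / t) *\<^sub>R (t *\<^sub>R y) = (1 / t) *\<^sub>R ((t - 1) *\<^sub>R x)" by (rule arg_cong)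
      moreover have "(1 / t) * (t - 1) = - s" using t0 by (simp add: s_def field_simps)
      ultimately have y: "y = (- s) *\<^sub>R x" using t0 by (simp only: scaleR_scaleR) simp
      have yx: "y - x = (- (1 + s)) *\<^sub>R x" unfolding y by (simp add: algebra_simps)
      have Ey: "energy y = s^2 * energy x" unfolding y energy_def F_hom using s by (simp add: power_mult_distrib)
      have fx: "flux x \<bullet> (y - x) = - (1 + s) * (2 * energy x)"
        unfolding yx flux_def energy_def using euler[OF False] by (simp add: power2_eq_square)
      have "(norm (y - x))^2 = (1 + s)^2 * (norm x)^2"
        unfolding yx using s by (simp add: power_mult_distrib)
      then have "c * (norm (y - x))^2 \<le> (1 + s)^2 * energy x"
        using mult_left_mono[OF lower[of x], of "(1 + s)^2"] by (simp add: mult_ac)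
      then show ?thesis unfolding fx Ey by (simp add: algebra_simps power2_eq_square)
    qed
  next
    case False
    define v where "v = y - x"
    have nz: "x + t *\<^sub>R v \<noteq> 0" if "0 \<le> t" "t \<le> 1" for t using False that by (auto simp: v_def)
    \<comment> \<open>After subtraction of the quadratic term the function is still convex on
      [0, 1], so the claim becomes \<open>k 1 \<ge> k 0 + k' 0\<close>.\<close>
    define k where "k = (\<lambda>t. energy (x + t *\<^sub>R v) - c * (norm v)^2 * t^2)"
    define k' where "k' = (\<lambda>t. F (x + t *\<^sub>R v) * (grad F (x + t *\<^sub>R v) \<bullet> v) - 2 * c * (norm v)^2 * t)"
    define k'' where "k'' = (\<lambda>t. (grad F (x + t *\<^sub>R v) \<bullet> v)^2 + F (x + t *\<^sub>R v) * D2 (x + t *\<^sub>R v) v v - 2 * c * (norm v)^2)"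
    have FD: "((\<lambda>t. F (x + t *\<^sub>R v)) has_real_derivative grad F (x + t *\<^sub>R v) \<bullet> v) (at t)"
      and GD: "((\<lambda>t. grad F (x + t *\<^sub>R v) \<bullet> v) has_real_derivative D2 (x + t *\<^sub>R v) v v) (at t)"
      if "0 \<le> t" "t \<le> 1" for t
      using DERIV_along_line[OF F_has_derivative[OF nz]] DERIV_along_line[OF grad_F_has_derivative[OF nz]] that by auto
    have k1: "(k has_real_derivative k' t) (at t)" if "0 \<le> t" "t \<le> 1" for t
      unfolding k_def k'_def energy_def using FD[OF that]
      by (auto intro!: derivative_eq_intros)
    have k2: "(k' has_real_derivative k'' t) (at t)" if "0 \<le> t" "t \<le> 1" for t
      unfolding k'_def k''_def using FD[OF that] GD[OF that]
      by (auto intro!: derivative_eq_intros simp: power2_eq_square)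
    have k3: "k'' t \<ge> 0" if "0 \<le> t" "t \<le> 1" for t
      using c(3)[OF nz[OF that], of v] by (simp add: k''_def)
    obtain z where z: "0 < z" "z < 1" "k 1 - k 0 = (1 - 0) * k' z"
      using MVT2[of 0 1 k k'] k1 by auto
    have "k' 0 \<le> k' z"
      by (rule DERIV_nonneg_imp_nondecreasing[of 0 z k']) (use k2 k3 z in \<open>force+\<close>)
    then have "k 1 \<ge> k 0 + k' 0" using z by simp
    then show ?thesis by (simp add: k_def k'_def v_def flux_def)
  qed
  then show thesis using c(1) that by blast
qed

lemma flux_norm: "norm (flux \<xi>) \<le> b^2 * norm \<xi>"
proof (cases "\<xi> = 0")
  case False
  have "norm (flux \<xi>) = F \<xi> * norm (grad F \<xi>)" by (simp add: flux_def F_nonneg)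
  also have "\<dots> \<le> (b * norm \<xi>) * b" using F_le grad_F_norm[OF False] ab_pos F_nonneg by (intro mult_mono) auto
  finally show ?thesis by (simp add: power2_eq_square mult_ac)
qed simp

lemma flux_self: "flux \<xi> \<bullet> \<xi> = (F \<xi>)^2"
  by (cases "\<xi> = 0") (simp_all add: flux_def euler power2_eq_square)

lemma F_cont: "isCont F \<xi>"
proof (cases "\<xi> = 0")
  case True
  have "(\<lambda>x. b * norm x) \<midarrow>0\<rightarrow> 0" by (auto intro!: tendsto_eq_intros)
  then have "F \<midarrow>0\<rightarrow> 0"
    by (rule Lim_null_comparison[rotated]) (auto simp: F_nonneg F_le)
  then show ?thesis unfolding True isCont_def by simp
qed (use F_diff differentiable_imp_continuous_within in blast)

lemma flux_cont: "isCont flux \<xi>"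
proof (cases "\<xi> = 0")
  case True
  have "(\<lambda>x::real^'n. b^2 * norm x) \<midarrow>0\<rightarrow> 0" by (auto intro!: tendsto_eq_intros)
  then have "flux \<midarrow>0\<rightarrow> 0"
    by (rule Lim_null_comparison[rotated]) (auto simp: flux_norm)
  then show ?thesis unfolding True isCont_def by simp
next
  case False
  have "isCont (pd i F) \<xi>" for i 
    using pd_F_diff[OF False] differentiable_imp_continuous_within by blast
  then have "isCont (grad F) \<xi>"
    unfolding isCont_def by (auto intro!: vec_tendstoI)
  then show ?thesis unfolding flux_def[abs_def] using F_cont
    by (auto intro!: continuous_intros)
qed

lemma flux_meas [measurable]: "flux \<in> borel_measurable borel"
  and F_meas [measurable]: "F \<in> borel_measurable borel"
  and energy_meas [measurable]: "energy \<in> borel_measurable borel"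
proof -
  show "flux \<in> borel_measurable borel" "F \<in> borel_measurable borel"
    using flux_cont F_cont by (auto intro!: borel_measurable_continuous_onI simp: continuous_on_eq_continuous_at)
  then show "energy \<in> borel_measurable borel" unfolding energy_def[abs_def] by measurable
qed

lemma energy_bounds: "a^2 / 2 * (norm x)^2 \<le> energy x" "energy x \<le> b^2 / 2 * (norm x)^2"
proof -
  have "(a * norm x)^2 \<le> (F x)^2" using F_ge ab_pos by (intro power_mono) auto
  then show "a^2 / 2 * (norm x)^2 \<le> energy x" by (simp add: energy_def power_mult_distrib)
  have "(F x)^2 \<le> (b * norm x)^2" using F_le F_nonneg by (intro power_mono) auto
  then show "energy x \<le> b^2 / 2 * (norm x)^2" by (simp add: energy_def power_mult_distrib)
qed

lemma energy_scale: "energy (s *\<^sub>R x) = s^2 * energy x"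
  by (simp add: energy_def F_hom power_mult_distrib)

end

section \<open>Square integrable functions\<close>

definition sq_int :: "'a measure \<Rightarrow> ('a \<Rightarrow> 'b::euclidean_space) \<Rightarrow> bool" where
  "sq_int M f \<longleftrightarrow> f \<in> borel_measurable M \<and> integrable M (\<lambda>x. (norm (f x))^2)"

definition sq_norm :: "'a measure \<Rightarrow> ('a \<Rightarrow> 'b::euclidean_space) \<Rightarrow> real" where
  "sq_norm M f = (LINT x|M. (norm (f x))^2)"

lemma sq_int_meas: "sq_int M f \<Longrightarrow> f \<in> borel_measurable M" 
  and sq_int_int: "sq_int M f \<Longrightarrow> integrable M (\<lambda>x. (norm (f x))^2)"
  by (auto simp: sq_int_def)

lemma sq_norm_nonneg [simp]: "0 \<le> sq_norm M f"
  by (auto simp: sq_norm_def intro!: integral_nonneg_AE)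

lemma norm_add_sq: "(norm (x + y))^2 \<le> 2 * (norm x)^2 + 2 * (norm (y::'b::real_normed_vector))^2"
proof -
  have "(norm (x + y))^2 \<le> (norm x + norm y)^2" by (intro power_mono norm_triangle_ineq) auto
  also have "\<dots> \<le> 2 * (norm x)^2 + 2 * (norm y)^2"
    using sum_squares_bound[of "norm x" "norm y"] by (simp add: power2_sum)
  finally show ?thesis .
qed

lemma sq_int_add:
  assumes "sq_int M f" "sq_int M g" shows "sq_int M (\<lambda>x. f x + g x)"
proof -
  have [measurable]: "f \<in> borel_measurable M" "g \<in> borel_measurable M"
    using assms by (auto simp: sq_int_def)
  have "integrable M (\<lambda>x. (norm (f x + g x))^2)"
  proof (rule Bochner_Integration.integrable_bound)
    show "integrable M (\<lambda>x. 2 * (norm (f x))^2 + 2 * (norm (g x))^2)"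
      using assms by (simp add: sq_int_def)
    show "AE x in M. norm ((norm (f x + g x))^2) \<le> norm (2 * (norm (f x))^2 + 2 * (norm (g x))^2)"
      using norm_add_sq by (intro AE_I2) simp
  qed measurable
  then show ?thesis by (simp add: sq_int_def)
qed

lemma sq_int_scale: "sq_int M f \<Longrightarrow> sq_int M (\<lambda>x. c *\<^sub>R f x)"
  unfolding sq_int_def by (auto simp: power_mult_distrib)

lemma sq_int_cmult: "sq_int M f \<Longrightarrow> sq_int M (\<lambda>x. c * (f x :: real))"
  using sq_int_scale[of M f c] by simp

lemma sq_int_diff: "sq_int M f \<Longrightarrow> sq_int M g \<Longrightarrow> sq_int M (\<lambda>x. f x - g x)"
  using sq_int_add[of M f "\<lambda>x. (- 1) *\<^sub>R g x"] sq_int_scale[of M g "- 1"] by simp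

lemma sq_int_zero: "sq_int M (\<lambda>x. 0)" by (simp add: sq_int_def)

lemma sq_int_bound:
  assumes "sq_int M g" "f \<in> borel_measurable M" "AE x in M. norm (f x) \<le> C * norm (g x)"
  shows "sq_int M f"
proof -
  have "integrable M (\<lambda>x. (norm (f x))^2)"
  proof (rule Bochner_Integration.integrable_bound[of M "\<lambda>x. C^2 * (norm (g x))^2"])
    show "AE x in M. norm ((norm (f x))^2) \<le> norm (C^2 * (norm (g x))^2)"
      using assms(3)
    proof eventually_elim
      case (elim x)
      then have "(norm (f x))^2 \<le> (C * norm (g x))^2" by (intro power_mono) auto
      then show ?case by (simp add: power_mult_distrib)
    qed
    show "integrable M (\<lambda>x. C^2 * (norm (g x))^2)" using sq_int_int[OF assms(1)] by simp
    show "(\<lambda>x. (norm (f x))^2) \<in> borel_measurable M" using assms(2) by measurable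
  qed
  then show ?thesis using assms(2) by (simp add: sq_int_def)
qed

lemma sq_int_norm: "sq_int M f \<Longrightarrow> sq_int M (\<lambda>x. norm (f x))"
  by (auto simp: sq_int_def)

lemma sq_int_mult_int:
  assumes "sq_int M f" "sq_int M g"
  shows "integrable M (\<lambda>x. norm (f x) * norm (g x))"
proof (rule Bochner_Integration.integrable_bound[of M "\<lambda>x. (norm (f x))^2 + (norm (g x))^2"])
  show "AE x in M. norm (norm (f x) * norm (g x)) \<le> norm ((norm (f x))^2 + (norm (g x))^2)"
  proof (rule AE_I2)
    fix x
    have "2 * (norm (f x) * norm (g x)) \<le> (norm (f x))^2 + (norm (g x))^2"
      using sum_squares_bound[of "norm (f x)" "norm (g x)"] by (simp add: mult.assoc)
    moreover have "0 \<le> norm (f x) * norm (g x)" by simp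
    ultimately have "norm (f x) * norm (g x) \<le> (norm (f x))^2 + (norm (g x))^2" by linarith
    then show "norm (norm (f x) * norm (g x)) \<le> norm ((norm (f x))^2 + (norm (g x))^2)" by simp
  qed
  show "integrable M (\<lambda>x. (norm (f x))^2 + (norm (g x))^2)" using assms by (auto simp: sq_int_def)
  have [measurable]: "f \<in> borel_measurable M" "g \<in> borel_measurable M" using assms by (auto simp: sq_int_def)
  show "(\<lambda>x. norm (f x) * norm (g x)) \<in> borel_measurable M" by measurable
qed

lemma sq_int_inner_int:
  assumes "sq_int M f" "sq_int M g"
  shows "integrable M (\<lambda>x. f x \<bullet> g x)"
  by (rule Bochner_Integration.integrable_bound[OF sq_int_mult_int[OF assms]])
    (use assms in \<open>auto simp: sq_int_def Cauchy_Schwarz_ineq2\<close>)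

lemma sq_norm_CS:
  assumes "sq_int M f" "sq_int M g"
  shows "(LINT x|M. norm (f x) * norm (g x)) \<le> sqrt (sq_norm M f) * sqrt (sq_norm M g)"
proof -
  note I = sq_int_mult_int[OF assms]
  have zero: "(LINT x|M. norm (p x) * norm (q x)) = 0" 
    if p: "sq_int M p" "sq_norm M p = 0" for p :: "'a \<Rightarrow> 'e::euclidean_space" and q :: "'a \<Rightarrow> 'f::euclidean_space"
  proof -
    have "AE x in M. (norm (p x))^2 = 0"
      using p integral_nonneg_eq_0_iff_AE[OF sq_int_int[OF p(1)]] by (simp add: sq_norm_def)
    then show ?thesis by (intro integral_eq_zero_AE) auto
  qed
  consider "sq_norm M f = 0" | "sq_norm M g = 0" | "sq_norm M f > 0" "sq_norm M g > 0"
    using sq_norm_nonneg[of M f] sq_norm_nonneg[of M g] by linarith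
  then show ?thesis
  proof cases
    case 1 then show ?thesis using zero[of f g] assms by simp
  next
    case 2 then show ?thesis using zero[of g f] assms by (simp add: mult.commute)
  next
    case 3
    define p where "p = sqrt (sq_norm M f)"
    define q where "q = sqrt (sq_norm M g)"
    have pq: "p > 0" "q > 0" "p^2 = sq_norm M f" "q^2 = sq_norm M g" using 3 by (auto simp: p_def q_def)
    \<comment> \<open>Young's inequality with the weights for which the integral of the right-hand
      side is exactly \<open>p * q\<close>.\<close>
    have pt: "norm (f x) * norm (g x) \<le> (q / (2 * p)) * (norm (f x))^2 + (p / (2 * q)) * (norm (g x))^2" for x
    proof -
      have "0 \<le> (q * norm (f x) - p * norm (g x))^2 / (2 * p * q)" using pq by simp
      also have "\<dots> = (q / (2 * p)) * (norm (f x))^2 + (p / (2 * q)) * (norm (g x))^2 - norm (f x) * norm (g x)"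
        using pq by (simp add: power2_diff field_simps power2_eq_square)
      finally show ?thesis by simp
    qed
    have "(LINT x|M. norm (f x) * norm (g x)) \<le> (LINT x|M. (q / (2 * p)) * (norm (f x))^2 + (p / (2 * q)) * (norm (g x))^2)"
      using I assms pt by (intro integral_mono) (auto simp: sq_int_def)
    also have "\<dots> = (q / (2 * p)) * p^2 + (p / (2 * q)) * q^2"
      using assms pq by (simp add: sq_int_def sq_norm_def)
    also have "\<dots> = p * q" using pq(1,2) by (simp add: field_simps power2_eq_square)
    finally show ?thesis by (simp add: p_def q_def)
  qed
qed

lemma sq_norm_CS_inner:
  assumes "sq_int M f" "sq_int M g"
  shows "\<bar>LINT x|M. f x \<bullet> g x\<bar> \<le> sqrt (sq_norm M f) * sqrt (sq_norm M g)"
proof -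
  have "\<bar>LINT x|M. f x \<bullet> g x\<bar> \<le> (LINT x|M. \<bar>f x \<bullet> g x\<bar>)"
    using integral_norm_bound[of M "\<lambda>x. f x \<bullet> g x"] by simp
  also have "\<dots> \<le> (LINT x|M. norm (f x) * norm (g x))"
    using sq_int_inner_int[OF assms] sq_int_mult_int[OF assms]
    by (intro integral_mono) (auto simp: Cauchy_Schwarz_ineq2)
  also note sq_norm_CS[OF assms]
  finally show ?thesis .
qed

lemma sq_norm_add: "sq_int M f \<Longrightarrow> sq_int M g \<Longrightarrow> sq_norm M (\<lambda>x. f x + g x) \<le> 2 * sq_norm M f + 2 * sq_norm M g"
proof -
  assume a: "sq_int M f" "sq_int M g"
  have "sq_norm M (\<lambda>x. f x + g x) \<le> (LINT x|M. 2 * (norm (f x))^2 + 2 * (norm (g x))^2)"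
    unfolding sq_norm_def using a sq_int_int[OF sq_int_add[OF a]]
    by (intro integral_mono) (auto simp: sq_int_def norm_add_sq)
  also have "\<dots> = 2 * sq_norm M f + 2 * sq_norm M g" using a by (simp add: sq_norm_def sq_int_def)
  finally show ?thesis .
qed

lemma sq_norm_scale: "sq_norm M (\<lambda>x. c *\<^sub>R f x) = c^2 * sq_norm M f"
  by (simp add: sq_norm_def power_mult_distrib)

lemma sq_norm_commute: "sq_norm M (\<lambda>x. f x - g x) = sq_norm M (\<lambda>x. g x - f x)"
  by (simp add: sq_norm_def norm_minus_commute)

lemma sq_norm_mono:
  assumes "sq_int M g" "f \<in> borel_measurable M" "AE x in M. norm (f x) \<le> C * norm (g x)"
  shows "sq_norm M f \<le> C^2 * sq_norm M g"
proof -
  have "sq_norm M f \<le> (LINT x|M. C^2 * (norm (g x))^2)"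
    unfolding sq_norm_def
  proof (rule integral_mono_AE)
    show "AE x in M. (norm (f x))^2 \<le> C^2 * (norm (g x))^2"
      using assms(3)
    proof eventually_elim
      case (elim x)
      then have "(norm (f x))^2 \<le> (C * norm (g x))^2" by (intro power_mono) auto
      then show ?case by (simp add: power_mult_distrib)
    qed
    show "integrable M (\<lambda>x. (norm (f x))^2)" by (rule sq_int_int[OF sq_int_bound[OF assms]])
    show "integrable M (\<lambda>x. C^2 * (norm (g x))^2)" using sq_int_int[OF assms(1)] by simp
  qed
  then show ?thesis by (simp add: sq_norm_def)
qed

lemma sq_norm_conv_inner:
  assumes "\<And>k. sq_int M (f k)" "sq_int M g" "sq_int M h" "(\<lambda>k. sq_norm M (\<lambda>x. f k x - g x)) \<longlonglongrightarrow> 0"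
  shows "(\<lambda>k. LINT x|M. h x \<bullet> f k x) \<longlonglongrightarrow> (LINT x|M. h x \<bullet> g x)"
proof -
  have "(\<lambda>k. (LINT x|M. h x \<bullet> f k x) - (LINT x|M. h x \<bullet> g x)) \<longlonglongrightarrow> 0"
  proof (rule Lim_null_comparison[of _ "\<lambda>k. sqrt (sq_norm M h) * sqrt (sq_norm M (\<lambda>x. f k x - g x))"])
    show "\<forall>\<^sub>F k in sequentially. norm ((LINT x|M. h x \<bullet> f k x) - (LINT x|M. h x \<bullet> g x))
        \<le> sqrt (sq_norm M h) * sqrt (sq_norm M (\<lambda>x. f k x - g x))"
    proof (rule always_eventually, rule allI)
      fix k
      have "(LINT x|M. h x \<bullet> f k x) - (LINT x|M. h x \<bullet> g x) = (LINT x|M. h x \<bullet> (f k x - g x))"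
        using sq_int_inner_int[OF assms(3) assms(1)] sq_int_inner_int[OF assms(3) assms(2)]
        by (simp add: inner_diff_right)
      then show "norm ((LINT x|M. h x \<bullet> f k x) - (LINT x|M. h x \<bullet> g x))
        \<le> sqrt (sq_norm M h) * sqrt (sq_norm M (\<lambda>x. f k x - g x))"
        using sq_norm_CS_inner[OF assms(3) sq_int_diff[OF assms(1,2)]] by simp
    qed
    show "(\<lambda>k. sqrt (sq_norm M h) * sqrt (sq_norm M (\<lambda>x. f k x - g x))) \<longlonglongrightarrow> 0"
      using tendsto_mult[OF tendsto_const tendsto_real_sqrt[OF assms(4)], of "sqrt (sq_norm M h)"] by simp
  qed
  then show ?thesis by (rule LIM_zero_cancel)
qed

text \<open>Fatou's lemma for real-valued integrals. It is the tool that turns uniform bounds along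
  an approximation into integrability of the limit.\<close>

lemma fatou_bound:
  fixes g :: "nat \<Rightarrow> 'a \<Rightarrow> real"
  assumes "\<And>k. integrable M (g k)" "\<And>k. AE x in M. 0 \<le> g k x" "\<And>k. integral\<^sup>L M (g k) \<le> C"
    "f \<in> borel_measurable M" "AE x in M. (\<lambda>k. g k x) \<longlonglongrightarrow> f x"
  shows "integrable M f" "integral\<^sup>L M f \<le> C"
proof -
  have pos: "AE x in M. \<forall>k. 0 \<le> g k x" using assms(2) by (simp add: AE_all_countable)
  have f0: "AE x in M. 0 \<le> f x" using assms(5) pos
    by eventually_elim (meson LIMSEQ_le_const)
  have [measurable]: "g k \<in> borel_measurable M" for k using assms(1) by auto
  have C0: "0 \<le> C" using order_trans[OF integral_nonneg_AE[OF assms(2)] assms(3)] .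
  have "(\<integral>\<^sup>+x. ennreal (f x) \<partial>M) = (\<integral>\<^sup>+x. liminf (\<lambda>k. ennreal (g k x)) \<partial>M)"
  proof (rule nn_integral_cong_AE)
    show "AE x in M. ennreal (f x) = liminf (\<lambda>k. ennreal (g k x))"
      using assms(5)
    proof eventually_elim
      case (elim x)
      then have "(\<lambda>k. ennreal (g k x)) \<longlonglongrightarrow> ennreal (f x)" by (rule tendsto_ennrealI)
      then show ?case by (simp add: lim_imp_Liminf)
    qed
  qed
  also have "\<dots> \<le> liminf (\<lambda>k. \<integral>\<^sup>+x. ennreal (g k x) \<partial>M)"
    by (rule nn_integral_liminf) measurable
  also have "\<dots> \<le> liminf (\<lambda>k. ennreal C)"
  proof (rule Liminf_mono, rule always_eventually, rule allI)
    fix k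
    show "(\<integral>\<^sup>+x. ennreal (g k x) \<partial>M) \<le> ennreal C"
      using nn_integral_eq_integral[OF assms(1,2)] assms(3)[of k] by (simp add: ennreal_leI)
  qed
  also have "\<dots> = ennreal C" by (simp add: Liminf_const)
  finally have le: "(\<integral>\<^sup>+x. ennreal (f x) \<partial>M) \<le> ennreal C" .
  then have "(\<integral>\<^sup>+x. ennreal (f x) \<partial>M) < \<infinity>" using ennreal_less_top le_less_trans by force
  moreover have "(\<integral>\<^sup>+x. ennreal (norm (f x)) \<partial>M) = (\<integral>\<^sup>+x. ennreal (f x) \<partial>M)"
    by (rule nn_integral_cong_AE) (use f0 in auto)
  ultimately show I: "integrable M f" using assms(4) by (simp add: integrable_iff_bounded)
  show "integral\<^sup>L M f \<le> C"
    using le nn_integral_eq_integral[OF I f0] C0 by (simp add: ennreal_le_iff)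
qed

section \<open>Almost everywhere convergence and completeness in the square norm\<close>

lemma sq_norm_AE_subseq:
  assumes "\<And>k. sq_int M (\<lambda>x. f k x - g x)" "(\<lambda>k. sq_norm M (\<lambda>x. f k x - g x)) \<longlonglongrightarrow> 0"
  obtains r :: "nat \<Rightarrow> nat" where "strict_mono r" "AE x in M. (\<lambda>k. f (r k) x) \<longlonglongrightarrow> g x"
proof -
  have "\<exists>r::nat\<Rightarrow>nat. strict_mono r \<and> (AE x in M. (\<lambda>k. (norm (f (r k) x - g x))^2) \<longlonglongrightarrow> 0)"
    by (rule tendsto_L1_AE_subseq) (use assms in \<open>auto simp: sq_int_def sq_norm_def\<close>)
  then obtain r :: "nat \<Rightarrow> nat" where r: "strict_mono r" "AE x in M. (\<lambda>k. (norm (f (r k) x - g x))^2) \<longlonglongrightarrow> 0"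
    by blast
  have "AE x in M. (\<lambda>k. f (r k) x) \<longlonglongrightarrow> g x"
    using r(2)
  proof eventually_elim
    case (elim x)
    from tendsto_real_sqrt[OF this] have "(\<lambda>k. norm (f (r k) x - g x)) \<longlonglongrightarrow> 0" by simp
    then have "(\<lambda>k. f (r k) x - g x) \<longlonglongrightarrow> 0" by (simp only: tendsto_norm_zero_iff)
    then show ?case by (rule LIM_zero_cancel)
  qed
  with r(1) show thesis using that by blast
qed

text \<open>The weight \<open>2^k\<close> in \<open>d\<close> is a balance: the integrals of the
  \<open>d k\<close> stay below \<open>(1/2)^k\<close>, so the sum of the \<open>d k x\<close> is
  finite almost everywhere, and 2 n \<le> 2^k n^2 + (1/2)^k turns this into absolute summability of
  the increments.\<close>

lemma sq_norm_fast_AE_conv: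
  fixes f :: "nat \<Rightarrow> 'a \<Rightarrow> 'b::euclidean_space"
  assumes s: "\<And>k. sq_int M (f k)" and le: "\<And>k. sq_norm M (\<lambda>x. f (Suc k) x - f k x) \<le> (1/4)^k"
  shows "AE x in M. convergent (\<lambda>k. f k x)"
proof -
  define d where "d k x = 2^k * (norm (f (Suc k) x - f k x))^2" for k x
  have dI: "integrable M (d k)" for k
    unfolding d_def using sq_int_int[OF sq_int_diff[OF s s]] by simp
  have [measurable]: "d k \<in> borel_measurable M" for k using dI by auto
  have d0: "d k x \<ge> 0" for k x by (simp add: d_def)
  have dk: "(\<integral>\<^sup>+x. ennreal (d k x) \<partial>M) \<le> ennreal ((1/2)^k)" for k
  proof -
    have "(LINT x|M. d k x) = 2^k * sq_norm M (\<lambda>x. f (Suc k) x - f k x)"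
      unfolding d_def sq_norm_def by simp
    also have "\<dots> \<le> 2^k * (1/4)^k" using le[of k] by (intro mult_left_mono) auto
    also have "\<dots> = (1/2)^k" by (simp add: power_mult_distrib[symmetric])
    finally show ?thesis using nn_integral_eq_integral[OF dI] d0 by (simp add: ennreal_leI)
  qed
  have "(\<integral>\<^sup>+x. (\<Sum>k. ennreal (d k x)) \<partial>M) = (\<Sum>k. \<integral>\<^sup>+x. ennreal (d k x) \<partial>M)"
    by (rule nn_integral_suminf) measurable
  also have "\<dots> \<le> (\<Sum>k. ennreal ((1/2)^k))" by (intro suminf_le dk) auto
  also have "\<dots> = ennreal (\<Sum>k. (1/2)^k)" by (intro suminf_ennreal2) auto
  also have "\<dots> < \<infinity>" by simp
  finally have "AE x in M. (\<Sum>k. ennreal (d k x)) \<noteq> \<infinity>"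
    by (intro nn_integral_PInf_AE) auto
  then show ?thesis
  proof eventually_elim
    case (elim x)
    then have sd: "summable (\<lambda>k. d k x)" using d0 by (intro summable_suminf_not_top) auto
    have "summable (\<lambda>k. norm (f (Suc k) x - f k x))"
    proof (rule summable_comparison_test')
      show "summable (\<lambda>k. (d k x + (1/2)^k))" using sd by (intro summable_add) auto
      fix k
      let ?n = "norm (f (Suc k) x - f k x)"
      have "0 \<le> (2^k * ?n - 1)^2 / 2^k" by simp
      also have "\<dots> = d k x - 2 * ?n + (1/2)^k" by (simp add: d_def power2_diff power2_eq_square field_simps)
      finally show "norm ?n \<le> d k x + (1/2)^k" using norm_ge_zero[of "f (Suc k) x - f k x"] by (simp del: norm_ge_zero)
    qed
    then have "summable (\<lambda>k. f (Suc k) x - f k x)" by (rule summable_norm_cancel)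
    then have "convergent (\<lambda>n. \<Sum>k<n. f (Suc k) x - f k x)" by (simp add: summable_iff_convergent)
    then have "convergent (\<lambda>n. f n x - f 0 x)" using sum_lessThan_telescope[of "\<lambda>k. f k x"] by simp
    then show ?case using convergent_add[OF _ convergent_const, of "\<lambda>n. f n x - f 0 x" "f 0 x"] by simp
  qed
qed

text \<open>The Riesz-Fischer argument for vector-valued functions: the limit is taken pointwise
  along a rapidly converging subsequence, and Fatou's lemma carries the Cauchy estimate over to it
  for the whole sequence.\<close>

lemma sq_norm_complete:
  fixes f :: "nat \<Rightarrow> 'a \<Rightarrow> 'b::euclidean_space"
  assumes s: "\<And>k. sq_int M (f k)"
    and cau: "\<And>e. e > 0 \<Longrightarrow> \<exists>N. \<forall>m\<ge>N. \<forall>n\<ge>N. sq_norm M (\<lambda>x. f m x - f n x) \<le> e"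
  obtains g where "sq_int M g" "(\<lambda>k. sq_norm M (\<lambda>x. f k x - g x)) \<longlonglongrightarrow> 0"
proof -
  obtain N where N: "\<And>e m n. e > 0 \<Longrightarrow> m \<ge> N e \<Longrightarrow> n \<ge> N e \<Longrightarrow> sq_norm M (\<lambda>x. f m x - f n x) \<le> e"
    using cau by metis
  \<comment> \<open>The maximum with \<open>Suc q\<close> forces strict growth; the other entry puts
    both \<open>r k\<close> and \<open>r (Suc k)\<close> past the threshold for
    \<open>(1/4)^k\<close>.\<close>
  define r where "r = rec_nat (N 1) (\<lambda>k q. max (Suc q) (N ((1/4)^Suc k)))"
  have r0: "r 0 = N 1" and rS: "r (Suc k) = max (Suc (r k)) (N ((1/4)^Suc k))" for k
    by (simp_all add: r_def)
  have sm: "strict_mono r" unfolding strict_mono_Suc_iff rS by auto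
  have rN: "N ((1/4)^k) \<le> r k" for k by (cases k) (auto simp: r0 rS)
  have "sq_norm M (\<lambda>x. f (r (Suc k)) x - f (r k) x) \<le> (1/4)^k" for k
  proof (rule N)
    show "N ((1/4)^k) \<le> r (Suc k)"
      using rN[of k] strict_mono_leD[OF sm, of k "Suc k"] by simp
  qed (use rN in auto)
  from sq_norm_fast_AE_conv[of M "\<lambda>k. f (r k)", OF s this]
  have conv: "AE x in M. convergent (\<lambda>k. f (r k) x)" .
  define g where "g x = lim (\<lambda>k. f (r k) x)" for x
  have [measurable]: "f k \<in> borel_measurable M" for k using s sq_int_meas by blast
  have gm [measurable]: "g \<in> borel_measurable M"
    unfolding g_def by (rule borel_measurable_lim_metric) measurable
  have lim: "AE x in M. (\<lambda>k. f (r k) x) \<longlonglongrightarrow> g x"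
    using conv by eventually_elim (simp add: g_def convergent_LIMSEQ_iff)
  have key: "sq_int M (\<lambda>x. f n x - g x) \<and> sq_norm M (\<lambda>x. f n x - g x) \<le> e" if e: "e > 0" "n \<ge> N e" for e n
  proof -
    have F: "integrable M (\<lambda>x. (norm (f n x - g x))^2)" "(LINT x|M. (norm (f n x - g x))^2) \<le> e"
    proof -
      have 1: "integrable M (\<lambda>x. (norm (f n x - f (r (k + N e)) x))^2)" for k
        by (rule sq_int_int[OF sq_int_diff[OF s s]])
      have 2: "(LINT x|M. (norm (f n x - f (r (k + N e)) x))^2) \<le> e" for k
      proof -
        have "r (k + N e) \<ge> N e" using seq_suble[OF sm, of "k + N e"] by simp
        from N[OF e this] show ?thesis by (simp add: sq_norm_def)
      qed
      have 3: "AE x in M. (\<lambda>k. (norm (f n x - f (r (k + N e)) x))^2) \<longlonglongrightarrow> (norm (f n x - g x))^2"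
        using lim
      proof eventually_elim
        case (elim x)
        from LIMSEQ_ignore_initial_segment[OF this, of "N e"]
        show ?case by (intro tendsto_intros) auto
      qed
      have 4: "(\<lambda>x. (norm (f n x - g x))^2) \<in> borel_measurable M" by measurable
      show "integrable M (\<lambda>x. (norm (f n x - g x))^2)"
        by (rule fatou_bound(1)[OF 1 _ 2 4 3]) simp
      show "(LINT x|M. (norm (f n x - g x))^2) \<le> e"
        by (rule fatou_bound(2)[OF 1 _ 2 4 3]) simp
    qed
    then show ?thesis by (auto simp: sq_int_def sq_norm_def)
  qed
  have g: "sq_int M g"
    using sq_int_diff[OF s[of "N 1"], of "\<lambda>x. f (N 1) x - g x"] key[of 1 "N 1"] by simp
  have "(\<lambda>k. sq_norm M (\<lambda>x. f k x - g x)) \<longlonglongrightarrow> 0"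
  proof (rule LIMSEQ_I)
    fix e :: real assume "e > 0"
    then have "norm (sq_norm M (\<lambda>x. f n x - g x) - 0) < e" if "n \<ge> N (e/2)" for n
      using key[of "e/2" n] that by simp
    then show "\<exists>no. \<forall>n\<ge>no. norm (sq_norm M (\<lambda>x. f n x - g x) - 0) < e" by blast
  qed
  with g show thesis using that by blast
qed

lemma sq_norm_expand:
  assumes "sq_int M f" "sq_int M g"
  shows "sq_norm M f = sq_norm M g + 2 * (LINT x|M. g x \<bullet> (f x - g x)) + sq_norm M (\<lambda>x. f x - g x)"
proof -
  have d: "sq_int M (\<lambda>x. f x - g x)" by (rule sq_int_diff[OF assms])
  have "sq_norm M f = (LINT x|M. (norm (g x))^2 + 2 * (g x \<bullet> (f x - g x)) + (norm (f x - g x))^2)"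
    unfolding sq_norm_def
    by (intro Bochner_Integration.integral_cong refl)
      (simp only: power2_norm_eq_inner, simp add: inner_diff_left inner_diff_right inner_commute)
  also have "\<dots> = sq_norm M g + 2 * (LINT x|M. g x \<bullet> (f x - g x)) + sq_norm M (\<lambda>x. f x - g x)"
    using sq_int_int[OF assms(2)] sq_int_int[OF d] sq_int_inner_int[OF assms(2) d] by (simp add: sq_norm_def)
  finally show ?thesis .
qed

lemma sq_norm_conv:
  assumes "\<And>k. sq_int M (f k)" "sq_int M g" "(\<lambda>k. sq_norm M (\<lambda>x. f k x - g x)) \<longlonglongrightarrow> 0"
  shows "(\<lambda>k. sq_norm M (f k)) \<longlonglongrightarrow> sq_norm M g"
proof -
  have eq: "(LINT x|M. g x \<bullet> (f k x - g x)) = (LINT x|M. g x \<bullet> f k x) - (LINT x|M. g x \<bullet> g x)" for k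
    using sq_int_inner_int[OF assms(2) assms(1)] sq_int_inner_int[OF assms(2) assms(2)]
    by (simp add: inner_diff_right)
  have "(\<lambda>k. LINT x|M. g x \<bullet> (f k x - g x)) \<longlonglongrightarrow> 0"
    unfolding eq using tendsto_diff[OF sq_norm_conv_inner[OF assms(1,2,2,3)] tendsto_const[of "LINT x|M. g x \<bullet> g x"]] by simp
  from tendsto_add[OF tendsto_add[OF tendsto_const[of "sq_norm M g"] tendsto_mult[OF tendsto_const[of 2] this]] assms(3)]
  show ?thesis using sq_norm_expand[OF assms(1,2)] by simp
qed

lemma sq_norm_tri:
  assumes "sq_int M f" "sq_int M g" "sq_int M h"
  shows "sq_norm M (\<lambda>x. f x - h x) \<le> 2 * sq_norm M (\<lambda>x. f x - g x) + 2 * sq_norm M (\<lambda>x. g x - h x)"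
  using sq_norm_add[OF sq_int_diff[OF assms(1,2)] sq_int_diff[OF assms(2,3)]] by simp

lemma tendsto_zero_squeeze:
  fixes f :: "nat \<Rightarrow> real"
  assumes "g \<longlonglongrightarrow> 0" "\<And>k. 0 \<le> f k" "\<And>k. f k \<le> g k"
  shows "f \<longlonglongrightarrow> 0"
  by (rule tendsto_sandwich[OF _ _ tendsto_const assms(1)]) (use assms in auto)

section \<open>Weighted Sobolev inequality\<close>

lemma test_fun_diff: "test_fun \<Omega> f \<Longrightarrow> f differentiable (at x)"
  and test_fun_pd_diff: "test_fun \<Omega> f \<Longrightarrow> pd i f differentiable (at x)"
proof -
  assume "test_fun \<Omega> f"
  then have "diff_upto 1 f" by (simp add: test_fun_def smooth_iff_diff_upto)
  then show "f differentiable (at x)" "pd i f differentiable (at x)" by auto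
qed

lemma test_fun_cont: "test_fun \<Omega> f \<Longrightarrow> continuous_on UNIV f"
  by (simp add: differentiable_imp_continuous_within continuous_on_eq_continuous_at test_fun_diff)

lemma test_fun_pd_cont: "test_fun \<Omega> f \<Longrightarrow> continuous_on UNIV (pd i f)"
  by (simp add: differentiable_imp_continuous_within continuous_on_eq_continuous_at test_fun_pd_diff)

lemma test_fun_grad_cont: "test_fun \<Omega> f \<Longrightarrow> continuous_on UNIV (grad f)"
  using test_fun_pd_cont[of \<Omega> f]
  by (auto simp: continuous_on_eq_continuous_at isCont_def intro!: vec_tendstoI)

lemma test_fun_outside:
  assumes "test_fun \<Omega> f" "x \<notin> closure {x. f x \<noteq> 0}"
  shows "f x = 0" "grad f x = 0"
proof -
  show "f x = 0" using assms(2) closure_subset[of "{x. f x \<noteq> 0}"] by blast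
  let ?U = "- closure {x. f x \<noteq> 0}"
  have "((\<lambda>x. 0) has_derivative (\<lambda>h. (0::real^'a) \<bullet> h)) (at x)" by simp
  then have "(f has_derivative (\<lambda>h. 0 \<bullet> h)) (at x)"
    by (rule has_derivative_transform_within_open[of _ _ _ _ ?U])
      (use assms(2) closure_subset[of "{x. f x \<noteq> 0}"] in auto)
  then show "grad f x = 0" by (rule grad_eqI)
qed

lemma test_fun_outside_dom:
  assumes "test_fun \<Omega> f" "x \<notin> \<Omega>"
  shows "f x = 0" "grad f x = 0"
  using test_fun_outside[OF assms(1), of x] assms by (auto simp: test_fun_def)

lemma test_fun_bounded:
  assumes "test_fun \<Omega> f"
  obtains B where "B \<ge> 0" "\<And>x. \<bar>f x\<bar> \<le> B" "\<And>x. norm (grad f x) \<le> B"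
proof -
  let ?K = "closure {x. f x \<noteq> 0}"
  have K: "compact ?K" using assms by (simp add: test_fun_def)
  have "bounded (f ` ?K)" "bounded (grad f ` ?K)"
    using K compact_imp_bounded compact_continuous_image continuous_on_subset
      test_fun_cont[OF assms] test_fun_grad_cont[OF assms] by (metis subset_UNIV)+
  then obtain A B where AB: "\<And>x. x \<in> ?K \<Longrightarrow> norm (f x) \<le> A" "\<And>x. x \<in> ?K \<Longrightarrow> norm (grad f x) \<le> B"
    unfolding bounded_iff by (metis imageI)
  show thesis
  proof (rule that[of "max 0 (max A B)"])
    fix x
    show "\<bar>f x\<bar> \<le> max 0 (max A B)" "norm (grad f x) \<le> max 0 (max A B)"
      using AB[of x] test_fun_outside[OF assms, of x] by (cases "x \<in> ?K"; force)+
  qed simp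
qed

lemma lborel_shift_nn:
  fixes f :: "'a::euclidean_space \<Rightarrow> ennreal"
  assumes [measurable]: "f \<in> borel_measurable borel" and "t \<noteq> 0"
  shows "(\<integral>\<^sup>+x. f x \<partial>lborel) = ennreal (\<bar>t\<bar>^DIM('a)) * (\<integral>\<^sup>+x. f (y + t *\<^sub>R x) \<partial>lborel)"
  by (subst lborel_affine[OF assms(2), of y])
    (simp add: nn_integral_density nn_integral_distr nn_integral_cmult)

lemma ennreal_sq_leD:
  assumes "X^2 \<le> ennreal (p^2)" "p \<ge> 0" shows "X \<le> ennreal p"
proof (cases X)
  case (real r)
  then have "r^2 \<le> p^2" using assms by (simp add: ennreal_power)
  then have "r \<le> p" using assms(2) by (rule power2_le_imp_le)
  then show ?thesis using real by (simp add: ennreal_leI)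
next
  case top
  then show ?thesis using assms(1) by (simp add: power2_eq_square top_unique)
qed

section \<open>Integration over a bounded open set\<close>

locale bounded_open_set =
  fixes \<Omega> :: "(real^'n::finite) set"
  assumes Om_open: "open \<Omega>" and Om_bounded: "bounded \<Omega>"
begin

abbreviation "M \<equiv> lebesgue_on \<Omega>"

lemma Om_lmeasurable: "\<Omega> \<in> lmeasurable" and Om_sets [simp, measurable]: "\<Omega> \<in> sets lebesgue"
  using Om_open Om_bounded by (auto simp: lmeasurable_open lmeasurable_open[OF Om_bounded Om_open, THEN fmeasurableD])

sublocale fin: finite_measure M by (rule finite_measure_lebesgue_on[OF Om_lmeasurable])

lemma borel_M: "f \<in> borel_measurable borel \<Longrightarrow> f \<in> borel_measurable M"
  by (intro measurable_restrict_space1 measurable_completion) simp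

lemma id_M: "(\<lambda>x. x) \<in> measurable M borel"
  by (intro borel_M) simp

lemma nn_M_le_lborel: "(\<integral>\<^sup>+x. f x \<partial>M) \<le> (\<integral>\<^sup>+x. f x \<partial>lborel)"
proof -
  have "(\<integral>\<^sup>+x. f x \<partial>M) = (\<integral>\<^sup>+x. f x * indicator \<Omega> x \<partial>lebesgue)"
    by (rule nn_integral_restrict_space) simp
  also have "\<dots> \<le> (\<integral>\<^sup>+x. f x \<partial>lebesgue)"
    by (intro nn_integral_mono) (auto simp: indicator_def)
  finally show ?thesis by (simp add: nn_integral_completion)
qed

lemma test_fun_sq_int:
  assumes "test_fun \<Omega> f"
  shows "sq_int M f" "sq_int M (grad f)" "f \<in> borel_measurable M" "grad f \<in> borel_measurable M"
    "f \<in> borel_measurable borel" "grad f \<in> borel_measurable borel"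
proof -
  show [measurable]: "f \<in> borel_measurable borel" "grad f \<in> borel_measurable borel"
    using assms by (auto intro!: borel_measurable_continuous_onI test_fun_cont test_fun_grad_cont)
  then show m[measurable]: "f \<in> borel_measurable M" "grad f \<in> borel_measurable M" by (auto intro: borel_M)
  obtain B where B: "B \<ge> 0" "\<And>x. \<bar>f x\<bar> \<le> B" "\<And>x. norm (grad f x) \<le> B"
    using test_fun_bounded[OF assms] by blast
  have b: "(norm (f x))^2 \<le> B^2" "(norm (grad f x))^2 \<le> B^2" for x
    using B by (intro power_mono; simp)+
  have "integrable M (\<lambda>x. (norm (f x))^2)"
    by (rule fin.integrable_const_bound[of _ "B^2"]) (use b(1) in simp_all)
  moreover have "integrable M (\<lambda>x. (norm (grad f x))^2)"
    by (rule fin.integrable_const_bound[of _ "B^2"]) (use b(2) in simp_all)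
  ultimately show "sq_int M f" "sq_int M (grad f)" using m by (auto simp: sq_int_def)
qed

lemma nn_grad:
  assumes "test_fun \<Omega> f"
  shows "(\<integral>\<^sup>+x. ennreal (norm (grad f x))^2 \<partial>lborel) = ennreal (sq_norm M (grad f))"
proof -
  have "ennreal (sq_norm M (grad f)) = (\<integral>\<^sup>+x. ennreal ((norm (grad f x))^2) \<partial>M)"
    unfolding sq_norm_def using sq_int_int[OF test_fun_sq_int(2)[OF assms]] by (intro nn_integral_eq_integral[symmetric]) auto
  also have "\<dots> = (\<integral>\<^sup>+x. ennreal ((norm (grad f x))^2) * indicator \<Omega> x \<partial>lebesgue)"
    by (rule nn_integral_restrict_space) simp
  also have "\<dots> = (\<integral>\<^sup>+x. ennreal ((norm (grad f x))^2) \<partial>lebesgue)"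
    using test_fun_outside_dom[OF assms] by (intro nn_integral_cong) (auto simp: indicator_def)
  finally show ?thesis by (simp add: nn_integral_completion ennreal_power)
qed

text \<open>For a test function, \<open>|f x|\<close> is at most the integral of \<open>|\<nabla>f|\<close> along any ray from \<open>x\<close>. Average over the
  directions in the cube \<open>[1, 2]\<^sup>N\<close>, which has measure 1 and whose elements have norm at least 1, so that every ray
  has left \<open>\<Omega>\<close> at time \<open>diam \<Omega>\<close>. At time \<open>t\<close> the weighted average is bounded by the \<open>L\<^sup>2\<close> norm of the weight,
  and by \<open>t\<^bsup>- N / 2\<^esup>\<close> times its \<open>L\<^sup>1\<close> norm; any interpolation integrable in \<open>t\<close> will do.\<close>

definition unit_cube :: "(real^'n) set" where "unit_cube = cbox (\<chi> i. 1) (\<chi> i. 2)"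

lemma unit_cube_sets [measurable]: "unit_cube \<in> sets borel" by (simp add: unit_cube_def)

lemma unit_cube_meas: "emeasure lborel unit_cube = 1"
proof -
  have "emeasure lborel unit_cube = ennreal (measure lborel (cbox (\<chi> i. 1) ((\<chi> i. 2)::real^'n)))"
    unfolding unit_cube_def by (rule emeasure_eq_ennreal_measure) (simp add: emeasure_lborel_cbox_eq)
  also have "measure lborel (cbox (\<chi> i. 1) ((\<chi> i. 2)::real^'n)) = 1"
    by (subst content_cbox_cart) (auto simp: interval_eq_empty_cart)
  finally show ?thesis by simp
qed

lemma unit_cube_norm: "w \<in> unit_cube \<Longrightarrow> 1 \<le> norm w" "w \<in> unit_cube \<Longrightarrow> norm w \<le> 2 * CARD('n)"
proof -
  assume w: "w \<in> unit_cube"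
  then have c: "1 \<le> w $ i" "w $ i \<le> 2" for i by (auto simp: unit_cube_def mem_box_cart)
  show "1 \<le> norm w" using component_le_norm_cart[of w undefined] c[of undefined] by linarith
  have "norm w \<le> (\<Sum>i\<in>UNIV. \<bar>w $ i\<bar>)" by (rule norm_le_l1_cart)
  also have "\<dots> \<le> (\<Sum>i\<in>(UNIV::'n set). 2)"
    by (intro sum_mono) (smt (verit) c)
  finally show "norm w \<le> 2 * CARD('n)" by simp
qed

text \<open>A strict bound for distances inside \<Omega>. Strictness is what puts
  \<open>x + diam_bound *\<^sub>R w\<close> outside \<Omega> as soon as \<open>w\<close> has norm at
  least 1.\<close>

definition diam_bound :: real where "diam_bound = (SOME D. D > 0 \<and> (\<forall>x\<in>\<Omega>. \<forall>y\<in>\<Omega>. norm (x - y) < D))"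

lemma diam_bound: "diam_bound > 0" "\<And>x y. x \<in> \<Omega> \<Longrightarrow> y \<in> \<Omega> \<Longrightarrow> norm (x - y) < diam_bound"
proof -
  obtain B where B: "B > 0" "\<And>x. x \<in> \<Omega> \<Longrightarrow> norm x \<le> B" using Om_bounded bounded_pos by metis
  have "norm (x - y) < 2 * B + 1" if "x \<in> \<Omega>" "y \<in> \<Omega>" for x y
    using norm_triangle_ineq4[of x y] B(2)[OF that(1)] B(2)[OF that(2)] by simp
  then have "\<exists>D. D > 0 \<and> (\<forall>x\<in>\<Omega>. \<forall>y\<in>\<Omega>. norm (x - y) < D)"
    using B by (intro exI[of _ "2 * B + 1"]) auto
  from someI_ex[OF this] show "diam_bound > 0" "\<And>x y. x \<in> \<Omega> \<Longrightarrow> y \<in> \<Omega> \<Longrightarrow> norm (x - y) < diam_bound"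
    unfolding diam_bound_def by auto
qed

lemma ray_bound:
  assumes t: "test_fun \<Omega> f" and x: "x \<in> \<Omega>" and w: "w \<in> unit_cube"
  shows "ennreal \<bar>f x\<bar> \<le> (\<integral>\<^sup>+t. ennreal (2 * CARD('n) * norm (grad f (x + t *\<^sub>R w))) * indicator {0..diam_bound} t \<partial>lborel)"
proof -
  let ?g = "\<lambda>t. grad f (x + t *\<^sub>R w) \<bullet> w"
  have d: "((\<lambda>t. f (x + t *\<^sub>R w)) has_real_derivative ?g t) (at t)" for t
    by (rule DERIV_along_line[OF has_derivative_pd[OF test_fun_diff[OF t]]])
  have gc: "isCont (grad f) y" for y
    using test_fun_grad_cont[OF t] by (simp add: continuous_on_eq_continuous_at)
  have c: "isCont ?g t" for t
    by (intro continuous_intros isCont_o2[OF _ gc])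
  have hb: "has_bochner_integral lborel (\<lambda>t. ?g t * indicator {0..diam_bound} t) (f (x + diam_bound *\<^sub>R w) - f (x + 0 *\<^sub>R w))"
    by (rule has_bochner_integral_FTC_Icc_real) (use diam_bound d c in auto)
  have "x + diam_bound *\<^sub>R w \<notin> \<Omega>"
  proof
    assume "x + diam_bound *\<^sub>R w \<in> \<Omega>"
    from diam_bound(2)[OF this x] have "diam_bound * norm w < diam_bound" using diam_bound(1) by simp
    then show False using unit_cube_norm(1)[OF w] diam_bound(1) by simp
  qed
  then have "f (x + diam_bound *\<^sub>R w) = 0" using test_fun_outside_dom[OF t] by blast
  then have "\<bar>f x\<bar> = norm (\<integral>t. ?g t * indicator {0..diam_bound} t \<partial>lborel)"
    using has_bochner_integral_integral_eq[OF hb] by simp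
  also have "ennreal \<dots> \<le> (\<integral>\<^sup>+t. ennreal (norm (?g t * indicator {0..diam_bound} t)) \<partial>lborel)"
    by (rule integral_norm_bound_ennreal[OF integrable.intros[OF hb]])
  also have "\<dots> \<le> (\<integral>\<^sup>+t. ennreal (2 * CARD('n) * norm (grad f (x + t *\<^sub>R w))) * indicator {0..diam_bound} t \<partial>lborel)"
  proof (rule nn_integral_mono)
    fix t :: real
    have "\<bar>?g t\<bar> \<le> norm (grad f (x + t *\<^sub>R w)) * norm w" by (rule Cauchy_Schwarz_ineq2)
    also have "\<dots> \<le> norm (grad f (x + t *\<^sub>R w)) * (2 * CARD('n))"
      using unit_cube_norm(2)[OF w] by (intro mult_left_mono) auto
    finally show "ennreal (norm (?g t * indicator {0..diam_bound} t))
       \<le> ennreal (2 * CARD('n) * norm (grad f (x + t *\<^sub>R w))) * indicator {0..diam_bound} t"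
      by (auto simp: indicator_def mult.commute intro!: ennreal_leI)
  qed
  finally show ?thesis .
qed

definition box_average :: "(real^'n \<Rightarrow> real) \<Rightarrow> (real^'n \<Rightarrow> real) \<Rightarrow> real \<Rightarrow> ennreal" where
  "box_average f w t = (\<integral>\<^sup>+x. ennreal (w x) * (\<integral>\<^sup>+y. ennreal (norm (grad f (x + t *\<^sub>R y))) * indicator unit_cube y \<partial>lborel) \<partial>M)"

text \<open>As \<open>unit_cube\<close> has measure 1, the ray bound may be averaged over its
  directions; two applications of Fubini then bring the ray parameter outside the weighted integral.
  The factor \<open>2 * CARD('n)\<close> bounds the norm of the directions.\<close>

lemma weighted_le_box_average:
  assumes t: "test_fun \<Omega> f" and w [measurable]: "w \<in> borel_measurable M"
  shows "(\<integral>\<^sup>+x. ennreal (w x) * ennreal \<bar>f x\<bar> \<partial>M) \<le> (\<integral>\<^sup>+t. ennreal (2 * CARD('n)) * box_average f w t * indicator {0..diam_bound} t \<partial>lborel)"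
proof -
  have [measurable]: "grad f \<in> borel_measurable borel" by (rule test_fun_sq_int(6)[OF t])
  let ?c = "ennreal (2 * CARD('n))" and ?A = "\<lambda>t x. \<integral>\<^sup>+y. ennreal (norm (grad f (x + t *\<^sub>R y))) * indicator unit_cube y \<partial>lborel"
  interpret pr: pair_sigma_finite M "lborel :: real measure"
    by (intro pair_sigma_finite.intro fin.sigma_finite_measure_axioms sigma_finite_lborel)
  have pt: "ennreal \<bar>f x\<bar> \<le> (\<integral>\<^sup>+t. ?c * ?A t x * indicator {0..diam_bound} t \<partial>lborel)"
    if x: "x \<in> \<Omega>" for x
  proof -
    have "ennreal \<bar>f x\<bar> = (\<integral>\<^sup>+y. ennreal \<bar>f x\<bar> * indicator unit_cube y \<partial>lborel)"
      by (simp add: nn_integral_cmult_indicator unit_cube_meas)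
    also have "\<dots> \<le> (\<integral>\<^sup>+y. (\<integral>\<^sup>+t. ennreal (2 * CARD('n) * norm (grad f (x + t *\<^sub>R y))) * indicator {0..diam_bound} t \<partial>lborel) * indicator unit_cube y \<partial>lborel)"
      using ray_bound[OF t x] by (intro nn_integral_mono) (auto simp: indicator_def)
    also have "\<dots> = (\<integral>\<^sup>+y. (\<integral>\<^sup>+t. ennreal (2 * CARD('n) * norm (grad f (x + t *\<^sub>R y))) * indicator {0..diam_bound} t * indicator unit_cube y \<partial>lborel) \<partial>lborel)"
      by (intro nn_integral_cong) (subst nn_integral_multc, auto)
    also have "\<dots> = (\<integral>\<^sup>+t. (\<integral>\<^sup>+y. ennreal (2 * CARD('n) * norm (grad f (x + t *\<^sub>R y))) * indicator {0..diam_bound} t * indicator unit_cube y \<partial>lborel) \<partial>lborel)"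
      by (rule lborel_pair.Fubini') measurable
    also have "\<dots> = (\<integral>\<^sup>+t. ?c * ?A t x * indicator {0..diam_bound} t \<partial>lborel)"
    proof (intro nn_integral_cong)
      fix t :: real
      have "ennreal (2 * CARD('n) * norm (grad f (x + t *\<^sub>R y))) * indicator {0..diam_bound} t * indicator unit_cube y
        = (?c * indicator {0..diam_bound} t) * (ennreal (norm (grad f (x + t *\<^sub>R y))) * indicator unit_cube y)" for y
        by (simp add: ennreal_mult mult_ac)
      then have "(\<integral>\<^sup>+y. ennreal (2 * CARD('n) * norm (grad f (x + t *\<^sub>R y))) * indicator {0..diam_bound} t * indicator unit_cube y \<partial>lborel) =
        (\<integral>\<^sup>+y. (?c * indicator {0..diam_bound} t) * (ennreal (norm (grad f (x + t *\<^sub>R y))) * indicator unit_cube y) \<partial>lborel)"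
        by (simp only:)
      also have "\<dots> = (?c * indicator {0..diam_bound} t) * ?A t x"
        by (rule nn_integral_cmult) measurable
      finally show "(\<integral>\<^sup>+y. ennreal (2 * CARD('n) * norm (grad f (x + t *\<^sub>R y))) * indicator {0..diam_bound} t * indicator unit_cube y \<partial>lborel) =
         ?c * ?A t x * indicator {0..diam_bound} t"
        by (simp only: mult_ac)
    qed
    finally show ?thesis .
  qed
  note id_M [measurable]
  have "(\<integral>\<^sup>+x. ennreal (w x) * ennreal \<bar>f x\<bar> \<partial>M) \<le> (\<integral>\<^sup>+x. ennreal (w x) * (\<integral>\<^sup>+t. ?c * ?A t x * indicator {0..diam_bound} t \<partial>lborel) \<partial>M)"
    using pt by (intro nn_integral_mono mult_left_mono) auto
  also have "\<dots> = (\<integral>\<^sup>+x. (\<integral>\<^sup>+t. ennreal (w x) * (?c * ?A t x * indicator {0..diam_bound} t) \<partial>lborel) \<partial>M)"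
    by (intro nn_integral_cong) (subst nn_integral_cmult, auto)
  also have "\<dots> = (\<integral>\<^sup>+t. (\<integral>\<^sup>+x. ennreal (w x) * (?c * ?A t x * indicator {0..diam_bound} t) \<partial>M) \<partial>lborel)"
    by (rule pr.Fubini'[symmetric]) measurable
  also have "\<dots> = (\<integral>\<^sup>+t. ?c * box_average f w t * indicator {0..diam_bound} t \<partial>lborel)"
  proof (intro nn_integral_cong)
    fix t :: real
    have "ennreal (w x) * (?c * ?A t x * indicator {0..diam_bound} t)
      = (?c * indicator {0..diam_bound} t) * (ennreal (w x) * ?A t x)" for x
      by (simp only: mult_ac)
    then have "(\<integral>\<^sup>+x. ennreal (w x) * (?c * ?A t x * indicator {0..diam_bound} t) \<partial>M)
      = (\<integral>\<^sup>+x. (?c * indicator {0..diam_bound} t) * (ennreal (w x) * ?A t x) \<partial>M)"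
      by (simp only:)
    also have "\<dots> = (?c * indicator {0..diam_bound} t) * box_average f w t"
      unfolding box_average_def by (rule nn_integral_cmult) measurable
    finally show "(\<integral>\<^sup>+x. ennreal (w x) * (?c * ?A t x * indicator {0..diam_bound} t) \<partial>M)
      = ?c * box_average f w t * indicator {0..diam_bound} t" by (simp only: mult_ac)
  qed
  finally show ?thesis .
qed

text \<open>For a fixed direction y, Cauchy-Schwarz in x and translation invariance give a bound
  independent of both y and t.\<close>

lemma box_average_le1:
  assumes t: "test_fun \<Omega> f" and w: "sq_int M w" "\<And>x. 0 \<le> w x"
  shows "box_average f w t \<le> ennreal (sqrt (sq_norm M w) * sqrt (sq_norm M (grad f)))"
proof -
  have [measurable]: "grad f \<in> borel_measurable borel" "w \<in> borel_measurable M"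
    using test_fun_sq_int(6)[OF t] w(1) by (auto simp: sq_int_def)
  interpret pr: pair_sigma_finite M "lborel :: (real^'n) measure"
    by (intro pair_sigma_finite.intro fin.sigma_finite_measure_axioms sigma_finite_lborel)
  note id_M [measurable]
  let ?p = "sqrt (sq_norm M w) * sqrt (sq_norm M (grad f))"
  have y: "(\<integral>\<^sup>+x. ennreal (w x) * ennreal (norm (grad f (x + t *\<^sub>R y))) \<partial>M) \<le> ennreal ?p" for y
  proof (rule ennreal_sq_leD)
    have "(\<integral>\<^sup>+x. ennreal (w x) * ennreal (norm (grad f (x + t *\<^sub>R y))) \<partial>M)^2
       \<le> (\<integral>\<^sup>+x. ennreal (w x)^2 \<partial>M) * (\<integral>\<^sup>+x. ennreal (norm (grad f (x + t *\<^sub>R y)))^2 \<partial>M)"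
      by (rule Cauchy_Schwarz_nn_integral) measurable
    also have "(\<integral>\<^sup>+x. ennreal (w x)^2 \<partial>M) = ennreal (sq_norm M w)"
      using nn_integral_eq_integral[OF sq_int_int[OF w(1)]] w(2) by (simp add: sq_norm_def ennreal_power)
    also have "(\<integral>\<^sup>+x. ennreal (norm (grad f (x + t *\<^sub>R y)))^2 \<partial>M) \<le> (\<integral>\<^sup>+x. ennreal (norm (grad f (x + t *\<^sub>R y)))^2 \<partial>lborel)"
      by (rule nn_M_le_lborel)
    also have "\<dots> = (\<integral>\<^sup>+x. ennreal (norm (grad f x))^2 \<partial>lborel)"
      using lborel_shift_nn[of "\<lambda>x. ennreal (norm (grad f x))^2" 1 "t *\<^sub>R y"] by (simp add: add.commute)
    also have "\<dots> = ennreal (sq_norm M (grad f))" by (rule nn_grad[OF t])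
    also have "ennreal (sq_norm M w) * ennreal (sq_norm M (grad f)) = ennreal (?p^2)"
      by (simp add: power_mult_distrib ennreal_mult)
    finally show "(\<integral>\<^sup>+x. ennreal (w x) * ennreal (norm (grad f (x + t *\<^sub>R y))) \<partial>M)^2 \<le> ennreal (?p^2)"
      by (simp add: mult_left_mono)
  qed simp
  have "box_average f w t = (\<integral>\<^sup>+x. (\<integral>\<^sup>+y. ennreal (w x) * (ennreal (norm (grad f (x + t *\<^sub>R y))) * indicator unit_cube y) \<partial>lborel) \<partial>M)"
    unfolding box_average_def by (intro nn_integral_cong) (subst nn_integral_cmult, auto)
  also have "\<dots> = (\<integral>\<^sup>+y. (\<integral>\<^sup>+x. ennreal (w x) * (ennreal (norm (grad f (x + t *\<^sub>R y))) * indicator unit_cube y) \<partial>M) \<partial>lborel)"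
    by (rule pr.Fubini'[symmetric]) measurable
  also have "\<dots> = (\<integral>\<^sup>+y. (\<integral>\<^sup>+x. ennreal (w x) * ennreal (norm (grad f (x + t *\<^sub>R y))) \<partial>M) * indicator unit_cube y \<partial>lborel)"
    by (intro nn_integral_cong) (subst nn_integral_multc[symmetric], auto simp: mult_ac)
  also have "\<dots> \<le> (\<integral>\<^sup>+y. ennreal ?p * indicator unit_cube y \<partial>lborel)"
    using y by (intro nn_integral_mono mult_right_mono) auto
  also have "\<dots> = ennreal ?p" by (simp add: nn_integral_cmult_indicator unit_cube_meas)
  finally show ?thesis .
qed

text \<open>Here x is fixed and Cauchy-Schwarz is applied in the direction y. The substitution of
  \<open>x + s *\<^sub>R y\<close> has Jacobian \<open>s^CARD('n)\<close>, whose inverse square root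
  is the power of s; the weight then enters only through its integral.\<close>

lemma box_average_le2:
  assumes t: "test_fun \<Omega> f" and w: "integrable M w" "\<And>x. 0 \<le> w x" and s: "s > 0"
  shows "box_average f w s \<le> ennreal ((LINT x|M. w x) * (s powr (- CARD('n) / 2) * sqrt (sq_norm M (grad f))))"
proof -
  have [measurable]: "grad f \<in> borel_measurable borel" "w \<in> borel_measurable M"
    using test_fun_sq_int(6)[OF t] w(1) by auto
  let ?p = "s powr (- CARD('n) / 2) * sqrt (sq_norm M (grad f))"
  have x: "(\<integral>\<^sup>+y. ennreal (norm (grad f (x + s *\<^sub>R y))) * indicator unit_cube y \<partial>lborel) \<le> ennreal ?p" for x
  proof (rule ennreal_sq_leD)
    have "(\<integral>\<^sup>+y. ennreal (norm (grad f (x + s *\<^sub>R y))) * indicator unit_cube y \<partial>lborel)^2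
       \<le> (\<integral>\<^sup>+y. ennreal (norm (grad f (x + s *\<^sub>R y)))^2 \<partial>lborel) * (\<integral>\<^sup>+y. (indicator unit_cube y)^2 \<partial>lborel)"
    proof (rule Cauchy_Schwarz_nn_integral)
      show "(\<lambda>y. ennreal (norm (grad f (x + s *\<^sub>R y)))) \<in> borel_measurable lborel" by measurable
      show "indicator unit_cube \<in> borel_measurable lborel" by (intro borel_measurable_indicator) simp
    qed
    also have "(\<integral>\<^sup>+y. (indicator unit_cube y)^2 \<partial>lborel) = (\<integral>\<^sup>+y. indicator unit_cube y \<partial>lborel)"
      by (intro nn_integral_cong) (auto simp: indicator_def)
    also have "\<dots> = 1" by (simp add: unit_cube_meas)
    finally have 1: "(\<integral>\<^sup>+y. ennreal (norm (grad f (x + s *\<^sub>R y))) * indicator unit_cube y \<partial>lborel)^2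
       \<le> (\<integral>\<^sup>+y. ennreal (norm (grad f (x + s *\<^sub>R y)))^2 \<partial>lborel)" by simp
    have "ennreal (s^CARD('n)) * (\<integral>\<^sup>+y. ennreal (norm (grad f (x + s *\<^sub>R y)))^2 \<partial>lborel) = ennreal (sq_norm M (grad f))"
      using lborel_shift_nn[of "\<lambda>x. ennreal (norm (grad f x))^2" s x] s nn_grad[OF t] by simp
    then have "ennreal (1 / s^CARD('n)) * (ennreal (s^CARD('n)) * (\<integral>\<^sup>+y. ennreal (norm (grad f (x + s *\<^sub>R y)))^2 \<partial>lborel)) = ennreal (1 / s^CARD('n)) * ennreal (sq_norm M (grad f))" by simp
    then have "(\<integral>\<^sup>+y. ennreal (norm (grad f (x + s *\<^sub>R y)))^2 \<partial>lborel) = ennreal (1 / s^CARD('n) * sq_norm M (grad f))"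
      using s by (simp add: mult.assoc[symmetric] ennreal_mult[symmetric])
    also have "1 / s^CARD('n) * sq_norm M (grad f) = ?p^2"
    proof -
      have "(s powr (- CARD('n) / 2))^2 = s powr (- CARD('n))"
        using s by (simp add: powr_power)
      also have "\<dots> = 1 / s^CARD('n)" using s by (simp add: powr_minus powr_realpow inverse_eq_divide)
      finally show ?thesis by (simp add: power_mult_distrib)
    qed
    finally show "(\<integral>\<^sup>+y. ennreal (norm (grad f (x + s *\<^sub>R y))) * indicator unit_cube y \<partial>lborel)^2 \<le> ennreal (?p^2)"
      using 1 by simp
  qed simp
  have "box_average f w s \<le> (\<integral>\<^sup>+x. ennreal (w x) * ennreal ?p \<partial>M)"
    unfolding box_average_def using x by (intro nn_integral_mono mult_left_mono) auto
  also have "\<dots> = (\<integral>\<^sup>+x. ennreal (w x) \<partial>M) * ennreal ?p" by (rule nn_integral_multc) measurable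
  also have "(\<integral>\<^sup>+x. ennreal (w x) \<partial>M) = ennreal (LINT x|M. w x)" using w by (intro nn_integral_eq_integral) auto
  finally show ?thesis using w by (simp add: ennreal_mult)
qed


section \<open>Weighted Poincare and Sobolev inequalities for test functions\<close>

definition poincare_const :: real where "poincare_const = 2 * CARD('n) * diam_bound"

lemma poincare_const_pos: "poincare_const > 0" using diam_bound by (simp add: poincare_const_def)

lemma test_weight_nn:
  assumes "test_fun \<Omega> f" "sq_int M w" "\<And>x. 0 \<le> w x"
  shows "(\<integral>\<^sup>+x. ennreal (w x) * ennreal \<bar>f x\<bar> \<partial>M) = ennreal (LINT x|M. w x * \<bar>f x\<bar>)"
proof -
  have I: "integrable M (\<lambda>x. w x * \<bar>f x\<bar>)"
    using sq_int_mult_int[OF assms(2) test_fun_sq_int(1)[OF assms(1)]] assms(3) by simp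
  have "(\<integral>\<^sup>+x. ennreal (w x) * ennreal \<bar>f x\<bar> \<partial>M) = (\<integral>\<^sup>+x. ennreal (w x * \<bar>f x\<bar>) \<partial>M)"
    using assms(3) by (intro nn_integral_cong) (simp add: ennreal_mult)
  also have "\<dots> = ennreal (LINT x|M. w x * \<bar>f x\<bar>)"
    using I assms(3) by (intro nn_integral_eq_integral) auto
  finally show ?thesis .
qed

lemma test_weight1:
  assumes "test_fun \<Omega> f" "sq_int M w" "\<And>x. 0 \<le> w x"
  shows "(LINT x|M. w x * \<bar>f x\<bar>) \<le> poincare_const * (sqrt (sq_norm M w) * sqrt (sq_norm M (grad f)))"
proof -
  let ?p = "sqrt (sq_norm M w) * sqrt (sq_norm M (grad f))"
  have "ennreal (LINT x|M. w x * \<bar>f x\<bar>) \<le> (\<integral>\<^sup>+t. ennreal (2 * CARD('n)) * box_average f w t * indicator {0..diam_bound} t \<partial>lborel)"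
    using weighted_le_box_average[OF assms(1) sq_int_meas[OF assms(2)]] by (simp add: test_weight_nn[OF assms])
  also have "\<dots> \<le> (\<integral>\<^sup>+t. ennreal (2 * CARD('n) * ?p) * indicator {0..diam_bound} t \<partial>lborel)"
    using box_average_le1[OF assms] by (intro nn_integral_mono mult_right_mono) (auto simp: ennreal_mult intro!: mult_left_mono)
  also have "\<dots> = ennreal (2 * CARD('n) * ?p * diam_bound)"
    using diam_bound(1) by (simp add: nn_integral_cmult_indicator ennreal_mult)
  finally show ?thesis using diam_bound(1) by (subst (asm) ennreal_le_iff) (auto simp: poincare_const_def mult_ac)
qed

text \<open>The factor \<open>2 * CARD('n)\<close> times the integral of t to the power -N\<beta>/2
  over \<open>{0..diam_bound}\<close>, for N\<beta>/2 < 1.\<close>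

definition sobolev_const :: "real \<Rightarrow> real" where
  "sobolev_const \<beta> = 2 * CARD('n) * (diam_bound powr (1 - real CARD('n) * \<beta> / 2) / (1 - real CARD('n) * \<beta> / 2))"

lemma interp_min:
  assumes "0 < \<beta>" "\<beta> < 1" "0 \<le> p" "0 \<le> q"
  shows "min p q \<le> p powr (1 - \<beta>) * q powr (\<beta>::real)"
proof (cases "p = 0 \<or> q = 0")
  case False
  have "min p q = min p q powr (1 - \<beta>) * min p q powr \<beta>"
    using False assms by (simp add: powr_add[symmetric])
  also have "\<dots> \<le> p powr (1 - \<beta>) * q powr \<beta>"
    using assms by (intro mult_mono powr_mono2) auto
  finally show ?thesis .
qed (use assms in auto)

text \<open>Sobolev's inequality in dual form: rather than a higher power of f, an interpolation of
  the L2 and L1 norms of the weight is used. The two bounds for \<open>box_average\<close> are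
  combined by the geometric mean with exponents 1 - \<beta> and \<beta>, so that at time t the
  singularity is only t to the power -N\<beta>/2.\<close>

lemma test_weight2:
  assumes "test_fun \<Omega> f" "sq_int M w" "\<And>x. 0 \<le> w x" and b: "0 < \<beta>" "\<beta> < 1" "real CARD('n) * \<beta> / 2 < 1"
  shows "(LINT x|M. w x * \<bar>f x\<bar>) \<le> sobolev_const \<beta> * (sqrt (sq_norm M w) powr (1 - \<beta>) * (LINT x|M. w x) powr \<beta> * sqrt (sq_norm M (grad f)))"
proof -
  define p where "p = sqrt (sq_norm M w)"
  define q where "q = (LINT x|M. w x)"
  define g where "g = sqrt (sq_norm M (grad f))"
  define \<gamma> where "\<gamma> = real CARD('n) * \<beta> / 2"
  have nn: "p \<ge> 0" "q \<ge> 0" "g \<ge> 0" using assms(3) by (auto simp: p_def q_def g_def)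
  have wI: "integrable M w"
    using sq_int_mult_int[OF assms(2), of "\<lambda>x. 1::real"] assms(3) by (simp add: sq_int_def)
  have box_average: "box_average f w s \<le> ennreal (p powr (1 - \<beta>) * q powr \<beta> * g * s powr (- \<gamma>))" if s: "s > 0" for s
  proof -
    have "box_average f w s \<le> ennreal (min (p * g) (q * (s powr (- CARD('n) / 2) * g)))"
      using box_average_le1[OF assms(1-3), of s] box_average_le2[OF assms(1) wI assms(3) s]
      by (simp add: p_def q_def g_def min_def)
    also have "\<dots> \<le> ennreal ((p * g) powr (1 - \<beta>) * (q * (s powr (- CARD('n) / 2) * g)) powr \<beta>)"
      by (intro ennreal_leI interp_min) (use b nn in auto)
    also have "(p * g) powr (1 - \<beta>) * (q * (s powr (- CARD('n) / 2) * g)) powr \<beta>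
       = p powr (1 - \<beta>) * q powr \<beta> * (g powr (1 - \<beta>) * g powr \<beta>) * (s powr (- CARD('n) / 2)) powr \<beta>"
      using nn s by (simp add: powr_mult mult_ac)
    also have "g powr (1 - \<beta>) * g powr \<beta> = g" using nn by (simp add: powr_add[symmetric])
    also have "(s powr (- CARD('n) / 2)) powr \<beta> = s powr (- \<gamma>)"
      by (simp add: powr_powr \<gamma>_def)
    finally show ?thesis .
  qed
  define P where "P = p powr (1 - \<beta>) * q powr \<beta> * g"
  have P0: "P \<ge> 0" using nn by (simp add: P_def)
  have "ennreal (LINT x|M. w x * \<bar>f x\<bar>) \<le> (\<integral>\<^sup>+t. ennreal (2 * CARD('n)) * box_average f w t * indicator {0..diam_bound} t \<partial>lborel)"
    using weighted_le_box_average[OF assms(1) sq_int_meas[OF assms(2)]] by (simp add: test_weight_nn[OF assms(1-3)])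
  also have "\<dots> \<le> (\<integral>\<^sup>+t. ennreal (2 * CARD('n) * P) * (indicator {0..diam_bound} t * ennreal (t powr (- \<gamma>))) \<partial>lborel)"
  proof (rule nn_integral_mono_AE)
    show "AE t in lborel. ennreal (2 * CARD('n)) * box_average f w t * indicator {0..diam_bound} t
        \<le> ennreal (2 * CARD('n) * P) * (indicator {0..diam_bound} t * ennreal (t powr (- \<gamma>)))"
      using AE_lborel_singleton[of "0::real"]
    proof eventually_elim
      case (elim t)
      show ?case
      proof (cases "t \<in> {0..diam_bound}")
        case True
        then have "box_average f w t \<le> ennreal (P * t powr (- \<gamma>))" using box_average elim by (simp add: P_def)
        then have "ennreal (2 * CARD('n)) * box_average f w t \<le> ennreal (2 * CARD('n)) * ennreal (P * t powr (- \<gamma>))"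
          by (rule mult_left_mono) simp
        also have "ennreal (2 * CARD('n)) * ennreal (P * t powr (- \<gamma>)) = ennreal (2 * CARD('n) * P) * ennreal (t powr (- \<gamma>))"
          using P0 by (subst (1 2) ennreal_mult[symmetric]) (simp_all add: mult_ac)
        finally show ?thesis using True by simp
      qed simp
    qed
  qed
  also have "\<dots> = ennreal (2 * CARD('n) * P) * (\<integral>\<^sup>+t. indicator {0..diam_bound} t * ennreal (t powr (- \<gamma>)) \<partial>lborel)"
    by (rule nn_integral_cmult) measurable
  also have "(\<integral>\<^sup>+t. indicator {0..diam_bound} t * ennreal (t powr (- \<gamma>)) \<partial>lborel) = ennreal (diam_bound powr (- \<gamma> + 1) / (- \<gamma> + 1))"
  proof -
    have "((\<lambda>x. x powr - \<gamma>) has_integral diam_bound powr (- \<gamma> + 1) / (- \<gamma> + 1)) {0..diam_bound}"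
      by (rule has_integral_powr_from_0) (use b diam_bound in \<open>auto simp: \<gamma>_def\<close>)
    from nn_integral_has_integral_lebesgue[OF _ this]
    show ?thesis by (simp add: ennreal_mult' ennreal_indicator)
  qed
  also have "ennreal (2 * CARD('n) * P) * ennreal (diam_bound powr (- \<gamma> + 1) / (- \<gamma> + 1)) = ennreal (sobolev_const \<beta> * P)"
    using P0 b by (subst ennreal_mult[symmetric]) (auto simp: sobolev_const_def \<gamma>_def mult_ac)
  finally have "(LINT x|M. w x * \<bar>f x\<bar>) \<le> sobolev_const \<beta> * P"
    using P0 b by (subst (asm) ennreal_le_iff) (auto simp: sobolev_const_def)
  then show ?thesis by (simp add: P_def p_def q_def g_def)
qed

lemma sobolev_const_nonneg: "real CARD('n) * \<beta> / 2 < 1 \<Longrightarrow> sobolev_const \<beta> \<ge> 0"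
  by (simp add: sobolev_const_def)

text \<open>Translation invariance makes every difference quotient integrate to zero, and dominated
  convergence passes to the derivative. Applied to a product of test functions, this is integration
  by parts.\<close>

lemma test_int_pd0:
  assumes "test_fun \<Omega> f" shows "(LINT x|M. pd i f x) = 0"
proof -
  obtain B where B: "B \<ge> 0" "\<And>x. \<bar>f x\<bar> \<le> B" "\<And>x. norm (grad f x) \<le> B"
    using test_fun_bounded[OF assms] by blast
  have fm [measurable]: "f \<in> borel_measurable borel" by (rule test_fun_sq_int(5)[OF assms])
  have pm [measurable]: "pd i f \<in> borel_measurable borel"
    using test_fun_pd_cont[OF assms] by (rule borel_measurable_continuous_onI)
  obtain R where R: "\<And>x. x \<in> \<Omega> \<Longrightarrow> norm x \<le> R" using Om_bounded bounded_pos by metis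
  let ?K = "closure {x. f x \<noteq> 0}"
  have K: "compact ?K" using assms by (simp add: test_fun_def)
  have "integrable lborel (\<lambda>x. indicator ?K x *\<^sub>R f x)"
    by (rule borel_integrable_compact[OF K continuous_on_subset[OF test_fun_cont[OF assms] subset_UNIV]])
  moreover have "(\<lambda>x. indicator ?K x *\<^sub>R f x) = f"
  proof
    fix x
    have "x \<notin> ?K \<Longrightarrow> f x = 0" by (rule test_fun_outside(1)[OF assms])
    then show "indicator ?K x *\<^sub>R f x = f x" by (cases "x \<in> ?K") (simp_all only: indicator_simps, auto)
  qed
  ultimately have fI: "integrable lborel f" by simp
  have fIs: "integrable lborel (\<lambda>x. f (c + x)) \<and> (\<integral>x. f (c + x) \<partial>lborel) = (\<integral>x. f x \<partial>lborel)" for c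
  proof -
    have "integrable (distr lborel borel ((+) c)) f" using fI by (simp add: lborel_distr_plus)
    then have "integrable lborel (\<lambda>x. f (c + x))" by (subst (asm) integrable_distr_eq) auto
    moreover have "(\<integral>x. f x \<partial>(distr lborel borel ((+) c))) = (\<integral>x. f (c + x) \<partial>lborel)"
      by (rule integral_distr) auto
    ultimately show ?thesis by (simp add: lborel_distr_plus)
  qed
  define h where "h n = 1 / real (Suc n)" for n
  have h: "h n > 0" "h n \<le> 1" for n by (auto simp: h_def)
  have h0: "h \<longlonglongrightarrow> 0" unfolding h_def by (rule LIMSEQ_one_over_Suc)
  define q where "q n x = (f (h n *\<^sub>R axis i 1 + x) - f x) / h n" for n x
  have q0: "(\<integral>x. q n x \<partial>lborel) = 0" for n
    unfolding q_def using fI fIs[of "h n *\<^sub>R axis i 1"] by simp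
  \<comment> \<open>The gradient bound \<open>B\<close> is a Lipschitz constant and bounds the
    quotients. All shifts have length at most 1, so the quotients vanish outside the ball of radius
    \<open>R + 1\<close>.\<close>
  have "(\<lambda>n. \<integral>x. q n x \<partial>lborel) \<longlonglongrightarrow> (\<integral>x. pd i f x \<partial>lborel)"
  proof (rule integral_dominated_convergence[where w="\<lambda>x. B * indicator (cball 0 (R + 1)) x"])
    show "integrable lborel (\<lambda>x::real^'n. B * indicator (cball 0 (R + 1)) x)"
    proof (intro integrable_mult_right integrable_real_indicator)
      show "emeasure lborel (cball (0::real^'n) (R + 1)) < \<infinity>" by (rule emeasure_bounded_finite) simp
    qed simp
    show "q n \<in> borel_measurable lborel" for n unfolding q_def by measurable
    show "pd i f \<in> borel_measurable lborel" by simp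
    show "AE x in lborel. (\<lambda>n. q n x) \<longlonglongrightarrow> pd i f x"
    proof (rule AE_I2)
      fix x
      have "((\<lambda>t. f (t *\<^sub>R axis i 1 + x)) has_derivative (\<lambda>t. grad f x \<bullet> (t *\<^sub>R axis i 1))) (at 0)"
      proof -
        have g: "((\<lambda>t::real. t *\<^sub>R axis i 1 + x) has_derivative (\<lambda>t. t *\<^sub>R axis i 1)) (at 0)"
          by (auto intro!: derivative_eq_intros)
        from has_derivative_compose[OF g, of f "\<lambda>h. grad f x \<bullet> h"] has_derivative_pd[OF test_fun_diff[OF assms]]
        show ?thesis by simp
      qed
      moreover have "(\<lambda>t. grad f x \<bullet> (t *\<^sub>R axis i 1)) = (*) (pd i f x)"
        by (auto simp: inner_axis mult.commute)
      ultimately have "((\<lambda>t. f (t *\<^sub>R axis i 1 + x)) has_real_derivative pd i f x) (at 0)"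
        by (simp add: has_field_derivative_def)
      then have L: "((\<lambda>t. (f (t *\<^sub>R axis i 1 + x) - f x) / t) \<longlongrightarrow> pd i f x) (at 0)"
        by (simp add: has_field_derivative_iff)
      have "filterlim h (at 0) sequentially"
        using h0 h(1) by (auto simp: filterlim_at intro!: always_eventually) (metis less_irrefl)
      from filterlim_compose[OF L this] show "(\<lambda>n. q n x) \<longlonglongrightarrow> pd i f x" by (simp add: q_def)
    qed
    show "AE x in lborel. norm (q n x) \<le> B * indicator (cball 0 (R + 1)) x" for n
    proof (rule AE_I2)
      fix x
      show "norm (q n x) \<le> B * indicator (cball 0 (R + 1)) x"
      proof (cases "x \<in> cball 0 (R + 1)")
        case True
        have "norm (f (h n *\<^sub>R axis i 1 + x) - f x) \<le> B * norm (h n *\<^sub>R axis i 1 + x - x)"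
        proof (rule differentiable_bound[of UNIV f "\<lambda>x h. grad f x \<bullet> h"])
          show "(f has_derivative (\<bullet>) (grad f y)) (at y within UNIV)" for y
            using has_derivative_pd[OF test_fun_diff[OF assms]] by simp
          show "onorm ((\<bullet>) (grad f y)) \<le> B" for y
          proof (rule onorm_le)
            fix z
            have "\<bar>grad f y \<bullet> z\<bar> \<le> norm (grad f y) * norm z" by (rule Cauchy_Schwarz_ineq2)
            also have "\<dots> \<le> B * norm z" using B(3)[of y] by (rule mult_right_mono) simp
            finally show "norm (grad f y \<bullet> z) \<le> B * norm z" by simp
          qed
        qed auto
        then show ?thesis using h[of n] True by (simp add: q_def divide_simps)
      next
        case False
        then have "x \<notin> \<Omega>" using R by force
        moreover have "h n *\<^sub>R axis i 1 + x \<notin> \<Omega>"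
        proof
          assume "h n *\<^sub>R axis i 1 + x \<in> \<Omega>"
          then have "norm (h n *\<^sub>R axis i 1 + x) \<le> R" by (rule R)
          moreover have "norm x \<le> norm (h n *\<^sub>R axis i 1 + x) + norm (h n *\<^sub>R (axis i 1 :: real^'n))"
            using norm_triangle_ineq4[of "h n *\<^sub>R axis i 1 + x" "h n *\<^sub>R axis i 1"] by simp
          moreover have "norm (h n *\<^sub>R (axis i 1 :: real^'n)) \<le> 1" using h[of n] by simp
          ultimately show False using False by simp
        qed
        ultimately show ?thesis using test_fun_outside_dom(1)[OF assms] B(1) by (simp add: q_def)
      qed
    qed
  qed
  then have "(\<lambda>n. 0::real) \<longlonglongrightarrow> (\<integral>x. pd i f x \<partial>lborel)" by (simp only: q0)
  then have z: "(\<integral>x. pd i f x \<partial>lborel) = 0" by (simp add: LIMSEQ_const_iff)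
  have "(LINT x|M. pd i f x) = (\<integral>x. indicator \<Omega> x *\<^sub>R pd i f x \<partial>lebesgue)"
    by (rule integral_restrict_space) simp
  also have "(\<lambda>x. indicator \<Omega> x *\<^sub>R pd i f x) = pd i f"
  proof
    fix x
    show "indicator \<Omega> x *\<^sub>R pd i f x = pd i f x"
      using grad_nth[of f x i] test_fun_outside_dom(2)[OF assms, of x] by (cases "x \<in> \<Omega>") (auto simp del: grad_nth)
  qed
  also have "(\<integral>x. pd i f x \<partial>lebesgue) = (\<integral>x. pd i f x \<partial>lborel)"
    by (rule integral_completion) simp
  finally show ?thesis using z by simp
qed

end

section \<open>Sobolev functions with zero boundary values\<close>

context bounded_open_set
begin

definition W0 :: "(real^'n \<Rightarrow> real) \<Rightarrow> (real^'n \<Rightarrow> real^'n) \<Rightarrow> bool" where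
  "W0 u g \<longleftrightarrow> sq_int M u \<and> sq_int M g \<and> (\<exists>\<phi>. (\<forall>k. test_fun \<Omega> (\<phi> k)) \<and>
     (\<lambda>k. sq_norm M (\<lambda>x. \<phi> k x - u x)) \<longlonglongrightarrow> 0 \<and> (\<lambda>k. sq_norm M (\<lambda>x. grad (\<phi> k) x - g x)) \<longlonglongrightarrow> 0)"

definition approx :: "(real^'n \<Rightarrow> real) \<Rightarrow> (real^'n \<Rightarrow> real^'n) \<Rightarrow> (nat \<Rightarrow> real^'n \<Rightarrow> real) \<Rightarrow> bool" where
  "approx u g \<phi> \<longleftrightarrow> (\<forall>k. test_fun \<Omega> (\<phi> k)) \<and> (\<lambda>k. sq_norm M (\<lambda>x. \<phi> k x - u x)) \<longlonglongrightarrow> 0 \<and>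
    (\<lambda>k. sq_norm M (\<lambda>x. grad (\<phi> k) x - g x)) \<longlonglongrightarrow> 0 \<and> (AE x in M. (\<lambda>k. \<phi> k x) \<longlonglongrightarrow> u x)"

lemma approxD:
  assumes "approx u g \<phi>"
  shows "test_fun \<Omega> (\<phi> k)" "(\<lambda>k. sq_norm M (\<lambda>x. \<phi> k x - u x)) \<longlonglongrightarrow> 0"
    "(\<lambda>k. sq_norm M (\<lambda>x. grad (\<phi> k) x - g x)) \<longlonglongrightarrow> 0" "AE x in M. (\<lambda>k. \<phi> k x) \<longlonglongrightarrow> u x"
  using assms by (auto simp: approx_def)

lemma W0_approx:
  assumes "W0 u g"
  obtains \<phi> where "approx u g \<phi>"
proof -
  obtain \<phi> where p: "\<And>k. test_fun \<Omega> (\<phi> k)" "(\<lambda>k. sq_norm M (\<lambda>x. \<phi> k x - u x)) \<longlonglongrightarrow> 0"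
    "(\<lambda>k. sq_norm M (\<lambda>x. grad (\<phi> k) x - g x)) \<longlonglongrightarrow> 0"
    using assms unfolding W0_def by blast
  have "sq_int M (\<lambda>x. \<phi> k x - u x)" for k
    using test_fun_sq_int(1)[OF p(1)] assms by (auto simp: W0_def intro: sq_int_diff)
  then obtain r :: "nat \<Rightarrow> nat" where r: "strict_mono r" "AE x in M. (\<lambda>k. \<phi> (r k) x) \<longlonglongrightarrow> u x"
    using sq_norm_AE_subseq[OF _ p(2)] by blast
  have "approx u g (\<lambda>k. \<phi> (r k))"
    using p r LIMSEQ_subseq_LIMSEQ[OF p(2) r(1)] LIMSEQ_subseq_LIMSEQ[OF p(3) r(1)] by (simp add: o_def approx_def)
  then show thesis by (rule that)
qed

lemma W0_sq_int: "W0 u g \<Longrightarrow> sq_int M u" "W0 u g \<Longrightarrow> sq_int M g"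
  by (auto simp: W0_def)

lemma W0_meas: "W0 u g \<Longrightarrow> u \<in> borel_measurable M" "W0 u g \<Longrightarrow> g \<in> borel_measurable M"
  by (auto simp: W0_def sq_int_def)

lemma W0_test: "test_fun \<Omega> f \<Longrightarrow> W0 f (grad f)"
  unfolding W0_def using test_fun_sq_int(1,2) by (intro conjI exI[of _ "\<lambda>k. f"]) (auto simp: sq_norm_def)

lemma W0_zero: "W0 (\<lambda>x. 0) (\<lambda>x. 0)"
proof -
  have "grad (\<lambda>x::real^'n. 0::real) = (\<lambda>x. 0)"
    using grad_cmult[of "\<lambda>x. 0" _ 0] by auto
  then show ?thesis using W0_test[OF test_fun_zero] by simp
qed

lemma W0_lin:
  assumes "W0 u g" "W0 v h"
  shows "W0 (\<lambda>x. u x + c * v x) (\<lambda>x. g x + c *\<^sub>R h x)"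
proof -
  obtain \<phi> where "approx u g \<phi>" using W0_approx[OF assms(1)] by blast
  note p = approxD[OF this]
  obtain \<psi> where "approx v h \<psi>" using W0_approx[OF assms(2)] by blast
  note q = approxD[OF this]
  note s = W0_sq_int[OF assms(1)] W0_sq_int[OF assms(2)]
  let ?f = "\<lambda>k x. \<phi> k x + c * \<psi> k x"
  have gr: "grad (?f k) x = grad (\<phi> k) x + c *\<^sub>R grad (\<psi> k) x" for k x
    using grad_add[OF test_fun_diff[OF p(1)] test_fun_diff[OF test_fun_cmult[OF q(1)]]]
      grad_cmult[OF test_fun_diff[OF q(1)]] by simp
  have "sq_norm M (\<lambda>x. ?f k x - (u x + c * v x)) \<le> 2 * sq_norm M (\<lambda>x. \<phi> k x - u x) + 2 * (c^2 * sq_norm M (\<lambda>x. \<psi> k x - v x))" for k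
  proof -
    have "sq_norm M (\<lambda>x. (\<phi> k x - u x) + c *\<^sub>R (\<psi> k x - v x)) \<le> 2 * sq_norm M (\<lambda>x. \<phi> k x - u x) + 2 * sq_norm M (\<lambda>x. c *\<^sub>R (\<psi> k x - v x))"
      using s test_fun_sq_int[OF p(1)] test_fun_sq_int[OF q(1)] by (intro sq_norm_add sq_int_diff sq_int_scale)
    then show ?thesis unfolding sq_norm_scale by (simp add: algebra_simps)
  qed
  then have 1: "(\<lambda>k. sq_norm M (\<lambda>x. ?f k x - (u x + c * v x))) \<longlonglongrightarrow> 0"
    by (rule tendsto_zero_squeeze[rotated 2]) (use p(2) q(2) in \<open>auto intro!: tendsto_eq_intros\<close>)
  have "sq_norm M (\<lambda>x. grad (?f k) x - (g x + c *\<^sub>R h x)) \<le> 2 * sq_norm M (\<lambda>x. grad (\<phi> k) x - g x) + 2 * (c^2 * sq_norm M (\<lambda>x. grad (\<psi> k) x - h x))" for k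
  proof -
    have "sq_norm M (\<lambda>x. (grad (\<phi> k) x - g x) + c *\<^sub>R (grad (\<psi> k) x - h x)) \<le> 2 * sq_norm M (\<lambda>x. grad (\<phi> k) x - g x) + 2 * sq_norm M (\<lambda>x. c *\<^sub>R (grad (\<psi> k) x - h x))"
      using s test_fun_sq_int[OF p(1)] test_fun_sq_int[OF q(1)] by (intro sq_norm_add sq_int_diff sq_int_scale)
    then show ?thesis unfolding sq_norm_scale by (simp add: gr algebra_simps)
  qed
  then have 2: "(\<lambda>k. sq_norm M (\<lambda>x. grad (?f k) x - (g x + c *\<^sub>R h x))) \<longlonglongrightarrow> 0"
    by (rule tendsto_zero_squeeze[rotated 2]) (use p(3) q(3) in \<open>auto intro!: tendsto_eq_intros\<close>)
  have "test_fun \<Omega> (?f k)" for k using p(1) q(1) by (intro test_fun_add test_fun_cmult)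
  moreover have "sq_int M (\<lambda>x. u x + c * v x)" "sq_int M (\<lambda>x. g x + c *\<^sub>R h x)"
    using s by (auto intro!: sq_int_add sq_int_scale sq_int_cmult)
  ultimately show ?thesis unfolding W0_def using 1 2 by (intro conjI exI[of _ ?f]) auto
qed

lemma W0_diff: "W0 u g \<Longrightarrow> W0 v h \<Longrightarrow> W0 (\<lambda>x. u x - v x) (\<lambda>x. g x - h x)"
  using W0_lin[of u g v h "-1"] by simp

lemma W0_scale: "W0 v h \<Longrightarrow> W0 (\<lambda>x. c * v x) (\<lambda>x. c *\<^sub>R h x)"
  using W0_lin[OF W0_zero, of v h c] by simp

text \<open>A diagonal choice: \<open>f k\<close> is a test function whose squared distances to the
  k-th function and its gradient are both below \<open>1 / real (Suc k)\<close>.\<close>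

lemma W0_limit:
  assumes s: "\<And>k. W0 (u k) (g k)" and v: "sq_int M v" "sq_int M h"
    and lim: "(\<lambda>k. sq_norm M (\<lambda>x. u k x - v x)) \<longlonglongrightarrow> 0" "(\<lambda>k. sq_norm M (\<lambda>x. g k x - h x)) \<longlonglongrightarrow> 0"
  shows "W0 v h"
proof -
  have "\<exists>f. test_fun \<Omega> f \<and> sq_norm M (\<lambda>x. f x - u k x) < 1 / real (Suc k) \<and> sq_norm M (\<lambda>x. grad f x - g k x) < 1 / real (Suc k)" for k
  proof -
    obtain \<phi> where "approx (u k) (g k) \<phi>" using W0_approx[OF s[of k]] by blast
  note p = approxD[OF this]
    have "\<forall>\<^sub>F j in sequentially. sq_norm M (\<lambda>x. \<phi> j x - u k x) < 1 / real (Suc k)"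
      "\<forall>\<^sub>F j in sequentially. sq_norm M (\<lambda>x. grad (\<phi> j) x - g k x) < 1 / real (Suc k)"
      using order_tendstoD(2)[OF p(2), of "1 / real (Suc k)"] order_tendstoD(2)[OF p(3), of "1 / real (Suc k)"] by auto
    then have "\<forall>\<^sub>F j in sequentially. sq_norm M (\<lambda>x. \<phi> j x - u k x) < 1 / real (Suc k) \<and> sq_norm M (\<lambda>x. grad (\<phi> j) x - g k x) < 1 / real (Suc k)"
      by (rule eventually_conj)
    then obtain j where "sq_norm M (\<lambda>x. \<phi> j x - u k x) < 1 / real (Suc k) \<and> sq_norm M (\<lambda>x. grad (\<phi> j) x - g k x) < 1 / real (Suc k)"
      using eventually_happens'[OF sequentially_bot] by blast
    then show ?thesis using p(1) by blast
  qed
  then have "\<forall>k. \<exists>f. test_fun \<Omega> f \<and> sq_norm M (\<lambda>x. f x - u k x) < 1 / real (Suc k) \<and> sq_norm M (\<lambda>x. grad f x - g k x) < 1 / real (Suc k)"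
    by (rule allI)
  from choice[OF this] obtain f where f: "\<And>k. test_fun \<Omega> (f k)" "\<And>k. sq_norm M (\<lambda>x. f k x - u k x) < 1 / real (Suc k)"
    "\<And>k. sq_norm M (\<lambda>x. grad (f k) x - g k x) < 1 / real (Suc k)" by auto
  have z: "(\<lambda>k. 1 / real (Suc k)) \<longlonglongrightarrow> 0" by (rule LIMSEQ_one_over_Suc)
  have 1: "(\<lambda>k. sq_norm M (\<lambda>x. f k x - v x)) \<longlonglongrightarrow> 0"
  proof (rule tendsto_zero_squeeze)
    show "(\<lambda>k. 2 * (1 / real (Suc k)) + 2 * sq_norm M (\<lambda>x. u k x - v x)) \<longlonglongrightarrow> 0"
      using tendsto_add[OF tendsto_mult_left[OF z, of 2] tendsto_mult_left[OF lim(1), of 2]] by simp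
    show "sq_norm M (\<lambda>x. f k x - v x) \<le> 2 * (1 / real (Suc k)) + 2 * sq_norm M (\<lambda>x. u k x - v x)" for k
      using sq_norm_tri[OF test_fun_sq_int(1)[OF f(1)] W0_sq_int(1)[OF s] v(1), of k k] f(2)[of k] by simp
  qed simp
  have 2: "(\<lambda>k. sq_norm M (\<lambda>x. grad (f k) x - h x)) \<longlonglongrightarrow> 0"
  proof (rule tendsto_zero_squeeze)
    show "(\<lambda>k. 2 * (1 / real (Suc k)) + 2 * sq_norm M (\<lambda>x. g k x - h x)) \<longlonglongrightarrow> 0"
      using tendsto_add[OF tendsto_mult_left[OF z, of 2] tendsto_mult_left[OF lim(2), of 2]] by simp
    show "sq_norm M (\<lambda>x. grad (f k) x - h x) \<le> 2 * (1 / real (Suc k)) + 2 * sq_norm M (\<lambda>x. g k x - h x)" for k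
      using sq_norm_tri[OF test_fun_sq_int(2)[OF f(1)] W0_sq_int(2)[OF s] v(2), of k k] f(3)[of k] by simp
  qed simp
  show ?thesis unfolding W0_def using v f(1) 1 2 by blast
qed

lemma sq_norm_factor_conv:
  fixes q :: "nat \<Rightarrow> real^'n \<Rightarrow> real" and g :: "real^'n \<Rightarrow> real^'n"
  assumes m: "\<And>k. q k \<in> borel_measurable M" "p \<in> borel_measurable M" and g: "sq_int M g"
    and b: "\<And>k x. \<bar>q k x\<bar> \<le> L" "\<And>x. \<bar>p x\<bar> \<le> L"
    and lim: "AE x in M. (\<lambda>k. q k x) \<longlonglongrightarrow> p x"
  shows "(\<lambda>k. sq_norm M (\<lambda>x. q k x *\<^sub>R g x - p x *\<^sub>R g x)) \<longlonglongrightarrow> 0"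
proof -
  note [measurable] = m sq_int_meas[OF g]
  have "(\<lambda>k. LINT x|M. (norm (q k x *\<^sub>R g x - p x *\<^sub>R g x))^2) \<longlonglongrightarrow> (LINT x|M. 0)"
  proof (rule integral_dominated_convergence[where w="\<lambda>x. (2 * L)^2 * (norm (g x))^2"])
    show "integrable M (\<lambda>x. (2 * L)^2 * (norm (g x))^2)" using sq_int_int[OF g] by simp
    show "AE x in M. (\<lambda>k. (norm (q k x *\<^sub>R g x - p x *\<^sub>R g x))^2) \<longlonglongrightarrow> 0"
      using lim
    proof eventually_elim
      case (elim x)
      have "(\<lambda>k. (norm (q k x *\<^sub>R g x - p x *\<^sub>R g x))^2) \<longlonglongrightarrow> (norm (p x *\<^sub>R g x - p x *\<^sub>R g x))^2"
        using elim by (intro tendsto_intros)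
      then show ?case by simp
    qed
    show "AE x in M. norm ((norm (q k x *\<^sub>R g x - p x *\<^sub>R g x))^2) \<le> (2 * L)^2 * (norm (g x))^2" for k
    proof (rule AE_I2)
      fix x
      have "\<bar>q k x - p x\<bar> \<le> 2 * L" using b(1)[of k x] b(2)[of x] by linarith
      then have "\<bar>q k x - p x\<bar>^2 \<le> (2 * L)^2" by (intro power_mono) auto
      then have "\<bar>q k x - p x\<bar>^2 * (norm (g x))^2 \<le> (2 * L)^2 * (norm (g x))^2" by (intro mult_right_mono) auto
      then show "norm ((norm (q k x *\<^sub>R g x - p x *\<^sub>R g x))^2) \<le> (2 * L)^2 * (norm (g x))^2"
        by (simp add: scaleR_left_diff_distrib[symmetric] power_mult_distrib)
    qed
  qed measurable
  then show ?thesis by (simp add: sq_norm_def)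
qed

text \<open>Composition with \<open>p\<close> maps the approximating test functions to test
  functions. The error of the gradients splits into \<open>p'\<close> times the error of the old
  gradients, controlled by \<open>L\<close>, and a change of the factor \<open>p'\<close> in front
  of the fixed \<open>g\<close>, which tends to 0 by dominated convergence because the approximation
  also converges almost everywhere.\<close>

lemma W0_comp:
  assumes s: "W0 u g" and p: "smooth1 p" "p 0 = 0" "\<And>s. (p has_real_derivative p' s) (at s)"
    and L: "\<And>s. \<bar>p' s\<bar> \<le> L"
  shows "W0 (\<lambda>x. p (u x)) (\<lambda>x. p' (u x) *\<^sub>R g x)"
proof -
  obtain \<phi> where "approx u g \<phi>" using W0_approx[OF s] by blast
  note f = approxD[OF this]
  obtain q where q: "smooth1 q" "\<And>s. (p has_real_derivative q s) (at s)" using smooth1_deriv[OF p(1)] by blast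
  have "q = p'" using q(2) p(3) DERIV_unique by blast
  then have "isCont p' s" for s using smooth1_deriv[OF q(1)] DERIV_isCont by metis
  then have pc': "continuous_on UNIV p'" and pci: "\<And>s. isCont p' s" by (auto simp: continuous_on_eq_continuous_at)
  have pc: "continuous_on UNIV p" using p(3) DERIV_isCont by (auto simp: continuous_on_eq_continuous_at)
  have pm [measurable]: "p \<in> borel_measurable borel" "p' \<in> borel_measurable borel"
    using pc pc' by (auto intro: borel_measurable_continuous_onI)
  note [measurable] = W0_meas[OF s] test_fun_sq_int(3,4)[OF f(1)]
  have lip: "\<bar>p a - p b\<bar> \<le> L * \<bar>a - b\<bar>" for a b
  proof -
    have "norm (p a - p b) \<le> L * norm (a - b)"
      by (rule field_differentiable_bound[of UNIV p p' L]) (use p(3) L in auto)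
    then show ?thesis by simp
  qed
  have gr: "grad (\<lambda>x. p (\<phi> k x)) x = p' (\<phi> k x) *\<^sub>R grad (\<phi> k) x" for k x
    by (rule grad_comp[OF test_fun_diff[OF f(1)] p(3)])
  have 1: "(\<lambda>k. sq_norm M (\<lambda>x. p (\<phi> k x) - p (u x))) \<longlonglongrightarrow> 0"
  proof (rule tendsto_zero_squeeze)
    show "(\<lambda>k. L^2 * sq_norm M (\<lambda>x. \<phi> k x - u x)) \<longlonglongrightarrow> 0" using f(2) by (auto intro!: tendsto_eq_intros)
    show "sq_norm M (\<lambda>x. p (\<phi> k x) - p (u x)) \<le> L^2 * sq_norm M (\<lambda>x. \<phi> k x - u x)" for k
    proof (rule sq_norm_mono)
      show "sq_int M (\<lambda>x. \<phi> k x - u x)" using test_fun_sq_int(1)[OF f(1)] W0_sq_int(1)[OF s] by (rule sq_int_diff)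
      show "AE x in M. norm (p (\<phi> k x) - p (u x)) \<le> L * norm (\<phi> k x - u x)" using lip by (intro AE_I2) simp
    qed measurable
  qed simp
  have sg: "sq_int M (\<lambda>x. p' (v x) *\<^sub>R h x)" if "sq_int M h" "v \<in> borel_measurable M" for h :: "real^'n \<Rightarrow> real^'n" and v
  proof (rule sq_int_bound[OF that(1)])
    show "(\<lambda>x. p' (v x) *\<^sub>R h x) \<in> borel_measurable M" using that(2) sq_int_meas[OF that(1)] by measurable
    show "AE x in M. norm (p' (v x) *\<^sub>R h x) \<le> L * norm (h x)"
      using L by (auto intro!: AE_I2 mult_right_mono)
  qed
  have 2: "(\<lambda>k. sq_norm M (\<lambda>x. p' (\<phi> k x) *\<^sub>R grad (\<phi> k) x - p' (u x) *\<^sub>R g x)) \<longlonglongrightarrow> 0"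
  proof (rule tendsto_zero_squeeze)
    have "(\<lambda>k. sq_norm M (\<lambda>x. p' (\<phi> k x) *\<^sub>R g x - p' (u x) *\<^sub>R g x)) \<longlonglongrightarrow> 0"
    proof (rule sq_norm_factor_conv[OF _ _ W0_sq_int(2)[OF s] L L])
      show "AE x in M. (\<lambda>k. p' (\<phi> k x)) \<longlonglongrightarrow> p' (u x)"
        using f(4) by eventually_elim (rule isCont_tendsto_compose[OF pci])
    qed measurable
    then show "(\<lambda>k. 2 * (L^2 * sq_norm M (\<lambda>x. grad (\<phi> k) x - g x)) + 2 * sq_norm M (\<lambda>x. p' (\<phi> k x) *\<^sub>R g x - p' (u x) *\<^sub>R g x)) \<longlonglongrightarrow> 0"
      using f(3) by (auto intro!: tendsto_eq_intros)
    fix k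
    have dg: "sq_int M (\<lambda>x. grad (\<phi> k) x - g x)" using test_fun_sq_int(2)[OF f(1)] W0_sq_int(2)[OF s] by (rule sq_int_diff)
    have "sq_norm M (\<lambda>x. p' (\<phi> k x) *\<^sub>R grad (\<phi> k) x - p' (u x) *\<^sub>R g x) \<le> 2 * sq_norm M (\<lambda>x. p' (\<phi> k x) *\<^sub>R grad (\<phi> k) x - p' (\<phi> k x) *\<^sub>R g x)
       + 2 * sq_norm M (\<lambda>x. p' (\<phi> k x) *\<^sub>R g x - p' (u x) *\<^sub>R g x)"
      by (rule sq_norm_tri; rule sg; fact test_fun_sq_int(2)[OF f(1)] W0_sq_int(2)[OF s] test_fun_sq_int(3)[OF f(1)] W0_meas(1)[OF s])
    also have "sq_norm M (\<lambda>x. p' (\<phi> k x) *\<^sub>R grad (\<phi> k) x - p' (\<phi> k x) *\<^sub>R g x) \<le> L^2 * sq_norm M (\<lambda>x. grad (\<phi> k) x - g x)"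
    proof (rule sq_norm_mono[OF dg])
      show "AE x in M. norm (p' (\<phi> k x) *\<^sub>R grad (\<phi> k) x - p' (\<phi> k x) *\<^sub>R g x) \<le> L * norm (grad (\<phi> k) x - g x)"
        using L by (auto intro!: AE_I2 mult_right_mono simp: scaleR_diff_right[symmetric])
    qed measurable
    finally show "sq_norm M (\<lambda>x. p' (\<phi> k x) *\<^sub>R grad (\<phi> k) x - p' (u x) *\<^sub>R g x)
       \<le> 2 * (L^2 * sq_norm M (\<lambda>x. grad (\<phi> k) x - g x)) + 2 * sq_norm M (\<lambda>x. p' (\<phi> k x) *\<^sub>R g x - p' (u x) *\<^sub>R g x)" by simp
  qed simp
  have "sq_int M (\<lambda>x. p (u x))"
  proof (rule sq_int_bound[OF W0_sq_int(1)[OF s]])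
    show "AE x in M. norm (p (u x)) \<le> L * norm (u x)" using lip[of _ 0] p(2) by (intro AE_I2) simp
  qed measurable
  moreover have "sq_int M (\<lambda>x. p' (u x) *\<^sub>R g x)" by (rule sg[OF W0_sq_int(2)[OF s] W0_meas(1)[OF s]])
  moreover have "test_fun \<Omega> (\<lambda>x. p (\<phi> k x))" for k by (rule test_fun_comp[OF f(1) p(1,2)])
  ultimately show ?thesis unfolding W0_def
    by (intro conjI exI[of _ "\<lambda>k x. p (\<phi> k x)"]) (use 1 2 in \<open>auto simp: gr\<close>)
qed

text \<open>The value at \<open>k\<close> is the limit of the derivatives of the soft plus functions; with this value no statement about
  gradients on level sets is needed.\<close>

definition heaviside :: "real \<Rightarrow> real \<Rightarrow> real" where
  "heaviside k s = (if s > k then 1 else if s = k then 1 / 2 else 0)"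

lemma heaviside_bounds: "0 \<le> heaviside k s" "heaviside k s \<le> 1" "\<bar>heaviside k s\<bar> \<le> 1" by (auto simp: heaviside_def)

lemma heaviside_meas [measurable]: "heaviside k \<in> borel_measurable borel"
  unfolding heaviside_def by measurable

lemma sigmoid_lim:
  "(\<lambda>j. sigmoid ((s - k) / (1 / real (Suc j)))) \<longlonglongrightarrow> heaviside k s"
proof -
  have A: "LIM j sequentially. a * real (Suc j) :> at_top" if "a > 0" for a
    using filterlim_tendsto_pos_mult_at_top[OF tendsto_const that filterlim_compose[OF filterlim_real_sequentially filterlim_Suc]] .
  have sg: "sigmoid t = 1 / (1 + exp (- t))" for t by (simp add: sigmoid_def)
  consider "s > k" | "s = k" | "s < k" by linarith
  then show ?thesis
  proof cases
    case 1
    have "LIM j sequentially. - ((s - k) * real (Suc j)) :> at_bot"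
      using A[of "s - k"] 1 by (simp add: filterlim_uminus_at_top[symmetric] filterlim_uminus_at_bot)
    then have "(\<lambda>j. exp (- ((s - k) * real (Suc j)))) \<longlonglongrightarrow> 0" by (rule filterlim_compose[OF exp_at_bot])
    then have "(\<lambda>j. 1 / (1 + exp (- ((s - k) * real (Suc j))))) \<longlonglongrightarrow> 1 / (1 + 0)" by (intro tendsto_intros) auto
    then show ?thesis using 1 by (simp add: sg heaviside_def)
  next
    case 2 then show ?thesis by (simp add: heaviside_def)
  next
    case 3
    have "LIM j sequentially. ((k - s) * real (Suc j)) :> at_top" using A[of "k - s"] 3 by simp
    then have "LIM j sequentially. exp ((k - s) * real (Suc j)) :> at_top" by (rule filterlim_compose[OF exp_at_top])
    then have "LIM j sequentially. 1 + exp ((k - s) * real (Suc j)) :> at_top"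
      by (rule filterlim_tendsto_add_at_top[OF tendsto_const])
    then have "(\<lambda>j. 1 / (1 + exp ((k - s) * real (Suc j)))) \<longlonglongrightarrow> 0"
      by (intro tendsto_divide_0[OF tendsto_const] filterlim_at_top_imp_at_infinity)
    moreover have "sigmoid ((s - k) / (1 / real (Suc j))) = 1 / (1 + exp ((k - s) * real (Suc j)))" for j
      by (simp add: sg algebra_simps)
    ultimately show ?thesis using 3 by (simp add: heaviside_def)
  qed
qed

text \<open>The subtracted constant makes the function vanish at 0, as compositions with test
  functions require. It is small because \<open>max (0 - k) 0 = 0\<close> for nonnegative
  \<open>k\<close>.\<close>

lemma softplus_close:
  assumes e: "e > 0" and k: "k \<ge> 0"
  shows "\<bar>softplus e (s - k) + (- softplus e (0 - k)) - max (s - k) 0\<bar> \<le> e"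
proof -
  have l2: "e * ln 2 \<le> e * 1" using e ln_2_less_1 by (intro mult_left_mono) auto
  have "max (0 - k) 0 = 0" using k by simp
  then show ?thesis using softplus_bounds[OF e, of "s - k"] softplus_bounds[OF e, of "0 - k"] l2 by linarith
qed

text \<open>The normalised soft plus functions converge uniformly to the positive part, hence in L2
  on a set of finite measure, and their bounded derivatives converge pointwise to
  \<open>heaviside k\<close>.\<close>

lemma W0_pos:
  assumes s: "W0 u g" and k: "k \<ge> 0"
  shows "W0 (\<lambda>x. max (u x - k) 0) (\<lambda>x. heaviside k (u x) *\<^sub>R g x)"
proof -
  define e where "e j = 1 / real (Suc j)" for j
  have e: "e j > 0" for j by (simp add: e_def)
  have e0: "e \<longlonglongrightarrow> 0" unfolding e_def by (rule LIMSEQ_one_over_Suc)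
  define p where "p j s = softplus (e j) (s - k) + (- softplus (e j) (0 - k))" for j s
  note [measurable] = W0_meas[OF s]
  have sj: "W0 (\<lambda>x. p j (u x)) (\<lambda>x. sigmoid ((u x - k) / e j) *\<^sub>R g x)" for j
  proof (rule W0_comp[OF s, of _ _ 1])
    show "smooth1 (p j)" unfolding p_def by (rule smooth1_softplus[OF e])
    show "p j 0 = 0" by (simp add: p_def)
    show "(p j has_real_derivative sigmoid ((s - k) / e j)) (at s)" for s
      unfolding p_def by (rule DERIV_softplus[OF e])
    show "\<bar>sigmoid ((s - k) / e j)\<bar> \<le> 1" for s using sigmoid_bounds[of "(s - k) / e j"] by simp
  qed
  have close: "\<bar>p j s - max (s - k) 0\<bar> \<le> e j" for j s
    unfolding p_def by (rule softplus_close[OF e k])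
  show ?thesis
  proof (rule W0_limit[OF sj])
    show "sq_int M (\<lambda>x. max (u x - k) 0)"
    proof (rule sq_int_bound[OF W0_sq_int(1)[OF s], of _ 1])
      show "AE x in M. norm (max (u x - k) 0) \<le> 1 * norm (u x)" using k by (auto intro!: AE_I2)
    qed measurable
    show "sq_int M (\<lambda>x. heaviside k (u x) *\<^sub>R g x)"
    proof (rule sq_int_bound[OF W0_sq_int(2)[OF s], of _ 1])
      show "AE x in M. norm (heaviside k (u x) *\<^sub>R g x) \<le> 1 * norm (g x)"
        using heaviside_bounds by (auto intro!: AE_I2 simp: mult_left_le_one_le)
    qed measurable
    show "(\<lambda>j. sq_norm M (\<lambda>x. p j (u x) - max (u x - k) 0)) \<longlonglongrightarrow> 0"
    proof (rule tendsto_zero_squeeze)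
      show "(\<lambda>j. (e j)^2 * sq_norm M (\<lambda>x. 1::real)) \<longlonglongrightarrow> 0" using e0 by (auto intro!: tendsto_eq_intros)
      show "sq_norm M (\<lambda>x. p j (u x) - max (u x - k) 0) \<le> (e j)^2 * sq_norm M (\<lambda>x. 1::real)" for j
        by (rule sq_norm_mono) (use close W0_meas(1)[OF sj[of j]] in \<open>auto simp: sq_int_def\<close>)
    qed simp
    show "(\<lambda>j. sq_norm M (\<lambda>x. sigmoid ((u x - k) / e j) *\<^sub>R g x - heaviside k (u x) *\<^sub>R g x)) \<longlonglongrightarrow> 0"
    proof (rule sq_norm_factor_conv[OF _ _ W0_sq_int(2)[OF s], of _ _ 1])
      show "\<bar>sigmoid ((u x - k) / e j)\<bar> \<le> 1" for j x using sigmoid_bounds[of "(u x - k) / e j"] by simp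
      show "AE x in M. (\<lambda>j. sigmoid ((u x - k) / e j)) \<longlonglongrightarrow> heaviside k (u x)"
        unfolding e_def by (intro AE_I2 sigmoid_lim)
      show "(\<lambda>x. sigmoid ((u x - k) / e j)) \<in> borel_measurable M" for j unfolding sigmoid_def by measurable
    qed (auto simp: heaviside_bounds)
  qed
qed

end

section \<open>Agreement with the given Sobolev notions, and inequalities for limits\<close>

lemma norm_sq_vec: "(norm (x::real^'n))^2 = (\<Sum>i\<in>UNIV. (x $ i)^2)"
  by (simp only: power2_norm_eq_inner) (simp add: inner_vec_def power2_eq_square)

context bounded_open_set
begin

lemma L2_iff_sq_int: "L2 \<Omega> u \<longleftrightarrow> sq_int M u"
  by (simp add: L2_def sq_int_def)

lemma sq_int_vec: "sq_int M g \<longleftrightarrow> (\<forall>i. sq_int M (\<lambda>x. (g x :: real^'n) $ i))"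
proof
  assume g: "sq_int M g"
  note [measurable] = sq_int_meas[OF g]
  show "\<forall>i. sq_int M (\<lambda>x. g x $ i)"
  proof
    fix i
    have "(\<lambda>x. g x \<bullet> axis i 1) \<in> borel_measurable M" by measurable
    then have "(\<lambda>x. g x $ i) \<in> borel_measurable M" by (simp add: inner_axis)
    then show "sq_int M (\<lambda>x. g x $ i)"
      by (rule sq_int_bound[OF g, of _ 1]) (auto intro!: AE_I2 simp: component_le_norm_cart)
  qed
next
  assume g: "\<forall>i. sq_int M (\<lambda>x. g x $ i)"
  then have "g \<in> borel_measurable M"
    by (subst borel_measurable_euclidean_space) (auto simp: Basis_vec_def inner_axis sq_int_def)
  moreover have "integrable M (\<lambda>x. (norm (g x))^2)"
    unfolding norm_sq_vec using g by (auto simp: sq_int_def)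
  ultimately show "sq_int M g" by (simp add: sq_int_def)
qed

lemma W012_imp_W0:
  assumes "W012 \<Omega> u g" shows "W0 u g"
proof -
  have s: "sq_int M u" "sq_int M g"
    using assms unfolding W012_def weak_grad_def sq_int_vec L2_iff_sq_int by blast+
  obtain \<phi> where p: "\<And>k. test_fun \<Omega> (\<phi> k)" "(\<lambda>k. (LINT x|M. (\<phi> k x - u x)^2) + (LINT x|M. (norm (grad (\<phi> k) x - g x))^2)) \<longlonglongrightarrow> 0"
    using assms unfolding W012_def by blast
  then have c: "(\<lambda>k. sq_norm M (\<lambda>x. \<phi> k x - u x) + sq_norm M (\<lambda>x. grad (\<phi> k) x - g x)) \<longlonglongrightarrow> 0"
    by (simp add: sq_norm_def)
  have "(\<lambda>k. sq_norm M (\<lambda>x. \<phi> k x - u x)) \<longlonglongrightarrow> 0" "(\<lambda>k. sq_norm M (\<lambda>x. grad (\<phi> k) x - g x)) \<longlonglongrightarrow> 0"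
    by (rule tendsto_zero_squeeze[OF c]; simp)+
  then show ?thesis unfolding W0_def using s p(1) by blast
qed

text \<open>The converse direction lets solutions constructed here be fed back into the hypothesis
  of minimality, which is phrased with \<open>weak_grad\<close> and \<open>W012\<close>. Integration
  by parts holds for each approximating test function and survives the L2 limit.\<close>

lemma W0_imp_W012:
  assumes s: "W0 u g" shows "W012 \<Omega> u g"
proof -
  obtain \<phi> where ap: "approx u g \<phi>" using W0_approx[OF s] by blast
  note p = approxD[OF ap]
  have sg: "sq_int M (\<lambda>x. g x $ i)" for i using W0_sq_int(2)[OF s] sq_int_vec by blast
  have ibp: "(LINT x|M. u x * pd i \<psi> x) = - (LINT x|M. g x $ i * \<psi> x)" if t: "test_fun \<Omega> \<psi>" for \<psi> i
  proof -
    have sp: "sq_int M (pd i \<psi>)" using sq_int_vec test_fun_sq_int(2)[OF t] by fastforce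
    have sv: "sq_int M (\<lambda>x. \<psi> x *\<^sub>R axis i (1::real))"
      by (rule sq_int_bound[OF test_fun_sq_int(1)[OF t], of _ 1]) (use test_fun_sq_int(3)[OF t] in \<open>auto intro!: AE_I2\<close>)
    have 1: "(\<lambda>k. LINT x|M. pd i \<psi> x \<bullet> \<phi> k x) \<longlonglongrightarrow> (LINT x|M. pd i \<psi> x \<bullet> u x)"
      by (rule sq_norm_conv_inner[OF test_fun_sq_int(1)[OF p(1)] W0_sq_int(1)[OF s] sp p(2)])
    have 2: "(\<lambda>k. LINT x|M. (\<psi> x *\<^sub>R axis i 1) \<bullet> grad (\<phi> k) x) \<longlonglongrightarrow> (LINT x|M. (\<psi> x *\<^sub>R axis i 1) \<bullet> g x)"
      by (rule sq_norm_conv_inner[OF test_fun_sq_int(2)[OF p(1)] W0_sq_int(2)[OF s] sv p(3)])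
    have eq: "(LINT x|M. pd i \<psi> x \<bullet> \<phi> k x) = - (LINT x|M. (\<psi> x *\<^sub>R axis i 1) \<bullet> grad (\<phi> k) x)" for k
    proof -
      have I1: "integrable M (\<lambda>x. pd i \<psi> x \<bullet> \<phi> k x)" by (rule sq_int_inner_int[OF sp test_fun_sq_int(1)[OF p(1)]])
      have I2: "integrable M (\<lambda>x. (\<psi> x *\<^sub>R axis i 1) \<bullet> grad (\<phi> k) x)" by (rule sq_int_inner_int[OF sv test_fun_sq_int(2)[OF p(1)]])
      have "0 = (LINT x|M. pd i (\<lambda>x. \<psi> x * \<phi> k x) x)"
        using test_int_pd0[OF test_fun_mult[OF test_fun_diff_upto[OF t] p(1)]] by simp
      also have "\<dots> = (LINT x|M. (\<psi> x *\<^sub>R axis i 1) \<bullet> grad (\<phi> k) x + pd i \<psi> x \<bullet> \<phi> k x)"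
        by (intro Bochner_Integration.integral_cong refl)
          (simp add: pd_mult[OF test_fun_diff[OF t] test_fun_diff[OF p(1)]] inner_axis')
      also have "\<dots> = (LINT x|M. (\<psi> x *\<^sub>R axis i 1) \<bullet> grad (\<phi> k) x) + (LINT x|M. pd i \<psi> x \<bullet> \<phi> k x)"
        using I1 I2 by simp
      finally show ?thesis by simp
    qed
    have "(LINT x|M. pd i \<psi> x \<bullet> u x) = - (LINT x|M. (\<psi> x *\<^sub>R axis i 1) \<bullet> g x)"
      using LIMSEQ_unique[OF 1] tendsto_minus[OF 2] by (simp only: eq)
    then show ?thesis by (simp add: inner_axis' mult.commute)
  qed
  have "(\<lambda>k. (LINT x|M. (\<phi> k x - u x)^2) + (LINT x|M. (norm (grad (\<phi> k) x - g x))^2)) \<longlonglongrightarrow> 0"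
    using tendsto_add[OF p(2) p(3)] by (simp add: sq_norm_def)
  then show ?thesis unfolding W012_def weak_grad_def L2_iff_sq_int
    using ibp sg W0_sq_int(1)[OF s] p(1) by blast
qed

lemma abs_conv:
  assumes ap: "approx u g \<phi>" and s: "W0 u g" and w: "sq_int M w"
  shows "(\<lambda>k. LINT x|M. w x * \<bar>\<phi> k x\<bar>) \<longlonglongrightarrow> (LINT x|M. w x * \<bar>u x\<bar>)"
proof -
  note p = approxD[OF ap]
  have ab_pos: "sq_int M (\<lambda>x. \<bar>v x\<bar>)" if "sq_int M v" for v :: "real^'n \<Rightarrow> real" using sq_int_norm[OF that] by simp
  have u_solves: "sq_int M (\<lambda>x. \<bar>u x\<bar>)" and sp: "sq_int M (\<lambda>x. \<bar>\<phi> k x\<bar>)" for k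
    using ab_pos W0_sq_int(1)[OF s] test_fun_sq_int(1)[OF p(1)] by auto
  have "(\<lambda>k. sq_norm M (\<lambda>x. \<bar>\<phi> k x\<bar> - \<bar>u x\<bar>)) \<longlonglongrightarrow> 0"
  proof (rule tendsto_zero_squeeze[OF p(2)])
    show "sq_norm M (\<lambda>x. \<bar>\<phi> k x\<bar> - \<bar>u x\<bar>) \<le> sq_norm M (\<lambda>x. \<phi> k x - u x)" for k
    proof -
      have "sq_norm M (\<lambda>x. \<bar>\<phi> k x\<bar> - \<bar>u x\<bar>) \<le> 1^2 * sq_norm M (\<lambda>x. \<phi> k x - u x)"
        by (rule sq_norm_mono[OF sq_int_diff[OF test_fun_sq_int(1)[OF p(1)] W0_sq_int(1)[OF s]] sq_int_meas[OF sq_int_diff[OF sp u_solves]]])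
          (simp add: abs_triangle_ineq3)
      then show ?thesis by simp
    qed
  qed simp
  from sq_norm_conv_inner[OF sp u_solves w this] show ?thesis by simp
qed

lemma W0_weight1:
  assumes s: "W0 u g" and w: "sq_int M w" "\<And>x. 0 \<le> w x"
  shows "(LINT x|M. w x * \<bar>u x\<bar>) \<le> poincare_const * (sqrt (sq_norm M w) * sqrt (sq_norm M g))"
proof -
  obtain \<phi> where ap: "approx u g \<phi>" using W0_approx[OF s] by blast
  note p = approxD[OF ap]
  have "(\<lambda>k. poincare_const * (sqrt (sq_norm M w) * sqrt (sq_norm M (grad (\<phi> k))))) \<longlonglongrightarrow> poincare_const * (sqrt (sq_norm M w) * sqrt (sq_norm M g))"
    using sq_norm_conv[OF test_fun_sq_int(2)[OF p(1)] W0_sq_int(2)[OF s] p(3)] by (intro tendsto_intros)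
  from LIMSEQ_le[OF abs_conv[OF ap s w(1)] this] show ?thesis
    using test_weight1[OF p(1) w] by blast
qed

lemma W0_weight2:
  assumes s: "W0 u g" and w: "sq_int M w" "\<And>x. 0 \<le> w x" and b: "0 < \<beta>" "\<beta> < 1" "real CARD('n) * \<beta> / 2 < 1"
  shows "(LINT x|M. w x * \<bar>u x\<bar>) \<le> sobolev_const \<beta> * (sqrt (sq_norm M w) powr (1 - \<beta>) * (LINT x|M. w x) powr \<beta> * sqrt (sq_norm M g))"
proof -
  obtain \<phi> where ap: "approx u g \<phi>" using W0_approx[OF s] by blast
  note p = approxD[OF ap]
  have "(\<lambda>k. sobolev_const \<beta> * (sqrt (sq_norm M w) powr (1 - \<beta>) * (LINT x|M. w x) powr \<beta> * sqrt (sq_norm M (grad (\<phi> k)))))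
     \<longlonglongrightarrow> sobolev_const \<beta> * (sqrt (sq_norm M w) powr (1 - \<beta>) * (LINT x|M. w x) powr \<beta> * sqrt (sq_norm M g))"
    using sq_norm_conv[OF test_fun_sq_int(2)[OF p(1)] W0_sq_int(2)[OF s] p(3)]
    by (intro tendsto_mult tendsto_const tendsto_real_sqrt)
  from LIMSEQ_le[OF abs_conv[OF ap s w(1)] this] show ?thesis
    using test_weight2[OF p(1) w b] by blast
qed

text \<open>The weight in \<open>W0_weight1\<close> is taken to be \<open>\<bar>u\<bar>\<close>
  itself; one factor \<open>sqrt (sq_norm M u)\<close> then cancels.\<close>

lemma poincare:
  assumes s: "W0 u g" shows "sq_norm M u \<le> poincare_const^2 * sq_norm M g"
proof -
  have "sq_int M (\<lambda>x. \<bar>u x\<bar>)" using sq_int_norm[OF W0_sq_int(1)[OF s]] by simp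
  from W0_weight1[OF s this]
  have "(LINT x|M. \<bar>u x\<bar> * \<bar>u x\<bar>) \<le> poincare_const * (sqrt (sq_norm M (\<lambda>x. \<bar>u x\<bar>)) * sqrt (sq_norm M g))" by simp
  moreover have "(LINT x|M. \<bar>u x\<bar> * \<bar>u x\<bar>) = sq_norm M u" "sq_norm M (\<lambda>x. \<bar>u x\<bar>) = sq_norm M u"
    by (simp_all add: sq_norm_def power2_eq_square)
  ultimately have le: "sqrt (sq_norm M u) * sqrt (sq_norm M u) \<le> (poincare_const * sqrt (sq_norm M g)) * sqrt (sq_norm M u)"
    by (simp add: mult_ac)
  have "sqrt (sq_norm M u) \<le> poincare_const * sqrt (sq_norm M g)"
  proof (cases "sqrt (sq_norm M u) = 0")
    case False
    then have "sqrt (sq_norm M u) > 0" using sq_norm_nonneg[of M u] real_sqrt_ge_zero[of "sq_norm M u"] by linarith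
    with le show ?thesis by (rule mult_right_le_imp_le)
  qed (use poincare_const_pos in simp)
  then have "(sqrt (sq_norm M u))^2 \<le> (poincare_const * sqrt (sq_norm M g))^2" by (intro power_mono) auto
  then show ?thesis by (simp add: power_mult_distrib)
qed

lemma W0_zero_grad:
  assumes s: "W0 u g" "AE x in M. g x = 0" shows "AE x in M. u x = 0"
proof -
  have "sq_norm M g = 0" unfolding sq_norm_def using s(2) by (intro integral_eq_zero_AE) auto
  then have "sq_norm M u = 0" using poincare[OF s(1)] sq_norm_nonneg[of M u] by simp
  then show ?thesis using integral_nonneg_eq_0_iff_AE[OF sq_int_int[OF W0_sq_int(1)[OF s(1)]]]
    by (simp add: sq_norm_def)
qed

text \<open>Nonnegative functions in the dual of the Sobolev space, with dual norm at most \<open>C\<close>.\<close>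

definition dual :: "(real^'n \<Rightarrow> real) \<Rightarrow> real \<Rightarrow> bool" where
  "dual f C \<longleftrightarrow> integrable M f \<and> (\<forall>x. 0 \<le> f x) \<and> 0 \<le> C \<and>
     (\<forall>\<phi>. test_fun \<Omega> \<phi> \<longrightarrow> (LINT x|M. f x * \<bar>\<phi> x\<bar>) \<le> C * sqrt (sq_norm M (grad \<phi>)))"

lemma integrable_mult_bdd:
  fixes f h :: "real^'n \<Rightarrow> real"
  assumes f: "integrable M f" and h: "h \<in> borel_measurable M" "\<And>x. \<bar>h x\<bar> \<le> B"
  shows "integrable M (\<lambda>x. f x * h x)"
proof (rule Bochner_Integration.integrable_bound)
  show "integrable M (\<lambda>x. B * norm (f x))" using f by simp
  show "AE x in M. norm (f x * h x) \<le> norm (B * norm (f x))"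
  proof (rule AE_I2)
    fix x
    have "\<bar>f x\<bar> * \<bar>h x\<bar> \<le> \<bar>f x\<bar> * B" using h(2)[of x] by (intro mult_left_mono) auto
    also have "\<dots> \<le> \<bar>B * \<bar>f x\<bar>\<bar>" by (simp add: mult.commute)
    finally show "norm (f x * h x) \<le> norm (B * norm (f x))" by (simp add: abs_mult)
  qed
qed (use f h in measurable)

lemma dual_test_int:
  assumes "integrable M f" "test_fun \<Omega> \<phi>"
  shows "integrable M (\<lambda>x. f x * \<phi> x)" "integrable M (\<lambda>x. f x * \<bar>\<phi> x\<bar>)"
proof -
  obtain B where B: "\<And>x. \<bar>\<phi> x\<bar> \<le> B" using test_fun_bounded[OF assms(2)] by metis
  note [measurable] = test_fun_sq_int(3)[OF assms(2)]
  show "integrable M (\<lambda>x. f x * \<phi> x)" by (rule integrable_mult_bdd[OF assms(1) _ B]) measurable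
  show "integrable M (\<lambda>x. f x * \<bar>\<phi> x\<bar>)" by (rule integrable_mult_bdd[OF assms(1), of _ B]) (use B in auto)
qed

text \<open>Since f is merely integrable, products with Sobolev functions are reached through
  Fatou's lemma along test functions converging almost everywhere.\<close>

lemma dual_bound:
  assumes f: "dual f C" and s: "W0 u g"
  shows "integrable M (\<lambda>x. f x * \<bar>u x\<bar>)" "(LINT x|M. f x * \<bar>u x\<bar>) \<le> C * sqrt (sq_norm M g)"
    "integrable M (\<lambda>x. f x * u x)"
proof -
  obtain \<phi> where ap: "approx u g \<phi>" using W0_approx[OF s] by blast
  note p = approxD[OF ap]
  have fI: "integrable M f" and f0: "\<And>x. 0 \<le> f x" using f by (auto simp: dual_def)
  note [measurable] = borel_measurable_integrable[OF fI] W0_meas[OF s]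
  have lim: "(\<lambda>k. C * sqrt (sq_norm M (grad (\<phi> k)))) \<longlonglongrightarrow> C * sqrt (sq_norm M g)"
    using sq_norm_conv[OF test_fun_sq_int(2)[OF p(1)] W0_sq_int(2)[OF s] p(3)] by (intro tendsto_intros)
  have key: "integrable M (\<lambda>x. f x * \<bar>u x\<bar>) \<and> (LINT x|M. f x * \<bar>u x\<bar>) \<le> C * sqrt (sq_norm M g) + e" if e: "e > 0" for e
  proof -
    have "\<forall>\<^sub>F k in sequentially. C * sqrt (sq_norm M (grad (\<phi> k))) < C * sqrt (sq_norm M g) + e"
      using order_tendstoD(2)[OF lim] e by simp
    then obtain N where N: "\<And>k. k \<ge> N \<Longrightarrow> C * sqrt (sq_norm M (grad (\<phi> k))) < C * sqrt (sq_norm M g) + e"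
      unfolding eventually_sequentially by blast
    have 2: "(LINT x|M. f x * \<bar>\<phi> (k + N) x\<bar>) \<le> C * sqrt (sq_norm M g) + e" for k
    proof -
      have "(LINT x|M. f x * \<bar>\<phi> (k + N) x\<bar>) \<le> C * sqrt (sq_norm M (grad (\<phi> (k + N))))"
        using f p(1) by (simp add: dual_def)
      then show ?thesis using N[of "k + N"] by simp
    qed
    have 3: "AE x in M. (\<lambda>k. f x * \<bar>\<phi> (k + N) x\<bar>) \<longlonglongrightarrow> f x * \<bar>u x\<bar>"
      using p(4)
    proof eventually_elim
      case (elim x)
      from LIMSEQ_ignore_initial_segment[OF this, of N] show ?case by (intro tendsto_intros)
    qed
    have 4: "(\<lambda>x. f x * \<bar>u x\<bar>) \<in> borel_measurable M" by measurable
    have 5: "AE x in M. 0 \<le> f x * \<bar>\<phi> (k + N) x\<bar>" for k using f0 by simp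
    show ?thesis using fatou_bound[OF dual_test_int(2)[OF fI p(1)] 5 2 4 3] by blast
  qed
  show I: "integrable M (\<lambda>x. f x * \<bar>u x\<bar>)" using key[of 1] by simp
  show "(LINT x|M. f x * \<bar>u x\<bar>) \<le> C * sqrt (sq_norm M g)"
  proof (rule field_le_epsilon)
    fix e :: real assume "0 < e"
    from key[OF this] show "(LINT x|M. f x * \<bar>u x\<bar>) \<le> C * sqrt (sq_norm M g) + e" by (rule conjunct2)
  qed
  show "integrable M (\<lambda>x. f x * u x)"
    by (rule Bochner_Integration.integrable_bound[OF I]) (use f0 in \<open>auto simp: abs_mult\<close>)
qed

lemma dual_conv:
  assumes f: "dual f C" and s: "\<And>k. W0 (u k) (g k)" "W0 v h"
    and lim: "(\<lambda>k. sq_norm M (\<lambda>x. g k x - h x)) \<longlonglongrightarrow> 0"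
  shows "(\<lambda>k. LINT x|M. f x * u k x) \<longlonglongrightarrow> (LINT x|M. f x * v x)"
proof (rule LIM_zero_cancel, rule Lim_null_comparison)
  have f0: "\<And>x. 0 \<le> f x" using f by (auto simp: dual_def)
  show "(\<lambda>k. C * sqrt (sq_norm M (\<lambda>x. g k x - h x))) \<longlonglongrightarrow> 0"
    using tendsto_mult[OF tendsto_const[of C] tendsto_real_sqrt[OF lim]] by simp
  show "\<forall>\<^sub>F k in sequentially. norm ((LINT x|M. f x * u k x) - (LINT x|M. f x * v x)) \<le> C * sqrt (sq_norm M (\<lambda>x. g k x - h x))"
  proof (rule always_eventually, rule allI)
    fix k
    have d: "W0 (\<lambda>x. u k x - v x) (\<lambda>x. g k x - h x)" by (rule W0_diff[OF s(1) s(2)])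
    have "(LINT x|M. f x * u k x) - (LINT x|M. f x * v x) = (LINT x|M. f x * (u k x - v x))"
      using dual_bound(3)[OF f s(1)] dual_bound(3)[OF f s(2)] by (simp add: right_diff_distrib)
    also have "norm \<dots> \<le> (LINT x|M. norm (f x * (u k x - v x)))" by (rule integral_norm_bound)
    also have "\<dots> = (LINT x|M. f x * \<bar>u k x - v x\<bar>)" using f0 by (simp add: abs_mult)
    also have "\<dots> \<le> C * sqrt (sq_norm M (\<lambda>x. g k x - h x))" by (rule dual_bound(2)[OF f d])
    finally show "norm ((LINT x|M. f x * u k x) - (LINT x|M. f x * v x)) \<le> C * sqrt (sq_norm M (\<lambda>x. g k x - h x))" .
  qed
qed

text \<open>Immediate because the functional is bounded on absolute values of test functions. It is
  the reason for that choice: whatever lies below \<open>lam * exp (u x)\<close> inherits its dual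
  constant.\<close>

lemma dual_mono:
  assumes f: "dual f C" and h: "h \<in> borel_measurable M" "\<And>x. 0 \<le> h x" "AE x in M. h x \<le> f x"
  shows "dual h C"
proof -
  have fI: "integrable M f" and f0: "\<And>x. 0 \<le> f x" using f by (auto simp: dual_def)
  have hI: "integrable M h"
    by (rule Bochner_Integration.integrable_bound[OF fI h(1)]) (use h f0 in auto)
  have "(LINT x|M. h x * \<bar>\<phi> x\<bar>) \<le> C * sqrt (sq_norm M (grad \<phi>))" if t: "test_fun \<Omega> \<phi>" for \<phi>
  proof -
    have "(LINT x|M. h x * \<bar>\<phi> x\<bar>) \<le> (LINT x|M. f x * \<bar>\<phi> x\<bar>)"
    proof (rule integral_mono_AE[OF dual_test_int(2)[OF hI t] dual_test_int(2)[OF fI t]])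
      show "AE x in M. h x * \<bar>\<phi> x\<bar> \<le> f x * \<bar>\<phi> x\<bar>"
        using h(3) by eventually_elim (rule mult_right_mono, auto)
    qed
    then show ?thesis using f t unfolding dual_def by (meson order_trans)
  qed
  then show ?thesis using f hI h(2) by (simp add: dual_def)
qed

end

section \<open>Weak equations tested with Sobolev functions\<close>

locale finsler_domain = bounded_open_set \<Omega> + finsler F a b \<mu> \<Lambda>
  for \<Omega> :: "(real^'n::finite) set" and F :: "real^'n \<Rightarrow> real" and a b \<mu> \<Lambda> :: real
begin

lemma flux_sq_int: "sq_int M g \<Longrightarrow> sq_int M (\<lambda>x. flux (g x))"
  by (rule sq_int_bound[of _ g _ "b^2"]) (auto simp: flux_norm dest: sq_int_meas)

definition solves :: "(real^'n \<Rightarrow> real) \<Rightarrow> (real^'n \<Rightarrow> real^'n) \<Rightarrow> (real^'n \<Rightarrow> real) \<Rightarrow> bool" where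
  "solves u g f \<longleftrightarrow> W0 u g \<and> (\<forall>v h. W0 v h \<longrightarrow> (LINT x|M. flux (g x) \<bullet> h x) = (LINT x|M. f x * v x))"

text \<open>The sign of f upgrades an equation against test functions to one against all of
  \<open>W0\<close>. Testing with smooth approximations of the positive part of a test function
  bounds the integral of f against that positive part by the L2 norm of the flux; the same for the
  negative part makes f a \<open>dual\<close> function, and then both sides of the equation are
  continuous in the gradient.\<close>

lemma solves_of_test:
  assumes s: "W0 u g" and f: "integrable M f" "\<And>x. 0 \<le> f x"
    and eq: "\<And>\<phi>. test_fun \<Omega> \<phi> \<Longrightarrow> (LINT x|M. flux (g x) \<bullet> grad \<phi> x) = (LINT x|M. f x * \<phi> x)"
  obtains C where "dual f C" "solves u g f"
proof -
  note flg = flux_sq_int[OF W0_sq_int(2)[OF s]]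
  note [measurable] = borel_measurable_integrable[OF f(1)]
  define Q where "Q = sqrt (sq_norm M (\<lambda>x. flux (g x)))"
  have Q0: "Q \<ge> 0" by (simp add: Q_def)
  have pos: "(LINT x|M. f x * max (\<phi> x - 0) 0) \<le> Q * sqrt (sq_norm M (grad \<phi>))" if t: "test_fun \<Omega> \<phi>" for \<phi>
  proof -
    note [measurable] = test_fun_sq_int(3,4)[OF t]
    define e where "e j = 1 / real (Suc j)" for j
    have e: "e j > 0" for j by (simp add: e_def)
    have e0: "e \<longlonglongrightarrow> 0" unfolding e_def by (rule LIMSEQ_one_over_Suc)
    define p where "p j s = softplus (e j) (s - 0) + (- softplus (e j) (0 - 0))" for j s
    have tj: "test_fun \<Omega> (\<lambda>x. p j (\<phi> x))" for j
      by (rule test_fun_comp[OF t]) (unfold p_def, rule smooth1_softplus[OF e], simp)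
    have dp: "(p j has_real_derivative sigmoid ((s - 0) / e j)) (at s)" for j s
      unfolding p_def by (rule DERIV_softplus[OF e])
    have gr: "grad (\<lambda>x. p j (\<phi> x)) x = sigmoid ((\<phi> x - 0) / e j) *\<^sub>R grad \<phi> x" for j x
      by (rule grad_comp[OF test_fun_diff[OF t] dp])
    have B: "(LINT x|M. f x * p j (\<phi> x)) \<le> Q * sqrt (sq_norm M (grad \<phi>))" for j
    proof -
      have "(LINT x|M. f x * p j (\<phi> x)) = (LINT x|M. flux (g x) \<bullet> grad (\<lambda>x. p j (\<phi> x)) x)" using eq[OF tj] by simp
      also have "\<dots> \<le> Q * sqrt (sq_norm M (grad (\<lambda>x. p j (\<phi> x))))"
        using sq_norm_CS_inner[OF flg test_fun_sq_int(2)[OF tj[of j]]] by (simp add: Q_def)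
      also have "sq_norm M (grad (\<lambda>x. p j (\<phi> x))) \<le> 1^2 * sq_norm M (grad \<phi>)"
      proof (rule sq_norm_mono[OF test_fun_sq_int(2)[OF t] test_fun_sq_int(4)[OF tj]])
        show "AE x in M. norm (grad (\<lambda>x. p j (\<phi> x)) x) \<le> 1 * norm (grad \<phi> x)"
        proof (rule AE_I2)
          fix x show "norm (grad (\<lambda>x. p j (\<phi> x)) x) \<le> 1 * norm (grad \<phi> x)"
            using sigmoid_bounds[of "\<phi> x / e j"] by (simp add: gr mult_left_le_one_le)
        qed
      qed
      finally show ?thesis using Q0 by (simp add: mult_left_mono)
    qed
    have "(\<lambda>j. (LINT x|M. f x * p j (\<phi> x))) \<longlonglongrightarrow> (LINT x|M. f x * max (\<phi> x - 0) 0)"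
    proof (rule integral_dominated_convergence[where w="\<lambda>x. f x * (\<bar>\<phi> x\<bar> + 1)"])
      show "integrable M (\<lambda>x. f x * (\<bar>\<phi> x\<bar> + 1))"
        using dual_test_int(2)[OF f(1) t] f(1) by (simp add: distrib_left)
      show "(\<lambda>x. f x * p j (\<phi> x)) \<in> borel_measurable M" for j using test_fun_sq_int(3)[OF tj[of j]] by measurable
      have close: "\<bar>p j s - max (s - 0) 0\<bar> \<le> e j" for j s unfolding p_def by (rule softplus_close[OF e]) simp
      show "AE x in M. (\<lambda>j. f x * p j (\<phi> x)) \<longlonglongrightarrow> f x * max (\<phi> x - 0) 0"
      proof (rule AE_I2, rule tendsto_mult[OF tendsto_const], rule LIM_zero_cancel, rule Lim_null_comparison[OF _ e0])
        fix x show "\<forall>\<^sub>F j in sequentially. norm (p j (\<phi> x) - max (\<phi> x - 0) 0) \<le> e j"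
          using close by simp
      qed
      show "AE x in M. norm (f x * p j (\<phi> x)) \<le> f x * (\<bar>\<phi> x\<bar> + 1)" for j
      proof (rule AE_I2)
        fix x
        have "e j \<le> 1" by (simp add: e_def)
        then have "\<bar>p j (\<phi> x)\<bar> \<le> \<bar>\<phi> x\<bar> + 1" using close[of j "\<phi> x"] by linarith
        then show "norm (f x * p j (\<phi> x)) \<le> f x * (\<bar>\<phi> x\<bar> + 1)" using f(2)[of x] by (simp add: abs_mult mult_left_mono)
      qed
    qed measurable
    then show ?thesis by (rule LIMSEQ_le_const2) (use B in blast)
  qed
  \<comment> \<open>One factor \<open>Q\<close> for the positive and one for the negative part of
    the test function.\<close>
  have D: "dual f (2 * Q)"
    unfolding dual_def
  proof (intro conjI allI impI f)
    fix \<phi> assume t: "test_fun \<Omega> \<phi>"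
    have t': "test_fun \<Omega> (\<lambda>x. (-1) * \<phi> x)" by (rule test_fun_cmult[OF t])
    have g': "sq_norm M (grad (\<lambda>x. (-1) * \<phi> x)) = sq_norm M (grad \<phi>)"
      using grad_cmult[OF test_fun_diff[OF t], of "-1"] by (simp add: sq_norm_def)
    obtain B where B: "\<And>x. \<bar>\<phi> x\<bar> \<le> B" "B \<ge> 0" using test_fun_bounded[OF t] by metis
    note [measurable] = test_fun_sq_int(3)[OF t]
    have mI: "integrable M (\<lambda>x. f x * max (\<phi> x - 0) 0)" "integrable M (\<lambda>x. f x * max ((-1) * \<phi> x - 0) 0)"
    proof -
      have b: "\<bar>max (\<phi> x - 0) 0\<bar> \<le> B" "\<bar>max ((-1) * \<phi> x - 0) 0\<bar> \<le> B" for x using B(1)[of x] B(2) by linarith+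
      show "integrable M (\<lambda>x. f x * max (\<phi> x - 0) 0)" by (rule integrable_mult_bdd[OF f(1) _ b(1)]) measurable
      show "integrable M (\<lambda>x. f x * max ((-1) * \<phi> x - 0) 0)" by (rule integrable_mult_bdd[OF f(1) _ b(2)]) measurable
    qed
    have "(LINT x|M. f x * \<bar>\<phi> x\<bar>) = (LINT x|M. f x * max (\<phi> x - 0) 0 + f x * max ((-1) * \<phi> x - 0) 0)"
      by (intro Bochner_Integration.integral_cong refl) (auto simp: max_def abs_if)
    also have "\<dots> = (LINT x|M. f x * max (\<phi> x - 0) 0) + (LINT x|M. f x * max ((-1) * \<phi> x - 0) 0)"
      using mI by simp
    also have "\<dots> \<le> Q * sqrt (sq_norm M (grad \<phi>)) + Q * sqrt (sq_norm M (grad \<phi>))"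
      using pos[OF t] pos[OF t'] unfolding g' by (rule add_mono)
    finally show "(LINT x|M. f x * \<bar>\<phi> x\<bar>) \<le> 2 * Q * sqrt (sq_norm M (grad \<phi>))" by simp
  qed (use Q0 in simp)
  have "(LINT x|M. flux (g x) \<bullet> h x) = (LINT x|M. f x * v x)" if v: "W0 v h" for v h
  proof -
    obtain \<phi> where ap: "approx v h \<phi>" using W0_approx[OF v] by blast
    note p = approxD[OF ap]
    have 1: "(\<lambda>k. LINT x|M. flux (g x) \<bullet> grad (\<phi> k) x) \<longlonglongrightarrow> (LINT x|M. flux (g x) \<bullet> h x)"
      by (rule sq_norm_conv_inner[OF test_fun_sq_int(2)[OF p(1)] W0_sq_int(2)[OF v] flg p(3)])
    have 2: "(\<lambda>k. LINT x|M. f x * \<phi> k x) \<longlonglongrightarrow> (LINT x|M. f x * v x)"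
      by (rule dual_conv[OF D W0_test[OF p(1)] v p(3)])
    show ?thesis using LIMSEQ_unique[OF 1] 2 eq[OF p(1)] by simp
  qed
  then have "solves u g f" using s by (simp add: solves_def)
  then show thesis using that D by blast
qed

end

section \<open>The Dirichlet problem\<close>

context finsler_domain
begin

lemma energy_int: "sq_int M g \<Longrightarrow> integrable M (\<lambda>x. energy (g x))"
proof -
  assume g: "sq_int M g"
  note [measurable] = sq_int_meas[OF g]
  show ?thesis
  proof (rule Bochner_Integration.integrable_bound)
    show "integrable M (\<lambda>x. b^2 / 2 * (norm (g x))^2)" using sq_int_int[OF g] by simp
    have "0 \<le> energy x" for x by (simp add: energy_def)
    then show "AE x in M. norm (energy (g x)) \<le> norm (b^2 / 2 * (norm (g x))^2)"
      using energy_bounds(2) by (intro AE_I2) (simp add: abs_of_nonneg)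
  qed measurable
qed

lemma energy_convex: "energy x + flux x \<bullet> (y - x) \<le> energy y"
proof -
  obtain c where c: "0 < c" "\<And>x y. energy x + flux x \<bullet> (y - x) + c * (norm (y - x))^2 \<le> energy y"
    using energy_strong by blast
  have "0 \<le> c * (norm (y - x))^2" using c(1) by simp
  then show ?thesis using c(2)[of x y] by linarith
qed

definition conv_const :: real where
  "conv_const = (SOME c. 0 < c \<and> (\<forall>x y. energy x + flux x \<bullet> (y - x) + c * (norm (y - x))^2 \<le> energy y))"

lemma conv_const: "0 < conv_const" "energy x + flux x \<bullet> (y - x) + conv_const * (norm (y - x))^2 \<le> energy y"
proof -
  have "\<exists>c. 0 < c \<and> (\<forall>x y. energy x + flux x \<bullet> (y - x) + c * (norm (y - x))^2 \<le> energy y)"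
    using energy_strong by metis
  from someI_ex[OF this] show "0 < conv_const" "energy x + flux x \<bullet> (y - x) + conv_const * (norm (y - x))^2 \<le> energy y"
    unfolding conv_const_def by blast+
qed

lemma flux_mono: "2 * conv_const * (norm (x - y))^2 \<le> (flux x - flux y) \<bullet> (x - y)"
  using conv_const(2)[of x y] conv_const(2)[of y x]
  by (simp add: inner_diff_left inner_diff_right norm_minus_commute algebra_simps)

lemma energy_mid: "2 * energy ((1/2) *\<^sub>R (x + y)) + conv_const / 2 * (norm (x - y))^2 \<le> energy x + energy y"
proof -
  let ?m = "(1/2) *\<^sub>R (x + y)"
  have 1: "x - ?m = (1/2) *\<^sub>R (x - y)" "y - ?m = - ((1/2) *\<^sub>R (x - y))"
    by (simp_all add: vec_eq_iff field_simps)
  have "energy ?m + flux ?m \<bullet> (x - ?m) + conv_const * (norm (x - ?m))^2 \<le> energy x" by (rule conv_const(2))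
  moreover have "energy ?m + flux ?m \<bullet> (y - ?m) + conv_const * (norm (y - ?m))^2 \<le> energy y" by (rule conv_const(2))
  ultimately show ?thesis unfolding 1 by (simp add: power_divide)
qed

text \<open>The convex functional whose Euler-Lagrange equation is the Dirichlet problem with
  right-hand side f.\<close>

definition lin_energy :: "(real^'n \<Rightarrow> real) \<Rightarrow> (real^'n \<Rightarrow> real) \<Rightarrow> (real^'n \<Rightarrow> real^'n) \<Rightarrow> real" where
  "lin_energy f v g = (LINT x|M. energy (g x)) - (LINT x|M. f x * v x)"

lemma lin_energy_lower:
  assumes f: "dual f C" and s: "W0 v g"
  shows "- (C^2 / (2 * a^2)) \<le> lin_energy f v g"
proof -
  have "a^2 / 2 * sq_norm M g = (LINT x|M. a^2 / 2 * (norm (g x))^2)" by (simp add: sq_norm_def)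
  also have "\<dots> \<le> (LINT x|M. energy (g x))"
    using energy_int[OF W0_sq_int(2)[OF s]] sq_int_int[OF W0_sq_int(2)[OF s]] energy_bounds(1)
    by (intro integral_mono) auto
  finally have 1: "a^2 / 2 * (sqrt (sq_norm M g))^2 \<le> (LINT x|M. energy (g x))" by simp
  have "(LINT x|M. f x * v x) \<le> (LINT x|M. f x * \<bar>v x\<bar>)"
    using dual_bound(1,3)[OF f s] f by (intro integral_mono) (auto simp: dual_def intro!: mult_left_mono)
  then have 2: "(LINT x|M. f x * v x) \<le> C * sqrt (sq_norm M g)" using dual_bound(2)[OF f s] by simp
  \<comment> \<open>Completing the square: this expression is the difference between the quadratic
    lower bound and its minimum.\<close>
  have "0 \<le> (a * sqrt (sq_norm M g) - C / a)^2 / 2" by simp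
  also have "\<dots> = a^2 / 2 * (sqrt (sq_norm M g))^2 - C * sqrt (sq_norm M g) + C^2 / (2 * a^2)"
    using ab_pos(1) by (simp add: power2_diff power_mult_distrib power_divide field_simps) (simp add: power2_eq_square)
  finally show ?thesis using 1 2 unfolding lin_energy_def by linarith
qed

lemma lin_energy_mid:
  assumes f: "dual f C" and s: "W0 v g" "W0 w h"
  shows "2 * lin_energy f (\<lambda>x. (1/2) * (v x + w x)) (\<lambda>x. (1/2) *\<^sub>R (g x + h x)) + conv_const / 2 * sq_norm M (\<lambda>x. g x - h x) \<le> lin_energy f v g + lin_energy f w h"
proof -
  have sg: "sq_int M g" "sq_int M h" using s W0_sq_int by auto
  have sm: "sq_int M (\<lambda>x. (1/2) *\<^sub>R (g x + h x))" by (intro sq_int_scale sq_int_add sg)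
  have "(LINT x|M. 2 * energy ((1/2) *\<^sub>R (g x + h x)) + conv_const / 2 * (norm (g x - h x))^2) \<le> (LINT x|M. energy (g x) + energy (h x))"
    using energy_int[OF sg(1)] energy_int[OF sg(2)] energy_int[OF sm] sq_int_int[OF sq_int_diff[OF sg]]
    by (intro integral_mono energy_mid) auto
  then have 1: "2 * (LINT x|M. energy ((1/2) *\<^sub>R (g x + h x))) + conv_const / 2 * sq_norm M (\<lambda>x. g x - h x) \<le> (LINT x|M. energy (g x)) + (LINT x|M. energy (h x))"
    using energy_int[OF sg(1)] energy_int[OF sg(2)] energy_int[OF sm] sq_int_int[OF sq_int_diff[OF sg]] by (simp add: sq_norm_def)
  have "(LINT x|M. f x * ((1/2) * (v x + w x))) = (LINT x|M. (1/2) * (f x * v x + f x * w x))"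
    by (intro Bochner_Integration.integral_cong refl) (simp add: algebra_simps)
  also have "\<dots> = (1/2) * ((LINT x|M. f x * v x) + (LINT x|M. f x * w x))"
    using dual_bound(3)[OF f s(1)] dual_bound(3)[OF f s(2)] by simp
  finally have 2: "2 * (LINT x|M. f x * ((1/2) * (v x + w x))) = (LINT x|M. f x * v x) + (LINT x|M. f x * w x)" by simp
  show ?thesis using 1 2 unfolding lin_energy_def right_diff_distrib by linarith
qed

text \<open>The direct method with strong convergence: by uniform convexity, midpoints of two nearly
  minimal functions would fall below the infimum unless their gradients were close. The gradients of
  a minimising sequence are therefore Cauchy, and so are the functions by Poincare's
  inequality.\<close>

lemma lin_energy_minimizer:
  assumes f: "dual f C"
  obtains v g where "W0 v g" "\<And>w h. W0 w h \<Longrightarrow> lin_energy f v g \<le> lin_energy f w h"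
proof -
  define S where "S = {lin_energy f v g | v g. W0 v g}"
  have ne: "S \<noteq> {}" using W0_zero by (auto simp: S_def)
  have bb: "bdd_below S" using lin_energy_lower[OF f] by (auto simp: S_def bdd_below_def)
  define I where "I = Inf S"
  have Ile: "I \<le> lin_energy f w h" if "W0 w h" for w h
    unfolding I_def by (rule cInf_lower[OF _ bb]) (use that in \<open>auto simp: S_def\<close>)
  have "\<exists>p. W0 (fst p) (snd p) \<and> lin_energy f (fst p) (snd p) < I + 1 / real (Suc k)" for k
  proof -
    have "Inf S < I + 1 / real (Suc k)" by (simp add: I_def)
    then obtain y where "y \<in> S" "y < I + 1 / real (Suc k)" using cInf_less_iff[OF ne bb] by blast
    then show ?thesis by (auto simp: S_def)
  qed
  then have "\<forall>k. \<exists>p. W0 (fst p) (snd p) \<and> lin_energy f (fst p) (snd p) < I + 1 / real (Suc k)" by (rule allI)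
  from choice[OF this] obtain P where P: "\<forall>k. W0 (fst (P k)) (snd (P k)) \<and> lin_energy f (fst (P k)) (snd (P k)) < I + 1 / real (Suc k)"
    by auto
  define v where "v k = fst (P k)" for k
  define g where "g k = snd (P k)" for k
  have s: "W0 (v k) (g k)" and Ek: "lin_energy f (v k) (g k) < I + 1 / real (Suc k)" for k
    using P by (auto simp: v_def g_def)
  have mid: "sq_norm M (\<lambda>x. g m x - g n x) \<le> 2 / conv_const * (1 / real (Suc m) + 1 / real (Suc n))" for m n
  proof -
    have "W0 (\<lambda>x. (1/2) * (v m x + 1 * v n x)) (\<lambda>x. (1/2) *\<^sub>R (g m x + 1 *\<^sub>R g n x))"
      by (intro W0_scale W0_lin s)
    then have "I \<le> lin_energy f (\<lambda>x. (1/2) * (v m x + v n x)) (\<lambda>x. (1/2) *\<^sub>R (g m x + g n x))"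
      by (intro Ile) simp
    then have "conv_const / 2 * sq_norm M (\<lambda>x. g m x - g n x) \<le> 1 / real (Suc m) + 1 / real (Suc n)"
      using lin_energy_mid[OF f s[of m] s[of n]] Ek[of m] Ek[of n] by linarith
    then have "2 / conv_const * (conv_const / 2 * sq_norm M (\<lambda>x. g m x - g n x)) \<le> 2 / conv_const * (1 / real (Suc m) + 1 / real (Suc n))"
      using conv_const(1) by (intro mult_left_mono) auto
    then show ?thesis using conv_const(1) by simp
  qed
  have cau: "\<exists>N. \<forall>m\<ge>N. \<forall>n\<ge>N. sq_norm M (\<lambda>x. g m x - g n x) \<le> e" if e: "e > 0" for e
  proof -
    \<comment> \<open>With both indices at least \<open>N\<close>, the estimate \<open>mid\<close>
      is at most \<open>4 / (conv_const * real (Suc N))\<close>.\<close>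
    obtain N where N: "4 / (conv_const * e) < real (Suc N)" using reals_Archimedean2[of "4 / (conv_const * e)"] by (metis less_trans lessI of_nat_less_iff)
    have "sq_norm M (\<lambda>x. g m x - g n x) \<le> e" if mn: "m \<ge> N" "n \<ge> N" for m n
    proof -
      have "1 / real (Suc m) \<le> 1 / real (Suc N)" "1 / real (Suc n) \<le> 1 / real (Suc N)"
        using mn by (auto intro!: divide_left_mono)
      then have "2 / conv_const * (1 / real (Suc m) + 1 / real (Suc n)) \<le> 2 / conv_const * (2 / real (Suc N))"
        using conv_const(1) by (intro mult_left_mono) auto
      also have "\<dots> = 4 / (conv_const * real (Suc N))" by simp
      also have "\<dots> \<le> e"
      proof -
        have "conv_const * e > 0" using conv_const(1) e by simp
        then have "4 < real (Suc N) * (conv_const * e)" using N by (simp only: pos_divide_less_eq)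
        then have "4 \<le> e * (conv_const * real (Suc N))" by (simp only: mult_ac)
        moreover have "conv_const * real (Suc N) > 0" using conv_const(1) by simp
        ultimately show ?thesis by (simp only: pos_divide_le_eq)
      qed
      finally show ?thesis using mid[of m n] by linarith
    qed
    then show ?thesis by blast
  qed
  have cau_v: "\<exists>N. \<forall>m\<ge>N. \<forall>n\<ge>N. sq_norm M (\<lambda>x. v m x - v n x) \<le> e" if e: "e > 0" for e
  proof -
    have "e / poincare_const^2 > 0" using e poincare_const_pos by simp
    from cau[OF this] obtain N where N: "\<And>m n. m \<ge> N \<Longrightarrow> n \<ge> N \<Longrightarrow> sq_norm M (\<lambda>x. g m x - g n x) \<le> e / poincare_const^2" by blast
    have "sq_norm M (\<lambda>x. v m x - v n x) \<le> e" if mn: "m \<ge> N" "n \<ge> N" for m n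
    proof -
      have "sq_norm M (\<lambda>x. v m x - v n x) \<le> poincare_const^2 * sq_norm M (\<lambda>x. g m x - g n x)"
        by (rule poincare[OF W0_diff[OF s s]])
      also have "\<dots> \<le> poincare_const^2 * (e / poincare_const^2)" using N[OF mn] by (intro mult_left_mono) auto
      finally show ?thesis using poincare_const_pos by simp
    qed
    then show ?thesis by blast
  qed
  obtain g' where g': "sq_int M g'" "(\<lambda>k. sq_norm M (\<lambda>x. g k x - g' x)) \<longlonglongrightarrow> 0"
    using sq_norm_complete[OF W0_sq_int(2)[OF s] cau] by blast
  obtain v' where v': "sq_int M v'" "(\<lambda>k. sq_norm M (\<lambda>x. v k x - v' x)) \<longlonglongrightarrow> 0"
    using sq_norm_complete[OF W0_sq_int(1)[OF s] cau_v] by blast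
  have sob': "W0 v' g'" by (rule W0_limit[OF s v'(1) g'(1) v'(2) g'(2)])
  have flg: "sq_int M (\<lambda>x. flux (g' x))" by (rule flux_sq_int[OF g'(1)])
  \<comment> \<open>Lower semicontinuity comes from the tangent plane of the energy at
    \<open>g'\<close>: it lies below the energy and is affine in \<open>g k\<close>, hence passes to
    the limit.\<close>
  have low: "(LINT x|M. energy (g' x)) + ((LINT x|M. flux (g' x) \<bullet> g k x) - (LINT x|M. flux (g' x) \<bullet> g' x)) - (LINT x|M. f x * v k x) \<le> I + 1 / real (Suc k)" for k
  proof -
    have "(LINT x|M. energy (g' x) + (flux (g' x) \<bullet> g k x - flux (g' x) \<bullet> g' x)) \<le> (LINT x|M. energy (g k x))"
    proof (rule integral_mono)
      show "energy (g' x) + (flux (g' x) \<bullet> g k x - flux (g' x) \<bullet> g' x) \<le> energy (g k x)" for x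
        using energy_convex[of "g' x" "g k x"] by (simp add: inner_diff_right)
    qed (use energy_int[OF g'(1)] energy_int[OF W0_sq_int(2)[OF s]] sq_int_inner_int[OF flg W0_sq_int(2)[OF s]] sq_int_inner_int[OF flg g'(1)] in auto)
    then show ?thesis
      using energy_int[OF g'(1)] sq_int_inner_int[OF flg W0_sq_int(2)[OF s]] sq_int_inner_int[OF flg g'(1)] Ek[of k] by (simp add: lin_energy_def)
  qed
  have z: "(\<lambda>k. 1 / real (Suc k)) \<longlonglongrightarrow> 0" by (rule LIMSEQ_one_over_Suc)
  have "(LINT x|M. energy (g' x)) + ((LINT x|M. flux (g' x) \<bullet> g' x) - (LINT x|M. flux (g' x) \<bullet> g' x)) - (LINT x|M. f x * v' x) \<le> I + 0"
  proof (rule LIMSEQ_le)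
    show "(\<lambda>k. (LINT x|M. energy (g' x)) + ((LINT x|M. flux (g' x) \<bullet> g k x) - (LINT x|M. flux (g' x) \<bullet> g' x)) - (LINT x|M. f x * v k x))
      \<longlonglongrightarrow> (LINT x|M. energy (g' x)) + ((LINT x|M. flux (g' x) \<bullet> g' x) - (LINT x|M. flux (g' x) \<bullet> g' x)) - (LINT x|M. f x * v' x)"
      by (intro tendsto_intros sq_norm_conv_inner[OF W0_sq_int(2)[OF s] g'(1) flg g'(2)] dual_conv[OF f s sob' g'(2)])
    show "(\<lambda>k. I + 1 / real (Suc k)) \<longlonglongrightarrow> I + 0" by (intro tendsto_intros z)
  qed (use low in blast)
  then have "lin_energy f v' g' \<le> I" by (simp add: lin_energy_def)
  then show thesis using that[OF sob'] Ile by force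
qed

text \<open>The first variation is obtained as an inequality, and replacing the direction by its
  negative gives the reverse one.\<close>

lemma exists_solution:
  assumes f: "dual f C"
  obtains v g where "solves v g f"
proof -
  obtain v g where s: "W0 v g" and mn: "\<And>w h. W0 w h \<Longrightarrow> lin_energy f v g \<le> lin_energy f w h"
    using lin_energy_minimizer[OF f] by blast
  have half: "(LINT x|M. f x * w x) \<le> (LINT x|M. flux (g x) \<bullet> h x)" if sw: "W0 w h" for w h
  proof -
    define t where "t k = 1 / real (Suc k)" for k
    have t: "t k > 0" "t k \<le> 1" for k by (auto simp: t_def)
    have t0: "t \<longlonglongrightarrow> 0" unfolding t_def by (rule LIMSEQ_one_over_Suc)
    have sg: "sq_int M (\<lambda>x. g x + t k *\<^sub>R h x)" for k
      by (intro sq_int_add sq_int_scale W0_sq_int(2)[OF s] W0_sq_int(2)[OF sw])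
    note [measurable] = W0_meas[OF s] W0_meas[OF sw]
    have ge: "(LINT x|M. f x * w x) \<le> (LINT x|M. flux (g x + t k *\<^sub>R h x) \<bullet> h x)" for k
    proof -
      have I: "integrable M (\<lambda>x. flux (g x + t k *\<^sub>R h x) \<bullet> h x)"
        by (rule sq_int_inner_int[OF flux_sq_int[OF sg] W0_sq_int(2)[OF sw]])
      \<comment> \<open>The tangent is taken at the perturbed point, so that convexity bounds the
        energy increment from above by t times the flux there. After division by t, continuity of
        the flux gives the limit t \<rightarrow> 0.\<close>
      have "(LINT x|M. energy (g x + t k *\<^sub>R h x) - t k * (flux (g x + t k *\<^sub>R h x) \<bullet> h x)) \<le> (LINT x|M. energy (g x))"
      proof (rule integral_mono)
        show "energy (g x + t k *\<^sub>R h x) - t k * (flux (g x + t k *\<^sub>R h x) \<bullet> h x) \<le> energy (g x)" for x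
          using energy_convex[of "g x + t k *\<^sub>R h x" "g x"] by simp
      qed (use energy_int[OF W0_sq_int(2)[OF s]] energy_int[OF sg] I in auto)
      then have 1: "(LINT x|M. energy (g x + t k *\<^sub>R h x)) - t k * (LINT x|M. flux (g x + t k *\<^sub>R h x) \<bullet> h x) \<le> (LINT x|M. energy (g x))"
        using energy_int[OF sg] I by simp
      have 2: "lin_energy f v g \<le> lin_energy f (\<lambda>x. v x + t k * w x) (\<lambda>x. g x + t k *\<^sub>R h x)"
        by (rule mn[OF W0_lin[OF s sw]])
      have "(LINT x|M. f x * (v x + t k * w x)) = (LINT x|M. f x * v x + t k * (f x * w x))"
        by (simp add: algebra_simps)
      also have "\<dots> = (LINT x|M. f x * v x) + t k * (LINT x|M. f x * w x)"
        using dual_bound(3)[OF f s] dual_bound(3)[OF f sw] by simp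
      finally have "t k * (LINT x|M. f x * w x) \<le> t k * (LINT x|M. flux (g x + t k *\<^sub>R h x) \<bullet> h x)"
        using 1 2 unfolding lin_energy_def by linarith
      then show ?thesis using t(1)[of k] by (simp add: mult_le_cancel_left_pos)
    qed
    have "(\<lambda>k. LINT x|M. flux (g x + t k *\<^sub>R h x) \<bullet> h x) \<longlonglongrightarrow> (LINT x|M. flux (g x) \<bullet> h x)"
    proof (rule integral_dominated_convergence[where w="\<lambda>x. b^2 * (norm (g x) * norm (h x) + norm (h x) * norm (h x))"])
      show "integrable M (\<lambda>x. b^2 * (norm (g x) * norm (h x) + norm (h x) * norm (h x)))"
        using sq_int_mult_int[OF W0_sq_int(2)[OF s] W0_sq_int(2)[OF sw]] sq_int_mult_int[OF W0_sq_int(2)[OF sw] W0_sq_int(2)[OF sw]] by simp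
      show "AE x in M. (\<lambda>k. flux (g x + t k *\<^sub>R h x) \<bullet> h x) \<longlonglongrightarrow> flux (g x) \<bullet> h x"
      proof (rule AE_I2)
        fix x
        have "(\<lambda>k. g x + t k *\<^sub>R h x) \<longlonglongrightarrow> g x + 0 *\<^sub>R h x" by (intro tendsto_intros t0)
        then have "(\<lambda>k. g x + t k *\<^sub>R h x) \<longlonglongrightarrow> g x" by simp
        from isCont_tendsto_compose[OF flux_cont this]
        show "(\<lambda>k. flux (g x + t k *\<^sub>R h x) \<bullet> h x) \<longlonglongrightarrow> flux (g x) \<bullet> h x" by (intro tendsto_intros)
      qed
      show "AE x in M. norm (flux (g x + t k *\<^sub>R h x) \<bullet> h x) \<le> b^2 * (norm (g x) * norm (h x) + norm (h x) * norm (h x))" for k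
      proof (rule AE_I2)
        fix x
        have "norm (g x + t k *\<^sub>R h x) \<le> norm (g x) + norm (t k *\<^sub>R h x)" by (rule norm_triangle_ineq)
        also have "norm (t k *\<^sub>R h x) \<le> norm (h x)" using t[of k] by (simp add: mult_left_le_one_le)
        finally have n: "norm (g x + t k *\<^sub>R h x) \<le> norm (g x) + norm (h x)" by simp
        have "\<bar>flux (g x + t k *\<^sub>R h x) \<bullet> h x\<bar> \<le> norm (flux (g x + t k *\<^sub>R h x)) * norm (h x)" by (rule Cauchy_Schwarz_ineq2)
        also have "\<dots> \<le> (b^2 * norm (g x + t k *\<^sub>R h x)) * norm (h x)" using flux_norm by (intro mult_right_mono) auto
        also have "\<dots> \<le> (b^2 * (norm (g x) + norm (h x))) * norm (h x)"
          using n by (intro mult_right_mono mult_left_mono) auto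
        finally show "norm (flux (g x + t k *\<^sub>R h x) \<bullet> h x) \<le> b^2 * (norm (g x) * norm (h x) + norm (h x) * norm (h x))"
          by (simp add: algebra_simps)
      qed
    qed measurable
    then show ?thesis by (rule LIMSEQ_le_const) (use ge in blast)
  qed
  have "(LINT x|M. flux (g x) \<bullet> h x) = (LINT x|M. f x * w x)" if sw: "W0 w h" for w h
  proof (rule antisym)
    show "(LINT x|M. f x * w x) \<le> (LINT x|M. flux (g x) \<bullet> h x)" by (rule half[OF sw])
    have "W0 (\<lambda>x. (-1) * w x) (\<lambda>x. (-1) *\<^sub>R h x)" by (rule W0_scale[OF sw])
    from half[OF this] show "(LINT x|M. flux (g x) \<bullet> h x) \<le> (LINT x|M. f x * w x)" by simp
  qed
  then show thesis using that s unfolding solves_def by blast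
qed

section \<open>Comparison principle\<close>

lemma solves_imp_W0: "solves u g f \<Longrightarrow> W0 u g" by (simp add: solves_def)

lemma solves_eq: "solves u g f \<Longrightarrow> W0 v h \<Longrightarrow> (LINT x|M. flux (g x) \<bullet> h x) = (LINT x|M. f x * v x)"
  by (simp add: solves_def)

lemma solves_diff_eq:
  assumes s: "solves u1 g1 f1" "solves u2 g2 f2" and d: "dual f1 C1" "dual f2 C2" and v: "W0 v h"
  shows "(LINT x|M. (flux (g1 x) - flux (g2 x)) \<bullet> h x) = (LINT x|M. (f1 x - f2 x) * v x)"
    "integrable M (\<lambda>x. (flux (g1 x) - flux (g2 x)) \<bullet> h x)" "integrable M (\<lambda>x. (f1 x - f2 x) * v x)"
proof -
  have I: "integrable M (\<lambda>x. flux (g1 x) \<bullet> h x)" "integrable M (\<lambda>x. flux (g2 x) \<bullet> h x)"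
    using s v by (auto intro!: sq_int_inner_int flux_sq_int dest: solves_imp_W0 W0_sq_int)
  note J = dual_bound(3)[OF d(1) v] dual_bound(3)[OF d(2) v]
  show "integrable M (\<lambda>x. (flux (g1 x) - flux (g2 x)) \<bullet> h x)" using I by (simp add: inner_diff_left)
  show "integrable M (\<lambda>x. (f1 x - f2 x) * v x)" using J by (simp add: left_diff_distrib)
  show "(LINT x|M. (flux (g1 x) - flux (g2 x)) \<bullet> h x) = (LINT x|M. (f1 x - f2 x) * v x)"
    using I J solves_eq[OF s(1) v] solves_eq[OF s(2) v] by (simp add: inner_diff_left left_diff_distrib)
qed

text \<open>The difference of the equations is tested with the positive part of
  \<open>u1 - u2\<close>. The flux side is nonnegative by monotonicity, the other side nonpositive,
  so both vanish. Strict monotonicity then kills the gradient of the positive part, and Poincare's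
  inequality the positive part itself.\<close>

lemma comparison:
  assumes s: "solves u1 g1 f1" "solves u2 g2 f2" and d: "dual f1 C1" "dual f2 C2"
    and le: "AE x in M. f1 x \<le> f2 x"
  shows "AE x in M. u1 x \<le> u2 x"
proof -
  have sd: "W0 (\<lambda>x. u1 x - u2 x) (\<lambda>x. g1 x - g2 x)" by (rule W0_diff[OF solves_imp_W0[OF s(1)] solves_imp_W0[OF s(2)]])
  let ?w = "\<lambda>x. max (u1 x - u2 x - 0) 0"
  let ?c = "\<lambda>x. heaviside 0 (u1 x - u2 x)"
  have sw: "W0 ?w (\<lambda>x. ?c x *\<^sub>R (g1 x - g2 x))" by (rule W0_pos[OF sd]) simp
  note E = solves_diff_eq[OF s d sw]
  have p0: "0 \<le> (flux (g1 x) - flux (g2 x)) \<bullet> (?c x *\<^sub>R (g1 x - g2 x))" for x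
  proof -
    have "0 \<le> 2 * conv_const * (norm (g1 x - g2 x))^2" using conv_const(1) by simp
    also have "\<dots> \<le> (flux (g1 x) - flux (g2 x)) \<bullet> (g1 x - g2 x)" by (rule flux_mono)
    finally show ?thesis using heaviside_bounds(1) by simp
  qed
  have "(LINT x|M. (f1 x - f2 x) * ?w x) \<le> 0"
  proof -
    have "AE x in M. 0 \<le> - ((f1 x - f2 x) * ?w x)"
      using le by eventually_elim (auto simp: mult_nonpos_nonneg)
    from integral_nonneg_AE[OF this] show ?thesis by simp
  qed
  then have "(LINT x|M. (flux (g1 x) - flux (g2 x)) \<bullet> (?c x *\<^sub>R (g1 x - g2 x))) \<le> 0" using E(1) by simp
  moreover have "0 \<le> (LINT x|M. (flux (g1 x) - flux (g2 x)) \<bullet> (?c x *\<^sub>R (g1 x - g2 x)))"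
    by (rule integral_nonneg_AE) (use p0 in simp)
  ultimately have "(LINT x|M. (flux (g1 x) - flux (g2 x)) \<bullet> (?c x *\<^sub>R (g1 x - g2 x))) = 0" by linarith
  then have "AE x in M. (flux (g1 x) - flux (g2 x)) \<bullet> (?c x *\<^sub>R (g1 x - g2 x)) = 0"
    using integral_nonneg_eq_0_iff_AE[OF E(2)] p0 by simp
  then have "AE x in M. ?c x *\<^sub>R (g1 x - g2 x) = 0"
  proof eventually_elim
    case (elim x)
    show ?case
    proof (cases "?c x = 0")
      case False
      then have "(flux (g1 x) - flux (g2 x)) \<bullet> (g1 x - g2 x) = 0" using elim by simp
      then have "2 * conv_const * (norm (g1 x - g2 x))^2 \<le> 0" using flux_mono[of "g1 x" "g2 x"] by simp
      then have "(norm (g1 x - g2 x))^2 \<le> 0" using conv_const(1) by (simp add: mult_le_0_iff)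
      then show ?thesis by simp
    qed simp
  qed
  from W0_zero_grad[OF sw this] show ?thesis
    by eventually_elim (simp add: max_def split: if_splits)
qed

lemma solves_zero: "solves (\<lambda>x. 0) (\<lambda>x. 0) (\<lambda>x. 0)"
  by (simp add: solves_def W0_zero)

lemma dual_zero: "dual (\<lambda>x. 0) 0" by (simp add: dual_def)

lemma solves_nonneg:
  assumes "solves u g f" "dual f C" shows "AE x in M. 0 \<le> u x"
  using comparison[OF solves_zero assms(1) dual_zero assms(2)] assms(2) by (simp add: dual_def)

end

section \<open>Minimal solutions minimise the energy\<close>

text \<open>Minimality is stated against nonnegative solutions with integrable exponential: the
  competitor will be the limit of the iterates started at 0, which has these properties.\<close>

locale minimal_solution = finsler_domain \<Omega> F a b \<mu> \<Lambda>
  for \<Omega> :: "(real^'n::finite) set" and F :: "real^'n \<Rightarrow> real" and a b \<mu> \<Lambda> :: real +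
  fixes lam :: real and u :: "real^'n \<Rightarrow> real" and g :: "real^'n \<Rightarrow> real^'n" and C :: real
  assumes lam: "lam > 0"
    and u_solves: "solves u g (\<lambda>x. lam * exp (u x))"
    and u_dual: "dual (\<lambda>x. lam * exp (u x)) C"
    and u_minimal: "\<And>z h. solves z h (\<lambda>x. lam * exp (z x)) \<Longrightarrow> integrable M (\<lambda>x. exp (z x)) \<Longrightarrow>
      AE x in M. 0 \<le> z x \<Longrightarrow> AE x in M. u x \<le> z x"
begin

lemma W0_u: "W0 u g" by (rule solves_imp_W0[OF u_solves])

lemma u_meas [measurable]: "u \<in> borel_measurable M" "g \<in> borel_measurable M"
  by (rule W0_meas[OF W0_u])+

lemma u_nonneg: "AE x in M. 0 \<le> u x" by (rule solves_nonneg[OF u_solves u_dual])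

lemma exp_u_integrable: "integrable M (\<lambda>x. exp (u x))"
proof -
  have "integrable M (\<lambda>x. (1 / lam) * (lam * exp (u x)))"
    using u_dual by (intro integrable_mult_right) (simp add: dual_def)
  then show ?thesis using lam by simp
qed

lemma exp_u_mult_u_integrable: "integrable M (\<lambda>x. exp (u x) * u x)"
proof -
  have "integrable M (\<lambda>x. (1 / lam) * (lam * exp (u x) * u x))"
    by (intro integrable_mult_right dual_bound(3)[OF u_dual W0_u])
  then show ?thesis using lam by (simp add: mult.assoc)
qed

lemma dual_below:
  assumes "w \<in> borel_measurable M" "AE x in M. w x \<le> u x"
  shows "dual (\<lambda>x. lam * exp (w x)) C"
proof (rule dual_mono[OF u_dual])
  show "AE x in M. lam * exp (w x) \<le> lam * exp (u x)"
    using assms(2) by eventually_elim (use lam in simp)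
qed (use assms lam in auto)

lemma exp_int_below:
  assumes "w \<in> borel_measurable M" "AE x in M. w x \<le> u x"
  shows "integrable M (\<lambda>x. exp (w x))"
proof (rule Bochner_Integration.integrable_bound[OF exp_u_integrable])
  show "AE x in M. norm (exp (w x)) \<le> norm (exp (u x))" using assms(2) by eventually_elim simp
qed (use assms in measurable)

text \<open>Function and gradient are chosen together, so that \<open>sol w\<close> and
  \<open>sol_grad w\<close> belong to the same solution. Existence holds below u because
  \<open>lam * exp (w x)\<close> inherits the dual bound of \<open>lam * exp (u x)\<close>.\<close>

definition solution_map :: "(real^'n \<Rightarrow> real) \<Rightarrow> (real^'n \<Rightarrow> real) \<times> (real^'n \<Rightarrow> real^'n)" where
  "solution_map w = (SOME p. solves (fst p) (snd p) (\<lambda>x. lam * exp (w x)))"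

definition sol where "sol w = fst (solution_map w)"
definition sol_grad where "sol_grad w = snd (solution_map w)"

lemma sol_solves:
  assumes "w \<in> borel_measurable M" "AE x in M. w x \<le> u x"
  shows "solves (sol w) (sol_grad w) (\<lambda>x. lam * exp (w x))"
proof -
  have "\<exists>p. solves (fst p) (snd p) (\<lambda>x. lam * exp (w x))"
  proof -
    obtain v h where "solves v h (\<lambda>x. lam * exp (w x))" using exists_solution[OF dual_below[OF assms]] by blast
    then show ?thesis by (intro exI[of _ "(v, h)"]) simp
  qed
  from someI_ex[OF this] show ?thesis by (simp add: sol_def sol_grad_def solution_map_def)
qed

lemma sol_props:
  assumes "w \<in> borel_measurable M" "AE x in M. w x \<le> u x"
  shows "W0 (sol w) (sol_grad w)" "sol w \<in> borel_measurable M" "AE x in M. 0 \<le> sol w x" "AE x in M. sol w x \<le> u x"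
proof -
  note s = sol_solves[OF assms] and d = dual_below[OF assms]
  show "W0 (sol w) (sol_grad w)" by (rule solves_imp_W0[OF s])
  then show "sol w \<in> borel_measurable M" by (rule W0_meas)
  show "AE x in M. 0 \<le> sol w x" by (rule solves_nonneg[OF s d])
  show "AE x in M. sol w x \<le> u x"
  proof (rule comparison[OF s u_solves d u_dual])
    show "AE x in M. lam * exp (w x) \<le> lam * exp (u x)" using assms(2) by eventually_elim (use lam in simp)
  qed
qed

lemma sol_mono:
  assumes "w \<in> borel_measurable M" "AE x in M. w x \<le> u x" "w' \<in> borel_measurable M" "AE x in M. w' x \<le> u x"
    "AE x in M. w x \<le> w' x"
  shows "AE x in M. sol w x \<le> sol w' x"
proof (rule comparison[OF sol_solves[OF assms(1,2)] sol_solves[OF assms(3,4)] dual_below[OF assms(1,2)] dual_below[OF assms(3,4)]])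
  show "AE x in M. lam * exp (w x) \<le> lam * exp (w' x)" using assms(5) by eventually_elim (use lam in simp)
qed

primrec iter :: "(real^'n \<Rightarrow> real) \<Rightarrow> nat \<Rightarrow> real^'n \<Rightarrow> real" where
  "iter w 0 = w" | "iter w (Suc k) = sol (iter w k)"

lemma iter_props:
  assumes "w \<in> borel_measurable M" "AE x in M. 0 \<le> w x" "AE x in M. w x \<le> u x"
  shows "iter w k \<in> borel_measurable M \<and> (AE x in M. 0 \<le> iter w k x) \<and> (AE x in M. iter w k x \<le> u x)"
  by (induction k) (use assms sol_props in auto)

lemma iter_mono:
  assumes "w \<in> borel_measurable M" "AE x in M. 0 \<le> w x" "AE x in M. w x \<le> u x"
    "w' \<in> borel_measurable M" "AE x in M. 0 \<le> w' x" "AE x in M. w' x \<le> u x" "AE x in M. w x \<le> w' x"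
  shows "AE x in M. iter w k x \<le> iter w' k x"
proof (induction k)
  case (Suc k)
  have "AE x in M. sol (iter w k) x \<le> sol (iter w' k) x"
    using iter_props[OF assms(1-3), of k] iter_props[OF assms(4-6), of k] Suc.IH by (intro sol_mono) blast+
  then show ?case by simp
qed (use assms(7) in simp)

abbreviation "iter_zero \<equiv> iter (\<lambda>x. 0)"

lemma iter_zero_props: "iter_zero k \<in> borel_measurable M" "AE x in M. 0 \<le> iter_zero k x" "AE x in M. iter_zero k x \<le> u x"
  using iter_props[of "\<lambda>x. 0" k] u_nonneg by auto

lemma iter_zero_incr: "AE x in M. iter_zero k x \<le> iter_zero (Suc k) x"
proof (induction k)
  case 0
  then show ?case using iter_zero_props(2)[of "Suc 0"] by simp
next
  case (Suc k)
  have "AE x in M. sol (iter_zero k) x \<le> sol (iter_zero (Suc k)) x"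
    by (rule sol_mono[OF iter_zero_props(1,3) iter_zero_props(1,3) Suc.IH])
  then show ?case by simp
qed

text \<open>The dominating function \<open>exp (u x) * u x\<close> is integrable because u itself is
  an admissible argument of the functional \<open>lam * exp (u x)\<close>.\<close>

lemma exp_diff_conv:
  assumes m: "\<And>k. v k \<in> borel_measurable M" "vl \<in> borel_measurable M"
    and b: "\<And>k. AE x in M. 0 \<le> v k x" "\<And>k. AE x in M. v k x \<le> u x"
    and lim: "AE x in M. (\<lambda>k. v k x) \<longlonglongrightarrow> vl x"
  shows "(\<lambda>k. LINT x|M. \<bar>exp (vl x) - exp (v k x)\<bar> * u x) \<longlonglongrightarrow> 0"
proof -
  note [measurable] = m
  have b': "AE x in M. \<forall>k. 0 \<le> v k x \<and> v k x \<le> u x" using b by (simp add: AE_all_countable)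
  have "(\<lambda>k. LINT x|M. \<bar>exp (vl x) - exp (v k x)\<bar> * u x) \<longlonglongrightarrow> (LINT x|M. 0)"
  proof (rule integral_dominated_convergence[where w="\<lambda>x. exp (u x) * u x"])
    show "AE x in M. (\<lambda>k. \<bar>exp (vl x) - exp (v k x)\<bar> * u x) \<longlonglongrightarrow> 0"
      using lim
    proof eventually_elim
      case (elim x)
      have "(\<lambda>k. \<bar>exp (vl x) - exp (v k x)\<bar> * u x) \<longlonglongrightarrow> \<bar>exp (vl x) - exp (vl x)\<bar> * u x"
        using elim by (intro tendsto_intros)
      then show ?case by simp
    qed
    show "AE x in M. norm (\<bar>exp (vl x) - exp (v k x)\<bar> * u x) \<le> exp (u x) * u x" for k
      using b' lim
    proof eventually_elim
      case (elim x)
      have l: "0 \<le> vl x" "vl x \<le> u x"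
        using elim(1) LIMSEQ_le_const[OF elim(2), of 0] LIMSEQ_le_const2[OF elim(2), of "u x"] by auto
      have "exp (vl x) \<le> exp (u x)" "exp (v k x) \<le> exp (u x)" using l elim(1) by auto
      then have "\<bar>exp (vl x) - exp (v k x)\<bar> \<le> exp (u x)"
        using exp_gt_zero[of "vl x"] exp_gt_zero[of "v k x"] by linarith
      moreover have "0 \<le> u x" using l by simp
      ultimately show ?case by (simp add: abs_mult mult_right_mono)
    qed
  qed (use exp_u_mult_u_integrable in measurable)
  then show ?thesis by simp
qed

text \<open>The iterates increase and stay below u, so they have a pointwise limit
  \<open>vl\<close>. Continuity of the solution operator along them shows that \<open>sol vl\<close>
  equals \<open>vl\<close> almost everywhere, so the limit solves the nonlinear problem. Minimality
  gives u \<le> vl, and the reverse inequality was built in.\<close>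

lemma iter_zero_conv: "AE x in M. (\<lambda>k. iter_zero k x) \<longlonglongrightarrow> u x"
proof -
  define vl where "vl x = lim (\<lambda>k. iter_zero k x)" for x
  note [measurable] = iter_zero_props(1)
  have vm [measurable]: "vl \<in> borel_measurable M"
    unfolding vl_def by (rule borel_measurable_lim_metric) measurable
  have ball: "AE x in M. \<forall>k. 0 \<le> iter_zero k x \<and> iter_zero k x \<le> u x \<and> iter_zero k x \<le> iter_zero (Suc k) x"
    using iter_zero_props iter_zero_incr by (simp add: AE_all_countable del: iter.simps)
  have lim: "AE x in M. (\<lambda>k. iter_zero k x) \<longlonglongrightarrow> vl x"
    using ball
  proof eventually_elim
    case (elim x)
    have "incseq (\<lambda>k. iter_zero k x)" using elim by (intro incseq_SucI) blast
    moreover have "\<forall>k. iter_zero k x \<le> u x" using elim by blast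
    ultimately have "convergent (\<lambda>k. iter_zero k x)" using incseq_convergent by (metis convergentI)
    then show ?case by (simp add: vl_def convergent_LIMSEQ_iff)
  qed
  have vlb: "AE x in M. 0 \<le> vl x" "AE x in M. vl x \<le> u x"
  proof -
    show "AE x in M. 0 \<le> vl x" using ball lim
      by eventually_elim (meson LIMSEQ_le_const)
    show "AE x in M. vl x \<le> u x" using ball lim
      by eventually_elim (meson LIMSEQ_le_const2)
  qed
  note z = sol_solves[OF vm vlb(2)] and zp = sol_props[OF vm vlb(2)] and zd = dual_below[OF vm vlb(2)]
  \<comment> \<open>Uniform monotonicity of the flux is tested with the difference of two solutions.
    Both lie between 0 and u, so the difference is at most u in absolute value, which fits
    \<open>exp_diff_conv\<close>.\<close>
  have est: "2 * conv_const * sq_norm M (\<lambda>x. sol_grad vl x - sol_grad (iter_zero k) x) \<le> lam * (LINT x|M. \<bar>exp (vl x) - exp (iter_zero k x)\<bar> * u x)" for k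
  proof -
    note y = sol_solves[OF iter_zero_props(1,3)[of k]] and yp = sol_props[OF iter_zero_props(1,3)[of k]] and yd = dual_below[OF iter_zero_props(1,3)[of k]]
    have sd: "W0 (\<lambda>x. sol vl x - sol (iter_zero k) x) (\<lambda>x. sol_grad vl x - sol_grad (iter_zero k) x)" by (rule W0_diff[OF zp(1) yp(1)])
    note E = solves_diff_eq[OF z y zd yd sd]
    have "2 * conv_const * sq_norm M (\<lambda>x. sol_grad vl x - sol_grad (iter_zero k) x) = (LINT x|M. 2 * conv_const * (norm (sol_grad vl x - sol_grad (iter_zero k) x))^2)"
      by (simp add: sq_norm_def)
    also have "\<dots> \<le> (LINT x|M. (flux (sol_grad vl x) - flux (sol_grad (iter_zero k) x)) \<bullet> (sol_grad vl x - sol_grad (iter_zero k) x))"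
      using sq_int_int[OF W0_sq_int(2)[OF sd]] by (intro integral_mono flux_mono E(2)) simp
    also have "\<dots> = (LINT x|M. (lam * exp (vl x) - lam * exp (iter_zero k x)) * (sol vl x - sol (iter_zero k) x))" by (rule E(1))
    also have "\<dots> \<le> (LINT x|M. lam * (\<bar>exp (vl x) - exp (iter_zero k x)\<bar> * u x))"
    proof (rule integral_mono_AE[OF E(3)])
      have "AE x in M. norm (\<bar>exp (vl x) - exp (iter_zero k x)\<bar> * u x) \<le> norm (exp (u x) * u x)"
        using iter_zero_props(2,3)[of k] vlb
      proof eventually_elim
        case (elim x)
        have "exp (vl x) \<le> exp (u x)" "exp (iter_zero k x) \<le> exp (u x)" using elim by auto
        then have "\<bar>exp (vl x) - exp (iter_zero k x)\<bar> \<le> exp (u x)"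
          using exp_gt_zero[of "vl x"] exp_gt_zero[of "iter_zero k x"] by linarith
        then show ?case using elim by (simp add: abs_mult mult_right_mono)
      qed
      then have "integrable M (\<lambda>x. \<bar>exp (vl x) - exp (iter_zero k x)\<bar> * u x)"
        by (intro Bochner_Integration.integrable_bound[OF exp_u_mult_u_integrable]) measurable
      then show "integrable M (\<lambda>x. lam * (\<bar>exp (vl x) - exp (iter_zero k x)\<bar> * u x))" by simp
      show "AE x in M. (lam * exp (vl x) - lam * exp (iter_zero k x)) * (sol vl x - sol (iter_zero k) x) \<le> lam * (\<bar>exp (vl x) - exp (iter_zero k x)\<bar> * u x)"
        using zp(3,4) yp(3,4)
      proof eventually_elim
        case (elim x)
        have "\<bar>sol vl x - sol (iter_zero k) x\<bar> \<le> u x" using elim by linarith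
        then have "\<bar>exp (vl x) - exp (iter_zero k x)\<bar> * \<bar>sol vl x - sol (iter_zero k) x\<bar> \<le> \<bar>exp (vl x) - exp (iter_zero k x)\<bar> * u x"
          by (intro mult_left_mono) auto
        then have "(exp (vl x) - exp (iter_zero k x)) * (sol vl x - sol (iter_zero k) x) \<le> \<bar>exp (vl x) - exp (iter_zero k x)\<bar> * u x"
          using abs_ge_self[of "(exp (vl x) - exp (iter_zero k x)) * (sol vl x - sol (iter_zero k) x)"] by (simp add: abs_mult)
        then have "lam * ((exp (vl x) - exp (iter_zero k x)) * (sol vl x - sol (iter_zero k) x)) \<le> lam * (\<bar>exp (vl x) - exp (iter_zero k x)\<bar> * u x)"
          using lam by (intro mult_left_mono) auto
        then show ?case by (simp add: algebra_simps)
      qed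
    qed
    finally show ?thesis by simp
  qed
  have "(\<lambda>k. poincare_const^2 * (lam / (2 * conv_const) * (LINT x|M. \<bar>exp (vl x) - exp (iter_zero k x)\<bar> * u x))) \<longlonglongrightarrow> poincare_const^2 * (lam / (2 * conv_const) * 0)"
    by (intro tendsto_intros exp_diff_conv[OF iter_zero_props(1) vm iter_zero_props(2,3) lim])
  then have lim0: "(\<lambda>k. poincare_const^2 * (lam / (2 * conv_const) * (LINT x|M. \<bar>exp (vl x) - exp (iter_zero k x)\<bar> * u x))) \<longlonglongrightarrow> 0" by simp
  have n2lim: "(\<lambda>k. sq_norm M (\<lambda>x. iter_zero (Suc k) x - sol vl x)) \<longlonglongrightarrow> 0"
  proof (rule tendsto_zero_squeeze[OF lim0])
    fix k
    have "sq_norm M (\<lambda>x. iter_zero (Suc k) x - sol vl x) = sq_norm M (\<lambda>x. sol vl x - sol (iter_zero k) x)" by (simp add: sq_norm_commute)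
    also have "\<dots> \<le> poincare_const^2 * sq_norm M (\<lambda>x. sol_grad vl x - sol_grad (iter_zero k) x)"
      by (rule poincare[OF W0_diff[OF zp(1) sol_props(1)[OF iter_zero_props(1,3)]]])
    also have "sq_norm M (\<lambda>x. sol_grad vl x - sol_grad (iter_zero k) x) \<le> lam / (2 * conv_const) * (LINT x|M. \<bar>exp (vl x) - exp (iter_zero k x)\<bar> * u x)"
      using est[of k] conv_const(1) by (simp add: pos_le_divide_eq mult_ac)
    finally show "sq_norm M (\<lambda>x. iter_zero (Suc k) x - sol vl x) \<le> poincare_const^2 * (lam / (2 * conv_const) * (LINT x|M. \<bar>exp (vl x) - exp (iter_zero k x)\<bar> * u x))"
      by (simp add: mult_left_mono)
  qed simp
  have "sq_int M (\<lambda>x. iter_zero (Suc k) x - sol vl x)" for k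
    using W0_sq_int(1)[OF zp(1)] W0_sq_int(1)[OF sol_props(1)[OF iter_zero_props(1,3)]] by (simp add: sq_int_diff)
  from sq_norm_AE_subseq[of M "\<lambda>k. iter_zero (Suc k)" "sol vl", OF this n2lim]
  obtain r :: "nat \<Rightarrow> nat" where r: "strict_mono r" "AE x in M. (\<lambda>k. iter_zero (Suc (r k)) x) \<longlonglongrightarrow> sol vl x" by blast
  have eq: "AE x in M. sol vl x = vl x"
    using r(2) lim
  proof eventually_elim
    case (elim x)
    have "(\<lambda>k. iter_zero (Suc (r k)) x) \<longlonglongrightarrow> vl x"
      using LIMSEQ_subseq_LIMSEQ[OF LIMSEQ_Suc[OF elim(2)] r(1)] by (simp add: o_def)
    then show ?case using elim(1) LIMSEQ_unique by blast
  qed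
  \<comment> \<open>The pointwise limit \<open>vl\<close> comes without a gradient. Its
    representative \<open>sol vl\<close> has one, and the two agree almost everywhere, so the
    right-hand side may be rewritten.\<close>
  have "solves (sol vl) (sol_grad vl) (\<lambda>x. lam * exp (sol vl x))"
    unfolding solves_def
  proof (intro conjI allI impI zp(1))
    fix w h assume w: "W0 w h"
    note [measurable] = zp(2) W0_meas[OF w]
    have "(LINT x|M. lam * exp (vl x) * w x) = (LINT x|M. lam * exp (sol vl x) * w x)"
    proof (rule integral_cong_AE)
      show "AE x in M. lam * exp (vl x) * w x = lam * exp (sol vl x) * w x" using eq by eventually_elim simp
    qed measurable
    then show "(LINT x|M. flux (sol_grad vl x) \<bullet> h x) = (LINT x|M. lam * exp (sol vl x) * w x)"
      using solves_eq[OF z w] by simp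
  qed
  from u_minimal[OF this exp_int_below[OF zp(2,4)] zp(3)]
  have "AE x in M. u x \<le> sol vl x" .
  then show ?thesis using eq vlb(2) lim
    by eventually_elim (simp add: antisym)
qed

section \<open>The energy functional along the iteration\<close>

definition gelfand :: "(real^'n \<Rightarrow> real) \<Rightarrow> (real^'n \<Rightarrow> real^'n) \<Rightarrow> real" where
  "gelfand w h = (LINT x|M. energy (h x)) - lam * (LINT x|M. exp (w x))"

text \<open>Two tangent inequalities are added: for the energy at \<open>sol_grad w\<close>, and for
  the exponential at \<open>w\<close>. The equation for \<open>sol w\<close>, tested with
  \<open>w - sol w\<close>, makes the two first-order terms cancel.\<close>

lemma gelfand_step:
  assumes s: "W0 w h" and w: "AE x in M. w x \<le> u x"
  shows "gelfand (sol w) (sol_grad w) \<le> gelfand w h"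
proof -
  note wm = W0_meas(1)[OF s]
  note t = sol_solves[OF wm w] and tp = sol_props[OF wm w] and d = dual_below[OF wm w]
  have sd: "W0 (\<lambda>x. w x - sol w x) (\<lambda>x. h x - sol_grad w x)" by (rule W0_diff[OF s tp(1)])
  have fI: "integrable M (\<lambda>x. flux (sol_grad w x) \<bullet> (h x - sol_grad w x))"
    by (rule sq_int_inner_int[OF flux_sq_int[OF W0_sq_int(2)[OF tp(1)]] W0_sq_int(2)[OF sd]])
  have "(LINT x|M. energy (sol_grad w x) + flux (sol_grad w x) \<bullet> (h x - sol_grad w x)) \<le> (LINT x|M. energy (h x))"
    using energy_int[OF W0_sq_int(2)[OF s]] energy_int[OF W0_sq_int(2)[OF tp(1)]] fI
    by (intro integral_mono energy_convex) auto
  then have 1: "(LINT x|M. energy (sol_grad w x)) + (LINT x|M. lam * exp (w x) * (w x - sol w x)) \<le> (LINT x|M. energy (h x))"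
    using energy_int[OF W0_sq_int(2)[OF tp(1)]] fI solves_eq[OF t sd] by simp
  have eI: "integrable M (\<lambda>x. lam * exp (w x) * (w x - sol w x))" by (rule dual_bound(3)[OF d sd])
  have "(LINT x|M. lam * exp (w x) - lam * exp (w x) * (w x - sol w x)) \<le> (LINT x|M. lam * exp (sol w x))"
  proof (rule integral_mono)
    show "integrable M (\<lambda>x. lam * exp (w x) - lam * exp (w x) * (w x - sol w x))"
      using eI exp_int_below[OF wm w] by simp
    show "integrable M (\<lambda>x. lam * exp (sol w x))" using exp_int_below[OF tp(2,4)] by simp
    fix x
    have "exp (w x) * (1 + (sol w x - w x)) \<le> exp (w x) * exp (sol w x - w x)"
      by (intro mult_left_mono exp_ge_add_one_self) simp
    also have "\<dots> = exp (sol w x)" by (simp add: exp_add[symmetric])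
    finally have "lam * (exp (w x) * (1 + (sol w x - w x))) \<le> lam * exp (sol w x)" using lam by (intro mult_left_mono) auto
    then show "lam * exp (w x) - lam * exp (w x) * (w x - sol w x) \<le> lam * exp (sol w x)" by (simp add: algebra_simps)
  qed
  then have 2: "lam * (LINT x|M. exp (w x)) - (LINT x|M. lam * exp (w x) * (w x - sol w x)) \<le> lam * (LINT x|M. exp (sol w x))"
    using eI exp_int_below[OF wm w] by simp
  show ?thesis using 1 2 unfolding gelfand_def by linarith
qed

text \<open>The functional decreases along the iterates of w, which are squeezed between those of 0
  and u and so converge to u almost everywhere. For the gradient term a lower bound at u is enough,
  and this needs only pointwise convergence of the functions.\<close>

lemma gelfand_min:
  assumes s: "W0 w h" and w: "AE x in M. 0 \<le> w x" "AE x in M. w x \<le> u x"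
  shows "gelfand u g \<le> gelfand w h"
proof -
  note wm [measurable] = W0_meas(1)[OF s]
  \<comment> \<open>The gradient belonging to the k-th iterate: the given one at the start,
    afterwards that of the chosen solution.\<close>
  define hh where "hh k = (case k of 0 \<Rightarrow> h | Suc j \<Rightarrow> sol_grad (iter w j))" for k
  note ip = iter_props[OF wm w]
  have sk: "W0 (iter w k) (hh k)" for k
    using s sol_props(1)[of "iter w (k - 1)"] ip[of "k - 1"] by (cases k) (auto simp: hh_def)
  note [measurable] = W0_meas(1)[OF sk]
  have dec: "gelfand (iter w k) (hh k) \<le> gelfand w h" for k
  proof (induction k)
    case (Suc k)
    have "gelfand (iter w (Suc k)) (hh (Suc k)) \<le> gelfand (iter w k) (hh k)"
      using gelfand_step[OF sk[of k]] ip[of k] by (simp add: hh_def)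
    then show ?case using Suc by simp
  qed (simp add: hh_def)
  \<comment> \<open>The tangent inequality at \<open>g\<close>, combined with the equation for u,
    replaces the gradient of the iterate by an integral of \<open>iter w k - u\<close> against
    \<open>lam * exp (u x)\<close>.\<close>
  have low: "(LINT x|M. energy (g x)) + (LINT x|M. lam * exp (u x) * (iter w k x - u x)) - lam * (LINT x|M. exp (iter w k x)) \<le> gelfand w h" for k
  proof -
    have sd: "W0 (\<lambda>x. iter w k x - u x) (\<lambda>x. hh k x - g x)" by (rule W0_diff[OF sk W0_u])
    have fI: "integrable M (\<lambda>x. flux (g x) \<bullet> (hh k x - g x))"
      by (rule sq_int_inner_int[OF flux_sq_int[OF W0_sq_int(2)[OF W0_u]] W0_sq_int(2)[OF sd]])
    have "(LINT x|M. energy (g x) + flux (g x) \<bullet> (hh k x - g x)) \<le> (LINT x|M. energy (hh k x))"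
      using energy_int[OF W0_sq_int(2)[OF sk]] energy_int[OF W0_sq_int(2)[OF W0_u]] fI
      by (intro integral_mono energy_convex) auto
    then have "(LINT x|M. energy (g x)) + (LINT x|M. lam * exp (u x) * (iter w k x - u x)) \<le> (LINT x|M. energy (hh k x))"
      using energy_int[OF W0_sq_int(2)[OF W0_u]] fI solves_eq[OF u_solves sd] by simp
    then show ?thesis using dec[of k] unfolding gelfand_def by linarith
  qed
  have v0w: "AE x in M. iter_zero k x \<le> iter w k x" for k
    by (rule iter_mono) (use w u_nonneg in auto)
  have ball: "AE x in M. \<forall>k. 0 \<le> iter w k x \<and> iter w k x \<le> u x \<and> iter_zero k x \<le> iter w k x"
    using ip v0w by (simp add: AE_all_countable)
  have lim: "AE x in M. (\<lambda>k. iter w k x) \<longlonglongrightarrow> u x"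
    using ball iter_zero_conv
  proof eventually_elim
    case (elim x)
    show ?case by (rule tendsto_sandwich[OF _ _ elim(2) tendsto_const]) (use elim(1) in auto)
  qed
  have 1: "(\<lambda>k. LINT x|M. lam * exp (u x) * (iter w k x - u x)) \<longlonglongrightarrow> (LINT x|M. 0)"
  proof (rule integral_dominated_convergence[where w="\<lambda>x. lam * (exp (u x) * u x)"])
    show "integrable M (\<lambda>x. lam * (exp (u x) * u x))" using exp_u_mult_u_integrable by simp
    show "AE x in M. (\<lambda>k. lam * exp (u x) * (iter w k x - u x)) \<longlonglongrightarrow> 0"
      using lim
    proof eventually_elim
      case (elim x)
      have "(\<lambda>k. lam * exp (u x) * (iter w k x - u x)) \<longlonglongrightarrow> lam * exp (u x) * (u x - u x)"
        using elim by (intro tendsto_intros)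
      then show ?case by simp
    qed
    show "AE x in M. norm (lam * exp (u x) * (iter w k x - u x)) \<le> lam * (exp (u x) * u x)" for k
      using ball
    proof eventually_elim
      case (elim x)
      have "0 \<le> iter w k x" "iter w k x \<le> u x" using elim by auto
      then have "\<bar>iter w k x - u x\<bar> \<le> u x" by linarith
      then show ?case using lam by (simp add: abs_mult)
    qed
  qed measurable
  have 2: "(\<lambda>k. LINT x|M. exp (iter w k x)) \<longlonglongrightarrow> (LINT x|M. exp (u x))"
  proof (rule integral_dominated_convergence[where w="\<lambda>x. exp (u x)"])
    show "AE x in M. (\<lambda>k. exp (iter w k x)) \<longlonglongrightarrow> exp (u x)" using lim by eventually_elim (rule tendsto_exp)
    show "AE x in M. norm (exp (iter w k x)) \<le> exp (u x)" for k using ball by eventually_elim simp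
  qed (use exp_u_integrable in measurable)
  have "(\<lambda>k. (LINT x|M. energy (g x)) + (LINT x|M. lam * exp (u x) * (iter w k x - u x)) - lam * (LINT x|M. exp (iter w k x)))
    \<longlonglongrightarrow> (LINT x|M. energy (g x)) + 0 - lam * (LINT x|M. exp (u x))"
    using 1 2 by (intro tendsto_intros) auto
  from LIMSEQ_le_const2[OF this] show ?thesis using low unfolding gelfand_def by simp
qed

end

section \<open>Stability and integrability of the exponential\<close>

text \<open>The smooth truncation \<open>m tanh (s / m)\<close>.\<close>

definition tau :: "real \<Rightarrow> real \<Rightarrow> real" where
  "tau m s = m * (2 * sigmoid (2 / m * s + 0) - 1)"

definition tau' :: "real \<Rightarrow> real \<Rightarrow> real" where
  "tau' m s = 4 * sigmoid (2 / m * s + 0) * (1 - sigmoid (2 / m * s + 0))"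

lemma tau_0 [simp]: "tau m 0 = 0" by (simp add: tau_def)

lemma tau'_bounds: "0 \<le> tau' m s" "tau' m s \<le> 1"
proof -
  have s: "0 < sigmoid (2 / m * s + 0)" "sigmoid (2 / m * s + 0) < 1" by (rule sigmoid_bounds)+
  then show "0 \<le> tau' m s" by (simp add: tau'_def)
  have "0 \<le> (2 * sigmoid (2 / m * s + 0) - 1)^2" by simp
  then show "tau' m s \<le> 1" by (simp add: tau'_def power2_eq_square algebra_simps)
qed

lemma tau_bound: "m > 0 \<Longrightarrow> \<bar>tau m s\<bar> \<le> m"
proof -
  assume m: "m > 0"
  have "\<bar>2 * sigmoid (2 / m * s + 0) - 1\<bar> \<le> 1" using sigmoid_bounds[of "2 / m * s + 0"] by linarith
  then show ?thesis using m by (simp add: tau_def abs_mult)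
qed

lemma DERIV_tau: "m > 0 \<Longrightarrow> (tau m has_real_derivative tau' m s) (at s)"
proof -
  assume m: "m > 0"
  have "((\<lambda>s. 2 / m * s + 0) has_real_derivative 2 / m) (at s)" using m by (auto intro!: derivative_eq_intros)
  from DERIV_chain2[where f = sigmoid and g = "\<lambda>s. 2 / m * s + 0", OF DERIV_sigmoid this]
  have "((\<lambda>s. sigmoid (2 / m * s + 0)) has_real_derivative sigmoid (2 / m * s + 0) * (1 - sigmoid (2 / m * s + 0)) * (2 / m)) (at s)" .
  then have "((\<lambda>s. m * (2 * sigmoid (2 / m * s + 0) - 1)) has_real_derivative m * (2 * (sigmoid (2 / m * s + 0) * (1 - sigmoid (2 / m * s + 0)) * (2 / m)) - 0)) (at s)"
    by (intro derivative_eq_intros refl) auto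
  moreover have "m * (2 * (sigmoid (2 / m * s + 0) * (1 - sigmoid (2 / m * s + 0)) * (2 / m)) - 0) = tau' m s"
    using m by (simp add: tau'_def)
  ultimately show ?thesis unfolding tau_def[abs_def] by simp
qed

lemma DERIV_exp_tau:
  assumes "m > 0"
  shows "((\<lambda>s. A * exp (k * tau m s) + B) has_real_derivative A * k * tau' m s * exp (k * tau m s)) (at s)"
  by (rule derivative_eq_intros DERIV_tau[OF assms] refl | simp)+

text \<open>\<open>k * tau m s\<close> is an affine function of a sigmoid, so the exponential is a
  constant multiple of a member of the family in \<open>smooth1_sigmoid_exp\<close>. The summand
  \<open>+ 0\<close> in \<open>tau\<close> keeps the argument in the shape required there.\<close>

lemma smooth1_exp_tau: "smooth1 (\<lambda>s. A * exp (k * tau m s) + B)"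
proof -
  have "smooth1 (\<lambda>s. poly [:1:] (sigmoid (2 / m * s + 0)) * exp (2 * k * m * sigmoid (2 / m * s + 0)))"
    by (rule smooth1_sigmoid_exp)
  from smooth1_affine[OF this, of "A * exp (- (k * m))" B]
  have "smooth1 (\<lambda>s. A * exp (- (k * m)) * exp (2 * k * m * sigmoid (2 / m * s + 0)) + B)" by simp
  moreover have "A * exp (- (k * m)) * exp (2 * k * m * sigmoid (2 / m * s + 0)) = A * exp (k * tau m s)" for s
  proof -
    have "k * tau m s = - (k * m) + 2 * k * m * sigmoid (2 / m * s + 0)" by (simp add: tau_def algebra_simps)
    then have "exp (k * tau m s) = exp (- (k * m)) * exp (2 * k * m * sigmoid (2 / m * s + 0))" by (simp only: exp_add)
    then show ?thesis by simp
  qed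
  ultimately show ?thesis by (simp only:)
qed

text \<open>With h = 1 / m, the truncation is the difference quotient at 0 of h \<mapsto> 2
  sigmoid(2 s h), whose derivative there is s.\<close>

lemma tau_lim: "(\<lambda>k. tau (real (Suc k)) s) \<longlonglongrightarrow> s"
proof -
  have "((\<lambda>h. 2 * s * h) has_real_derivative 2 * s) (at 0)" by (auto intro!: derivative_eq_intros)
  from DERIV_chain2[where f = sigmoid and g = "\<lambda>h. 2 * s * h", OF DERIV_sigmoid this]
  have "((\<lambda>h. sigmoid (2 * s * h)) has_real_derivative s / 2) (at 0)" by simp
  then have "((\<lambda>h. 2 * sigmoid (2 * s * h)) has_real_derivative 2 * (s / 2)) (at 0)" by (rule DERIV_cmult)
  then have L: "((\<lambda>h. (2 * sigmoid (2 * s * h) - 1) / h) \<longlongrightarrow> s) (at 0)"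
    by (simp add: has_field_derivative_iff)
  have h0: "(\<lambda>k. 1 / real (Suc k)) \<longlonglongrightarrow> 0" by (rule LIMSEQ_one_over_Suc)
  have "filterlim (\<lambda>k. 1 / real (Suc k)) (at 0) sequentially"
    unfolding filterlim_at using h0 by (intro conjI always_eventually) auto
  from filterlim_compose[OF L this] show ?thesis by (simp add: tau_def mult_ac)
qed

text \<open>Taylor expansion to third order: the remainder carries a fourth power and is
  nonnegative. In the second variation the cubic term is of order t^3 and disappears after division
  by t^2.\<close>

lemma exp_neg_lower:
  assumes "(y::real) \<ge> 0" shows "1 - y + y^2 / 2 - y^3 / 6 \<le> exp (- y)"
proof -
  obtain t where "exp (- y) = (\<Sum>m<4. (- y)^m / fact m) + exp t / fact 4 * (- y)^4"
    using Maclaurin_exp_le[of "- y" 4] by blast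
  moreover have "(\<Sum>m<4. (- y)^m / fact m) = 1 - y + y^2 / 2 - y^3 / 6"
    by (simp add: numeral_eq_Suc)
  moreover have "0 \<le> exp t / fact 4 * (- y)^4" by simp
  ultimately show ?thesis by linarith
qed

context minimal_solution
begin

text \<open>The equation tested with \<open>p (u x)\<close>; by Euler's identity the flux applied to
  the gradient of u is \<open>F^2\<close>, twice the energy.\<close>

lemma compose_solution:
  assumes "smooth1 p" "p 0 = 0" "\<And>s. (p has_real_derivative p' s) (at s)" "\<And>s. \<bar>p' s\<bar> \<le> L"
  shows "W0 (\<lambda>x. p (u x)) (\<lambda>x. p' (u x) *\<^sub>R g x)" 
    "integrable M (\<lambda>x. 2 * (p' (u x) * energy (g x)))"
    "(LINT x|M. 2 * (p' (u x) * energy (g x))) = lam * (LINT x|M. exp (u x) * p (u x))"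
    "integrable M (\<lambda>x. exp (u x) * p (u x))"
proof -
  show s: "W0 (\<lambda>x. p (u x)) (\<lambda>x. p' (u x) *\<^sub>R g x)" by (rule W0_comp[OF W0_u assms])
  have e: "flux (g x) \<bullet> (p' (u x) *\<^sub>R g x) = 2 * (p' (u x) * energy (g x))" for x
    by (simp add: flux_self energy_def)
  have "integrable M (\<lambda>x. flux (g x) \<bullet> (p' (u x) *\<^sub>R g x))"
    by (rule sq_int_inner_int[OF flux_sq_int[OF W0_sq_int(2)[OF W0_u]] W0_sq_int(2)[OF s]])
  then show "integrable M (\<lambda>x. 2 * (p' (u x) * energy (g x)))" by (simp only: e)
  have "(LINT x|M. 2 * (p' (u x) * energy (g x))) = (LINT x|M. lam * exp (u x) * p (u x))"
    using solves_eq[OF u_solves s] by (simp only: e)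
  also have "\<dots> = lam * (LINT x|M. exp (u x) * p (u x))" by (simp add: mult.assoc)
  finally show "(LINT x|M. 2 * (p' (u x) * energy (g x))) = lam * (LINT x|M. exp (u x) * p (u x))" .
  have "integrable M (\<lambda>x. (1 / lam) * (lam * exp (u x) * p (u x)))"
    by (intro integrable_mult_right dual_bound(3)[OF u_dual s])
  then show "integrable M (\<lambda>x. exp (u x) * p (u x))" using lam by (simp add: mult.assoc)
qed

text \<open>The functional at \<open>u - t p(u)\<close> is compared with its value at u. The
  first-order terms cancel by the equation tested with p(u); dividing by t^2 and letting t tend to 0
  leaves the claim.\<close>

lemma second_variation:
  assumes p: "smooth1 p" "p 0 = 0" "\<And>s. (p has_real_derivative p' s) (at s)"
    and b: "\<And>s. 0 \<le> p' s" "\<And>s. p' s \<le> L" "\<And>s. \<bar>p s\<bar> \<le> B"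
  shows "lam * (LINT x|M. exp (u x) * (p (u x))^2) \<le> 2 * (LINT x|M. (p' (u x))^2 * energy (g x))"
    "integrable M (\<lambda>x. (p' (u x))^2 * energy (g x))"
proof -
  have pa: "\<bar>p' s\<bar> \<le> L" for s using b by simp
  have L0: "0 \<le> L" using b(1,2)[of 0] by linarith
  note S = compose_solution[OF p pa]
  have pm: "continuous_on UNIV p" using p(3) DERIV_isCont by (auto simp: continuous_on_eq_continuous_at)
  have [measurable]: "p \<in> borel_measurable borel" by (rule borel_measurable_continuous_onI[OF pm])
  obtain q where q: "smooth1 q" "\<And>s. (p has_real_derivative q s) (at s)" using smooth1_deriv[OF p(1)] by blast
  have "q = p'" using q(2) p(3) DERIV_unique by blast
  then have "isCont p' s" for s using smooth1_deriv[OF q(1)] DERIV_isCont by metis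
  then have pc': "continuous_on UNIV p'" by (simp add: continuous_on_eq_continuous_at)
  have [measurable]: "p' \<in> borel_measurable borel" by (rule borel_measurable_continuous_onI[OF pc'])
  \<comment> \<open>The bound \<open>p s \<le> L * s\<close> keeps \<open>u - t p(u)\<close>
    nonnegative when \<open>t * L \<le> 1\<close>, and \<open>0 \<le> p s\<close> keeps it below u,
    as \<open>gelfand_min\<close> requires.\<close>
  have pup: "0 \<le> p s" "p s \<le> L * s" if "s \<ge> 0" for s
  proof -
    have "p 0 \<le> p s" by (rule DERIV_nonneg_imp_nondecreasing[OF that]) (use p(3) b(1) in blast)
    then show "0 \<le> p s" using p(2) by simp
    have "L * 0 - p 0 \<le> L * s - p s"
    proof (rule DERIV_nonneg_imp_nondecreasing[OF that])
      fix x
      have "((\<lambda>s. L * s - p s) has_real_derivative L - p' x) (at x)"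
        by (rule derivative_eq_intros p(3) refl | simp)+
      then show "\<exists>y. ((\<lambda>s. L * s - p s) has_real_derivative y) (at x) \<and> 0 \<le> y" using b(2)[of x] by force
    qed
    then show "p s \<le> L * s" using p(2) by simp
  qed
  define A where "A n = (LINT x|M. exp (u x) * (p (u x))^n)" for n
  have AI: "integrable M (\<lambda>x. exp (u x) * (p (u x))^n)" for n
  proof (rule integrable_mult_bdd[OF exp_u_integrable])
    show "\<bar>(p (u x))^n\<bar> \<le> B^n" for x using b(3)[of "u x"] by (simp add: power_abs power_mono)
  qed measurable
  define H2 where "H2 = (LINT x|M. (p' (u x))^2 * energy (g x))"
  have EnI: "integrable M (\<lambda>x. energy (g x))" by (rule energy_int[OF W0_sq_int(2)[OF W0_u]])
  show H2I: "integrable M (\<lambda>x. (p' (u x))^2 * energy (g x))"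
  proof -
    have "integrable M (\<lambda>x. energy (g x) * (p' (u x))^2)"
    proof (rule integrable_mult_bdd[OF EnI])
      show "\<bar>(p' (u x))^2\<bar> \<le> L^2" for x using b(1,2)[of "u x"] by (simp add: power_mono)
    qed measurable
    then show ?thesis by (simp add: mult.commute)
  qed
  have G: "(LINT x|M. p' (u x) * energy (g x)) = lam * A 1 / 2" and GI: "integrable M (\<lambda>x. p' (u x) * energy (g x))"
  proof -
    have "integrable M (\<lambda>x. (1/2) * (2 * (p' (u x) * energy (g x))))" by (intro integrable_mult_right S(2))
    then show "integrable M (\<lambda>x. p' (u x) * energy (g x))" by simp
    show "(LINT x|M. p' (u x) * energy (g x)) = lam * A 1 / 2" using S(3) by (simp add: A_def)
  qed
  have key: "lam / 2 * A 2 \<le> H2 + t * (lam / 6 * A 3)" if t: "0 < t" "t * L \<le> 1" for t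
  proof -
    let ?w = "\<lambda>x. u x + (- t) * p (u x)" and ?h = "\<lambda>x. g x + (- t) *\<^sub>R (p' (u x) *\<^sub>R g x)"
    have sw: "W0 ?w ?h" by (rule W0_lin[OF W0_u S(1)])
    have w0: "AE x in M. 0 \<le> ?w x" "AE x in M. ?w x \<le> u x"
    proof -
      show "AE x in M. 0 \<le> ?w x" using u_nonneg
      proof eventually_elim
        case (elim x)
        have "t * p (u x) \<le> t * (L * u x)" using pup(2)[OF elim] t by (intro mult_left_mono) auto
        also have "\<dots> \<le> 1 * u x" using mult_right_mono[OF t(2) elim] by (simp add: mult.assoc)
        finally show ?case by simp
      qed
      show "AE x in M. ?w x \<le> u x" using u_nonneg by eventually_elim (use pup(1) t in simp)
    qed
    have J: "gelfand u g \<le> gelfand ?w ?h" by (rule gelfand_min[OF sw w0])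
    \<comment> \<open>2-homogeneity: the new gradient is \<open>1 - t * p' (u x)\<close> times the
      old one, so the expansion in t is exact and involves no derivative of the energy.\<close>
    have hE: "energy (?h x) = energy (g x) - 2 * t * (p' (u x) * energy (g x)) + t^2 * ((p' (u x))^2 * energy (g x))" for x
    proof -
      have "?h x = (1 - t * p' (u x)) *\<^sub>R g x" by (simp add: scaleR_left_diff_distrib)
      then have "energy (?h x) = (1 - t * p' (u x))^2 * energy (g x)" by (simp only: energy_scale)
      then show ?thesis by (simp add: power2_diff power_mult_distrib algebra_simps)
    qed
    have 1: "(LINT x|M. energy (?h x)) = (LINT x|M. energy (g x)) - 2 * t * (lam * A 1 / 2) + t^2 * H2"
      unfolding hE H2_def G[symmetric] using EnI GI H2I by simp
    have "(LINT x|M. exp (u x) - t * (exp (u x) * (p (u x))^1) + t^2 / 2 * (exp (u x) * (p (u x))^2) - t^3 / 6 * (exp (u x) * (p (u x))^3))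
       \<le> (LINT x|M. exp (?w x))"
    proof (rule integral_mono_AE)
      show "integrable M (\<lambda>x. exp (?w x))" by (rule exp_int_below[OF W0_meas(1)[OF sw] w0(2)])
      show "AE x in M. exp (u x) - t * (exp (u x) * (p (u x))^1) + t^2 / 2 * (exp (u x) * (p (u x))^2) - t^3 / 6 * (exp (u x) * (p (u x))^3) \<le> exp (?w x)"
        using u_nonneg
      proof eventually_elim
        case (elim x)
        have "0 \<le> t * p (u x)" using pup(1)[OF elim] t by simp
        from exp_neg_lower[OF this]
        have "exp (u x) * (1 - t * p (u x) + (t * p (u x))^2 / 2 - (t * p (u x))^3 / 6) \<le> exp (u x) * exp (- (t * p (u x)))"
          by (intro mult_left_mono) auto
        also have "\<dots> = exp (?w x)" by (simp add: exp_add[symmetric])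
        finally show ?case by (simp add: algebra_simps power_mult_distrib)
      qed
    qed (intro Bochner_Integration.integrable_add Bochner_Integration.integrable_diff integrable_mult_right exp_u_integrable AI)
    then have 2: "(LINT x|M. exp (u x)) - t * A 1 + t^2 / 2 * A 2 - t^3 / 6 * A 3 \<le> (LINT x|M. exp (?w x))"
      unfolding A_def using exp_u_integrable AI[of 1] AI[of 2] AI[of 3] by simp
    have "lam * ((LINT x|M. exp (u x)) - t * A 1 + t^2 / 2 * A 2 - t^3 / 6 * A 3) \<le> lam * (LINT x|M. exp (?w x))"
      using 2 lam by (intro mult_left_mono) auto
    then have "lam * (t^2 / 2 * A 2 - t^3 / 6 * A 3) \<le> t^2 * H2"
      using J 1 unfolding gelfand_def by (simp add: algebra_simps)
    then have "t^2 * (lam / 2 * A 2) \<le> t^2 * (H2 + t * (lam / 6 * A 3))"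
      by (simp add: algebra_simps power2_eq_square power3_eq_cube)
    then show ?thesis using t(1) by (simp only: mult_le_cancel_left_pos zero_less_power)
  qed
  \<comment> \<open>The denominator \<open>L + 1\<close> guarantees \<open>ts k * L \<le> 1\<close>
    and is positive even for \<open>L = 0\<close>.\<close>
  define ts where "ts k = 1 / (L + 1) * (1 / real (Suc k))" for k
  have ts: "0 < ts k" "ts k * L \<le> 1" for k
  proof -
    show "0 < ts k" using L0 by (simp add: ts_def)
    have "1 / (L + 1) * L \<le> 1" using L0 by (simp add: divide_simps)
    moreover have "1 / real (Suc k) \<le> 1" by simp
    ultimately have "(1 / (L + 1) * L) * (1 / real (Suc k)) \<le> 1 * 1" using L0 by (intro mult_mono) auto
    then show "ts k * L \<le> 1" by (simp add: ts_def mult_ac)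
  qed
  have "ts \<longlonglongrightarrow> 1 / (L + 1) * 0" unfolding ts_def
    by (intro tendsto_intros LIMSEQ_one_over_Suc)
  then have "(\<lambda>k. H2 + ts k * (lam / 6 * A 3)) \<longlonglongrightarrow> H2 + 0 * (lam / 6 * A 3)" by (intro tendsto_intros) simp
  then have "lam / 2 * A 2 \<le> H2 + 0 * (lam / 6 * A 3)"
    by (rule LIMSEQ_le_const) (use key[OF ts] in blast)
  then show "lam * (LINT x|M. exp (u x) * (p (u x))^2) \<le> 2 * (LINT x|M. (p' (u x))^2 * energy (g x))"
    by (simp add: A_def H2_def)
qed

text \<open>Here \<open>\<alpha> = 19 / 10 < 2\<close>, so \<open>e\<^sup>u\<close> lies in \<open>L\<^sup>q\<close> for \<open>q = 1 + 2\<alpha> = 24 / 5 > 9 / 2\<close>.\<close>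

lemma exp_tau_bound:
  assumes m: "m > 0"
  shows "(LINT x|M. exp (u x) * exp (19/5 * tau m (u x))) \<le> 1600 * (LINT x|M. exp (u x))"
    "integrable M (\<lambda>x. exp (u x) * exp (19/5 * tau m (u x)))"
proof -
  define \<alpha> :: real where "\<alpha> = 19/10"
  define p where "p s = 1 * exp (\<alpha> * tau m s) + (-1)" for s
  define p' where "p' s = 1 * \<alpha> * tau' m s * exp (\<alpha> * tau m s)" for s
  \<comment> \<open>Chosen with \<open>q 0 = 0\<close> and derivative \<alpha>^2 tau' e^(2\<alpha>
    tau). This dominates \<open>(p' s)^2\<close>, which has \<open>tau'\<close> squared, because
    \<open>tau'\<close> is at most 1.\<close>
  define q where "q s = \<alpha> / 2 * exp (2 * \<alpha> * tau m s) + (- \<alpha> / 2)" for s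
  define q' where "q' s = \<alpha> / 2 * (2 * \<alpha>) * tau' m s * exp (2 * \<alpha> * tau m s)" for s
  have eb: "exp (k * tau m s) \<le> exp (k * m)" if "k \<ge> 0" for k s
    using tau_bound[OF m, of s] that by (simp add: mult_left_mono abs_le_iff)
  have tb: "tau' m s * exp (k * tau m s) \<le> exp (k * m)" "0 \<le> tau' m s * exp (k * tau m s)" if "k \<ge> 0" for k s
  proof -
    have "tau' m s * exp (k * tau m s) \<le> 1 * exp (k * m)"
      using tau'_bounds[of m s] eb[OF that, of s] by (intro mult_mono) auto
    then show "tau' m s * exp (k * tau m s) \<le> exp (k * m)" by simp
    show "0 \<le> tau' m s * exp (k * tau m s)" using tau'_bounds[of m s] by simp
  qed
  have P: "smooth1 p" "p 0 = 0" "\<And>s. (p has_real_derivative p' s) (at s)"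
    unfolding p_def p'_def by (rule smooth1_exp_tau, simp, rule DERIV_exp_tau[OF m])
  have Q: "smooth1 q" "q 0 = 0" "\<And>s. (q has_real_derivative q' s) (at s)"
    unfolding q_def q'_def by (rule smooth1_exp_tau, simp, rule DERIV_exp_tau[OF m])
  have a0: "\<alpha> > 0" by (simp add: \<alpha>_def)
  have pb: "0 \<le> p' s" "p' s \<le> \<alpha> * exp (\<alpha> * m)" "\<bar>p s\<bar> \<le> exp (\<alpha> * m) + 1" for s
  proof -
    show "0 \<le> p' s" using tb(2)[of \<alpha> s] a0 by (simp add: p'_def mult.assoc)
    show "p' s \<le> \<alpha> * exp (\<alpha> * m)" using tb(1)[of \<alpha> s] a0 by (simp add: p'_def mult.assoc)
    show "\<bar>p s\<bar> \<le> exp (\<alpha> * m) + 1" using eb[of \<alpha> s] a0 exp_gt_zero[of "\<alpha> * tau m s"] unfolding p_def by linarith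
  qed
  have qb: "\<bar>q' s\<bar> \<le> \<alpha>^2 * exp (2 * \<alpha> * m)" for s
    using tb[of "2 * \<alpha>" s] a0 by (simp add: q'_def mult.assoc power2_eq_square abs_mult)
  have pq: "(p' s)^2 \<le> q' s" for s
  proof -
    have "(p' s)^2 = \<alpha>^2 * (tau' m s)^2 * exp (2 * \<alpha> * tau m s)"
      by (simp add: p'_def power_mult_distrib exp_double[symmetric] mult.assoc)
    also have "\<dots> \<le> \<alpha>^2 * tau' m s * exp (2 * \<alpha> * tau m s)"
      using tau'_bounds[of m s] by (intro mult_right_mono mult_left_mono) (auto simp: power2_eq_square mult_left_le_one_le)
    also have "\<dots> = q' s" by (simp add: q'_def power2_eq_square)
    finally show ?thesis .
  qed
  have S2: "lam * (LINT x|M. exp (u x) * (p (u x))^2) \<le> 2 * (LINT x|M. (p' (u x))^2 * energy (g x))"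
    and HI: "integrable M (\<lambda>x. (p' (u x))^2 * energy (g x))"
    by (rule second_variation[OF P pb])+
  note Qs = compose_solution[OF Q qb]
  have En0: "0 \<le> energy y" for y by (simp add: energy_def)
  have "2 * (LINT x|M. (p' (u x))^2 * energy (g x)) = (LINT x|M. 2 * ((p' (u x))^2 * energy (g x)))" by simp
  also have "\<dots> \<le> (LINT x|M. 2 * (q' (u x) * energy (g x)))"
  proof (rule integral_mono[OF _ Qs(2)])
    show "integrable M (\<lambda>x. 2 * ((p' (u x))^2 * energy (g x)))" using HI by simp
    show "2 * ((p' (u x))^2 * energy (g x)) \<le> 2 * (q' (u x) * energy (g x))" for x
      using mult_right_mono[OF pq En0] by simp
  qed
  also have "\<dots> = lam * (LINT x|M. exp (u x) * q (u x))" by (rule Qs(3))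
  finally have "lam * (LINT x|M. exp (u x) * (p (u x))^2) \<le> lam * (LINT x|M. exp (u x) * q (u x))"
    using S2 by simp
  then have main: "(LINT x|M. exp (u x) * (p (u x))^2) \<le> (LINT x|M. exp (u x) * q (u x))" using lam by simp
  have [measurable]: "tau m \<in> borel_measurable borel"
    using DERIV_tau[OF m] DERIV_isCont by (intro borel_measurable_continuous_onI) (auto simp: continuous_on_eq_continuous_at)
  have pI: "integrable M (\<lambda>x. exp (u x) * (p (u x))^2)"
  proof (rule integrable_mult_bdd[OF exp_u_integrable])
    show "\<bar>(p (u x))^2\<bar> \<le> (exp (\<alpha> * m) + 1)^2" for x
      using power_mono[OF pb(3)[of "u x"], of 2] by simp
  qed (unfold p_def, measurable)
  show XI: "integrable M (\<lambda>x. exp (u x) * exp (19/5 * tau m (u x)))"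
    by (rule integrable_mult_bdd[OF exp_u_integrable, of _ "exp (19/5 * m)"]) (use eb[of "19/5"] in auto)
  have "(LINT x|M. 1/40 * (exp (u x) * exp (19/5 * tau m (u x))) - 40 * exp (u x)) \<le> (LINT x|M. exp (u x) * (p (u x))^2 - exp (u x) * q (u x))"
  proof (rule integral_mono)
    fix x
    define X where "X = exp (\<alpha> * tau m (u x))"
    have X2: "exp (19/5 * tau m (u x)) = X^2" "exp (2 * \<alpha> * tau m (u x)) = X^2"
      by (simp_all add: X_def \<alpha>_def exp_double[symmetric])
    \<comment> \<open>For \<alpha> = 19/10 the bracket (X - 1)^2 - \<alpha>/2 (X^2 - 1) equals
      X^2/20 - 2X + 39/20. Half of the leading term is kept and the other half absorbs -2X at the
      cost of the constant 40; hence the final factor 1600 = 40 * 40.\<close>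
    have "0 \<le> (X - 40)^2 / 40 + 195/100" by simp
    also have "\<dots> = ((X - 1)^2 - (\<alpha> / 2 * X^2 - \<alpha> / 2)) - (X^2 / 40 - 40)"
      by (simp add: \<alpha>_def power2_diff field_simps)
    finally have "X^2 / 40 - 40 \<le> (X - 1)^2 - (\<alpha> / 2 * X^2 - \<alpha> / 2)" by simp
    then have "exp (u x) * (X^2 / 40 - 40) \<le> exp (u x) * ((X - 1)^2 - (\<alpha> / 2 * X^2 - \<alpha> / 2))" by (intro mult_left_mono) auto
    then show "1/40 * (exp (u x) * exp (19/5 * tau m (u x))) - 40 * exp (u x) \<le> exp (u x) * (p (u x))^2 - exp (u x) * q (u x)"
      unfolding p_def q_def X2 X_def[symmetric] by (simp add: algebra_simps)
  qed (use XI exp_u_integrable pI Qs(4) in auto)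
  also have "\<dots> \<le> 0" using main pI Qs(4) by simp
  finally show "(LINT x|M. exp (u x) * exp (19/5 * tau m (u x))) \<le> 1600 * (LINT x|M. exp (u x))"
    using XI exp_u_integrable by simp
qed

text \<open>Fatou's lemma removes the truncation, and the remaining integral of
  \<open>exp (u x)\<close> is absorbed into the left-hand side, so that only the measure of the
  domain is left.\<close>

lemma exp_Lp:
  "integrable M (\<lambda>x. exp (24/5 * u x))" "(LINT x|M. exp (24/5 * u x)) \<le> 10240000 * measure M (space M)"
proof -
  have 1: "integrable M (\<lambda>x. exp (u x) * exp (19/5 * tau (real (Suc k)) (u x)))"
    "(LINT x|M. exp (u x) * exp (19/5 * tau (real (Suc k)) (u x))) \<le> 1600 * (LINT x|M. exp (u x))" for k
    using exp_tau_bound[of "real (Suc k)"] by auto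
  have 2: "AE x in M. 0 \<le> exp (u x) * exp (19/5 * tau (real (Suc k)) (u x))" for k by simp
  have 3: "(\<lambda>x. exp (24/5 * u x)) \<in> borel_measurable M" by measurable
  have 4: "AE x in M. (\<lambda>k. exp (u x) * exp (19/5 * tau (real (Suc k)) (u x))) \<longlonglongrightarrow> exp (24/5 * u x)"
  proof (rule AE_I2)
    fix x
    have "(\<lambda>k. exp (u x) * exp (19/5 * tau (real (Suc k)) (u x))) \<longlonglongrightarrow> exp (u x) * exp (19/5 * u x)"
      by (intro tendsto_intros tau_lim)
    then show "(\<lambda>k. exp (u x) * exp (19/5 * tau (real (Suc k)) (u x))) \<longlonglongrightarrow> exp (24/5 * u x)"
      by (simp add: exp_add[symmetric] algebra_simps)
  qed
  show I: "integrable M (\<lambda>x. exp (24/5 * u x))" by (rule fatou_bound(1)[OF 1(1) 2 1(2) 3 4])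
  have le: "(LINT x|M. exp (24/5 * u x)) \<le> 1600 * (LINT x|M. exp (u x))" by (rule fatou_bound(2)[OF 1(1) 2 1(2) 3 4])
  \<comment> \<open>The threshold is 2 * 1600, so that 1600 / 3200 = 1/2 of the left-hand side is
    absorbed; the constant is 2 * 1600 * 3200 = 10240000.\<close>
  have "(LINT x|M. exp (u x)) \<le> (LINT x|M. 3200 + exp (24/5 * u x) / 3200)"
  proof (rule integral_mono_AE[OF exp_u_integrable])
    show "AE x in M. exp (u x) \<le> 3200 + exp (24/5 * u x) / 3200"
      using u_nonneg
    proof eventually_elim
      case (elim x)
      show ?case
      proof (cases "exp (u x) \<le> 3200")
        case True
        then show ?thesis using exp_gt_zero[of "24/5 * u x"] by (simp add: add_increasing2)
      next
        case False
        have "3200 * exp (u x) \<le> exp (u x) * exp (u x)" using False by (intro mult_right_mono) auto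
        also have "\<dots> = exp (2 * u x)" by (simp add: exp_add[symmetric])
        also have "\<dots> \<le> exp (24/5 * u x)" using elim by simp
        finally show ?thesis by simp
      qed
    qed
  qed (use I in simp)
  also have "\<dots> = 3200 * measure M (space M) + (LINT x|M. exp (24/5 * u x)) / 3200" using I by simp
  finally show "(LINT x|M. exp (24/5 * u x)) \<le> 10240000 * measure M (space M)" using le by simp
qed

end

section \<open>Boundedness\<close>

text \<open>Along the levels \<open>D * (1 - (1/2)^j)\<close> the values of \<mu> decay
  geometrically: the superlinear power on the right gains more than the halved level gaps lose. All
  these levels lie below \<open>D\<close>.\<close>

lemma stampacchia_iteration:
  fixes \<mu> :: "real \<Rightarrow> real"
  assumes step: "\<And>h k. 0 \<le> k \<Longrightarrow> k < h \<Longrightarrow> (h - k) * \<mu> h \<le> C * \<mu> k powr (1 + \<delta>)"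
    and nn: "\<And>k. 0 \<le> \<mu> k" and anti: "\<And>h k. k \<le> h \<Longrightarrow> \<mu> h \<le> \<mu> k"
    and m0: "\<mu> 0 \<le> m0" "0 < m0" and C: "0 < C" and \<delta>: "0 < \<delta>"
  shows "\<mu> (2 powr (1 + 1 / \<delta>) * C * m0 powr \<delta>) = 0"
proof -
  define D where "D = 2 powr (1 + 1 / \<delta>) * C * m0 powr \<delta>"
  have D: "D > 0" using C m0 by (simp add: D_def)
  \<comment> \<open>The decay rate satisfies r^\<delta> = 1/2, which matches the halving of the
    gaps, and the factor in \<open>D\<close> gives \<open>D * r = 2 * C * m0 powr \<delta>\<close>,
    which closes the induction.\<close>
  define r where "r = 2 powr (- (1 / \<delta>))"
  have r: "0 < r" "r < 1"
    using \<delta> by (auto simp: r_def powr_less_one)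
  have rd: "r powr \<delta> = 1 / 2" unfolding r_def powr_powr using \<delta> by (simp add: powr_minus_divide)
  define k where "k j = D * (1 - (1/2)^j)" for j :: nat
  have k0: "0 \<le> k j" for j using D by (simp add: k_def power_le_one)
  have kd: "k (Suc j) - k j = D * (1/2)^Suc j" for j by (simp add: k_def algebra_simps)
  have main: "\<mu> (k j) \<le> m0 * r^j" for j
  proof (induction j)
    case 0
    then show ?case using m0 by (simp add: k_def)
  next
    case (Suc j)
    have lt: "k j < k (Suc j)" using kd[of j] D by (smt (verit) zero_less_power mult_pos_pos half_gt_zero_iff zero_less_one)
    have "(D * (1/2)^Suc j) * \<mu> (k (Suc j)) \<le> C * \<mu> (k j) powr (1 + \<delta>)"
      using step[OF k0 lt] by (simp only: kd)
    also have "\<dots> \<le> C * (m0 * r^j) powr (1 + \<delta>)"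
      using C Suc.IH nn \<delta> by (intro mult_left_mono powr_mono2) auto
    also have "(m0 * r^j) powr (1 + \<delta>) = (m0 * r^j) * (m0 powr \<delta> * (1/2)^j)"
    proof -
      have "(r^j) powr \<delta> = (r powr \<delta>)^j" using r by (simp add: powr_realpow[symmetric] powr_powr mult.commute)
      then have "(m0 * r^j) powr \<delta> = m0 powr \<delta> * (1/2)^j" using m0 r rd by (simp add: powr_mult)
      then show ?thesis using m0 r by (simp add: powr_add)
    qed
    also have "C * ((m0 * r^j) * (m0 powr \<delta> * (1/2)^j)) = (D * (1/2)^Suc j) * (m0 * r^Suc j)"
    proof -
      have "2 powr (1 + 1 / \<delta>) * r = 2" by (simp add: r_def powr_add[symmetric])
      then have "D * r = 2 * C * m0 powr \<delta>" unfolding D_def by (simp add: mult_ac)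
      then have "C * m0 powr \<delta> = D * r / 2" by simp
      then show ?thesis by (simp add: mult_ac)
    qed
    finally show ?case using D by (simp add: mult_le_cancel_left_pos)
  qed
  have "\<mu> D \<le> m0 * r^j" for j
    using main[of j] anti[of "k j" D] D by (simp add: k_def mult_le_cancel_left1 order_trans)
  moreover have "(\<lambda>j. m0 * r^j) \<longlonglongrightarrow> m0 * 0" using r by (intro tendsto_intros LIMSEQ_realpow_zero) auto
  ultimately have "\<mu> D \<le> 0" using LIMSEQ_le_const[of "\<lambda>j. m0 * r^j" "m0 * 0" "\<mu> D"] by auto
  then show ?thesis using nn[of D] unfolding D_def by simp
qed

text \<open>The first term covers the case exp y \<le> K, the second the opposite case. A suitable
  choice of K later yields the effect of Hoelder's inequality.\<close>

lemma exp_interp: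
  fixes y K r p :: real
  assumes K: "K > 0" and r: "r \<le> p" "r \<ge> 0"
  shows "exp (r * y) \<le> K powr r + exp (p * y) * K powr (r - p)"
proof (cases "exp y \<le> K")
  case True
  have "exp (r * y) = exp y powr r" by (simp add: powr_def)
  also have "\<dots> \<le> K powr r" using True r by (intro powr_mono2) auto
  finally show ?thesis by (simp add: add_increasing2)
next
  case False
  have "exp (r * y) = exp (p * y) * exp ((r - p) * y)" by (simp add: exp_add[symmetric] algebra_simps)
  also have "exp ((r - p) * y) = exp y powr (r - p)" by (simp add: powr_def)
  also have "exp y powr (r - p) \<le> K powr (r - p)" using False r K by (intro powr_mono2') auto
  finally show ?thesis by (simp add: add_increasing mult_left_mono)
qed

section \<open>Decay of the measure of the superlevel sets\<close>

context minimal_solution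
begin

definition superlevel :: "real \<Rightarrow> (real^'n) set" where "superlevel k = {x \<in> space M. k < u x}"
definition superlevel_measure :: "real \<Rightarrow> real" where "superlevel_measure k = measure M (superlevel k)"

lemma superlevel_sets [measurable]: "superlevel k \<in> sets M" unfolding superlevel_def by measurable

lemma superlevel_Int [simp]: "superlevel k \<inter> \<Omega> = superlevel k" by (auto simp: superlevel_def)

lemma superlevel_measure_antimono: "k \<le> h \<Longrightarrow> superlevel_measure h \<le> superlevel_measure k"
  unfolding superlevel_measure_def by (rule fin.finite_measure_mono[OF _ superlevel_sets]) (auto simp: superlevel_def)

lemma superlevel_measure_nonneg: "0 \<le> superlevel_measure k" by (simp add: superlevel_measure_def)

text \<open>The threshold \<open>K\<close> is the measure of the level set to the power -1/q with q
  = 24/5. It gives the two terms of \<open>exp_interp\<close> the same power 1 - r/q of that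
  measure.\<close>

lemma level_exp:
  assumes r: "0 \<le> r" "r \<le> 24/5" and m: "superlevel_measure k > 0"
  shows "integrable M (\<lambda>x. indicator (superlevel k) x * exp (r * u x))"
    "(LINT x|M. indicator (superlevel k) x * exp (r * u x)) \<le> (1 + (LINT x|M. exp (24/5 * u x))) * superlevel_measure k powr (1 - 5/24 * r)"
proof -
  define K where "K = superlevel_measure k powr (- (5/24))"
  have K: "K > 0" using m by (simp add: K_def)
  define A where "A = (LINT x|M. exp (24/5 * u x))"
  have pt: "indicator (superlevel k) x * exp (r * u x) \<le> K powr r * indicator (superlevel k) x + K powr (r - 24/5) * exp (24/5 * u x)" for x
    using exp_interp[OF K r(2,1), of "u x"] by (cases "x \<in> superlevel k") (auto simp: mult.commute)
  have I: "integrable M (\<lambda>x. K powr r * indicator (superlevel k) x + K powr (r - 24/5) * exp (24/5 * u x))"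
    using exp_Lp(1) by (intro Bochner_Integration.integrable_add integrable_mult_right integrable_real_indicator) (auto simp: fin.emeasure_finite less_top[symmetric])
  show J: "integrable M (\<lambda>x. indicator (superlevel k) x * exp (r * u x))"
  proof (rule Bochner_Integration.integrable_bound[OF I])
    show "AE x in M. norm (indicator (superlevel k) x * exp (r * u x)) \<le> norm (K powr r * indicator (superlevel k) x + K powr (r - 24/5) * exp (24/5 * u x))"
    proof (rule AE_I2)
      fix x
      have "0 \<le> indicator (superlevel k) x * exp (r * u x)" by simp
      then show "norm (indicator (superlevel k) x * exp (r * u x)) \<le> norm (K powr r * indicator (superlevel k) x + K powr (r - 24/5) * exp (24/5 * u x))"
        using pt[of x] by (simp only: real_norm_def)
    qed
  qed measurable
  have "(LINT x|M. indicator (superlevel k) x * exp (r * u x)) \<le> (LINT x|M. K powr r * indicator (superlevel k) x + K powr (r - 24/5) * exp (24/5 * u x))"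
    by (rule integral_mono[OF J I pt])
  also have "\<dots> = K powr r * superlevel_measure k + K powr (r - 24/5) * A"
  proof -
    have "(LINT x|M. indicator (superlevel k) x) = superlevel_measure k" using fin.emeasure_finite by (simp add: superlevel_measure_def)
    moreover have "integrable M (\<lambda>x. indicator (superlevel k) x :: real)"
      by (intro integrable_real_indicator) (auto simp: fin.emeasure_finite less_top[symmetric])
    ultimately show ?thesis using exp_Lp(1) by (simp add: A_def)
  qed
  also have "K powr r * superlevel_measure k = superlevel_measure k powr (1 - 5/24 * r)"
  proof -
    have "K powr r * superlevel_measure k = superlevel_measure k powr (- (5/24) * r) * superlevel_measure k powr 1" using m by (simp add: K_def powr_powr)
    also have "\<dots> = superlevel_measure k powr (1 - 5/24 * r)" by (subst powr_add[symmetric]) (simp add: algebra_simps)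
    finally show ?thesis .
  qed
  also have "K powr (r - 24/5) = superlevel_measure k powr (1 - 5/24 * r)" by (simp add: K_def powr_powr algebra_simps)
  finally show "(LINT x|M. indicator (superlevel k) x * exp (r * u x)) \<le> (1 + (LINT x|M. exp (24/5 * u x))) * superlevel_measure k powr (1 - 5/24 * r)"
    by (simp add: A_def algebra_simps)
qed

text \<open>The interpolation exponent \<open>\<beta> = 43 / 200\<close> satisfies \<open>1 / q = 5 / 24 < \<beta> < 2 / 9\<close>: the upper bound makes the
  Sobolev constant finite for \<open>N \<le> 9\<close>, and the gain in the exponent is \<open>\<beta> - 1 / q = 1 / 150\<close>.\<close>

lemma level_step:
  assumes N: "CARD('n) \<le> 9" and k: "0 \<le> k" "k < h"
  shows "(h - k) * superlevel_measure h \<le> (lam * (sobolev_const (43/200))^2 / a^2 * (1 + (LINT x|M. exp (24/5 * u x)))) * superlevel_measure k powr (1 + 1/150)"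
proof (cases "superlevel_measure k = 0")
  case True
  then have "superlevel_measure h = 0" using superlevel_measure_antimono[of k h] superlevel_measure_nonneg[of h] k by simp
  then show ?thesis using True by simp
next
  case False
  define m where "m = superlevel_measure k"
  have m: "m > 0" using False superlevel_measure_nonneg[of k] by (simp add: m_def)
  define \<beta> :: real where "\<beta> = 43/200"
  have b: "0 < \<beta>" "\<beta> < 1" "real CARD('n) * \<beta> / 2 < 1"
  proof -
    have "real CARD('n) * \<beta> \<le> 9 * \<beta>" using N by (intro mult_right_mono) (auto simp: \<beta>_def)
    then show "real CARD('n) * \<beta> / 2 < 1" by (simp add: \<beta>_def)
  qed (auto simp: \<beta>_def)
  define K where "K = sobolev_const \<beta>"
  have K: "K \<ge> 0" unfolding K_def by (rule sobolev_const_nonneg[OF b(3)])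
  define A where "A = (LINT x|M. exp (24/5 * u x))"
  have A: "A \<ge> 0" unfolding A_def by (intro integral_nonneg_AE) simp
  let ?v = "\<lambda>x. max (u x - k) 0" and ?gv = "\<lambda>x. heaviside k (u x) *\<^sub>R g x"
  have sv: "W0 ?v ?gv" by (rule W0_pos[OF W0_u k(1)])
  define G where "G = sqrt (sq_norm M ?gv)"
  have G: "G \<ge> 0" "G^2 = sq_norm M ?gv" by (auto simp: G_def)
  \<comment> \<open>The first weight is the right-hand side restricted to the level set.
    \<open>level_exp\<close> with r = 2 and r = 1 gives the powers 7/12 = 1 - 10/24 and 19/24 = 1 -
    5/24 of the measure.\<close>
  define w where "w x = indicator (superlevel k) x * exp (u x)" for x
  have wm [measurable]: "w \<in> borel_measurable M" unfolding w_def by measurable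
  have w0: "0 \<le> w x" for x by (simp add: w_def)
  have w2: "(norm (w x))^2 = indicator (superlevel k) x * exp (2 * u x)" for x
    by (cases "x \<in> superlevel k") (auto simp: w_def exp_double)
  have mk: "superlevel_measure k > 0" using m by (simp add: m_def)
  note L2' = level_exp[of 2, OF _ _ mk]
  note L1' = level_exp[of 1, OF _ _ mk]
  have sw: "sq_int M w" unfolding sq_int_def w2 using L2'(1) by auto
  have n2w: "sq_norm M w \<le> (1 + A) * m powr (7/12)" unfolding sq_norm_def w2 using L2'(2) by (simp add: A_def m_def)
  have i1w: "(LINT x|M. w x) \<le> (1 + A) * m powr (19/24)" unfolding w_def using L1'(2) by (simp add: A_def m_def)
  have i1w0: "0 \<le> (LINT x|M. w x)" using w0 by (intro integral_nonneg_AE) simp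
  have fac: "sqrt (sq_norm M w) powr (1 - \<beta>) * (LINT x|M. w x) powr \<beta> \<le> (1 + A) * m powr (7/24 + \<beta> / 2)"
  proof -
    have "sqrt (sq_norm M w) \<le> sqrt ((1 + A) * m powr (7/12))" using n2w by simp
    also have "\<dots> = (1 + A) powr (1/2) * m powr (7/24)"
      using A m by (simp add: powr_half_sqrt[symmetric] powr_mult powr_powr)
    finally have "sqrt (sq_norm M w) powr (1 - \<beta>) \<le> ((1 + A) powr (1/2) * m powr (7/24)) powr (1 - \<beta>)"
      using b by (intro powr_mono2) auto
    also have "\<dots> = (1 + A) powr ((1 - \<beta>) / 2) * m powr (7/24 * (1 - \<beta>))"
      by (simp add: powr_mult powr_powr)
    finally have 1: "sqrt (sq_norm M w) powr (1 - \<beta>) \<le> (1 + A) powr ((1 - \<beta>) / 2) * m powr (7/24 * (1 - \<beta>))" .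
    have "(LINT x|M. w x) powr \<beta> \<le> ((1 + A) * m powr (19/24)) powr \<beta>"
      using i1w i1w0 b by (intro powr_mono2) auto
    also have "\<dots> = (1 + A) powr \<beta> * m powr (19/24 * \<beta>)" using A by (simp add: powr_mult powr_powr)
    finally have 2: "(LINT x|M. w x) powr \<beta> \<le> (1 + A) powr \<beta> * m powr (19/24 * \<beta>)" .
    have "sqrt (sq_norm M w) powr (1 - \<beta>) * (LINT x|M. w x) powr \<beta>
      \<le> ((1 + A) powr ((1 - \<beta>) / 2) * m powr (7/24 * (1 - \<beta>))) * ((1 + A) powr \<beta> * m powr (19/24 * \<beta>))"
      using 1 2 by (intro mult_mono) auto
    also have "\<dots> = (1 + A) powr ((1 - \<beta>) / 2 + \<beta>) * m powr (7/24 * (1 - \<beta>) + 19/24 * \<beta>)"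
      by (simp add: powr_add mult_ac)
    also have "7/24 * (1 - \<beta>) + 19/24 * \<beta> = 7/24 + \<beta> / 2" by (simp add: field_simps)
    also have "(1 + A) powr ((1 - \<beta>) / 2 + \<beta>) * m powr (7/24 + \<beta> / 2) \<le> (1 + A) * m powr (7/24 + \<beta> / 2)"
    proof (rule mult_right_mono)
      have "(1 + A) powr ((1 - \<beta>) / 2 + \<beta>) \<le> (1 + A) powr 1" using A by (intro powr_mono) (auto simp: \<beta>_def)
      then show "(1 + A) powr ((1 - \<beta>) / 2 + \<beta>) \<le> 1 + A" using A by simp
    qed simp
    finally show ?thesis .
  qed
  \<comment> \<open>The equation tested with the part of u above k. The square of
    \<open>heaviside\<close> is at most \<open>heaviside\<close>, so the flux integral controls the
    gradient of the truncated function.\<close>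
  have energy: "a^2 * G^2 \<le> lam * (K * (sqrt (sq_norm M w) powr (1 - \<beta>) * (LINT x|M. w x) powr \<beta> * G))"
  proof -
    have "a^2 * G^2 = (LINT x|M. a^2 * (norm (?gv x))^2)" by (simp add: G sq_norm_def)
    also have "\<dots> \<le> (LINT x|M. flux (g x) \<bullet> ?gv x)"
    proof (rule integral_mono)
      show "integrable M (\<lambda>x. a^2 * (norm (?gv x))^2)" using sq_int_int[OF W0_sq_int(2)[OF sv]] by simp
      show "integrable M (\<lambda>x. flux (g x) \<bullet> ?gv x)" by (rule sq_int_inner_int[OF flux_sq_int[OF W0_sq_int(2)[OF W0_u]] W0_sq_int(2)[OF sv]])
      fix x
      have c: "0 \<le> heaviside k (u x)" "heaviside k (u x) \<le> 1" by (rule heaviside_bounds)+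
      have e: "a^2 * (norm (g x))^2 \<le> (F (g x))^2" using energy_bounds(1)[of "g x"] by (simp add: energy_def)
      have "a^2 * (norm (?gv x))^2 = (heaviside k (u x))^2 * (a^2 * (norm (g x))^2)" by (simp add: power_mult_distrib)
      also have "\<dots> \<le> heaviside k (u x) * (F (g x))^2"
        using c e by (intro mult_mono) (auto simp: power2_eq_square mult_left_le_one_le)
      also have "\<dots> = flux (g x) \<bullet> ?gv x" by (simp add: flux_self)
      finally show "a^2 * (norm (?gv x))^2 \<le> flux (g x) \<bullet> ?gv x" .
    qed
    also have "\<dots> = (LINT x|M. lam * exp (u x) * ?v x)" by (rule solves_eq[OF u_solves sv])
    also have "\<dots> = (LINT x|M. lam * (w x * \<bar>?v x\<bar>))"
    proof (rule Bochner_Integration.integral_cong[OF refl])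
      fix x assume "x \<in> space M"
      then show "lam * exp (u x) * ?v x = lam * (w x * \<bar>?v x\<bar>)"
        by (cases "x \<in> superlevel k") (auto simp: w_def superlevel_def)
    qed
    also have "\<dots> = lam * (LINT x|M. w x * \<bar>?v x\<bar>)" by simp
    also have "\<dots> \<le> lam * (K * (sqrt (sq_norm M w) powr (1 - \<beta>) * (LINT x|M. w x) powr \<beta> * G))"
      unfolding K_def G_def using lam by (intro mult_left_mono W0_weight2[OF sv sw w0 b]) auto
    finally show ?thesis .
  qed
  have Gle: "G \<le> lam * K / a^2 * ((1 + A) * m powr (7/24 + \<beta> / 2))"
  proof (cases "G = 0")
    case True
    then show ?thesis using lam K A by simp
  next
    case False
    then have Gp: "G > 0" using G(1) by simp
    have "(a^2 * G) * G \<le> (lam * (K * (sqrt (sq_norm M w) powr (1 - \<beta>) * (LINT x|M. w x) powr \<beta>))) * G"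
      using energy by (simp add: power2_eq_square mult_ac)
    then have "a^2 * G \<le> lam * (K * (sqrt (sq_norm M w) powr (1 - \<beta>) * (LINT x|M. w x) powr \<beta>))"
      using Gp by (rule mult_right_le_imp_le)
    also have "\<dots> \<le> lam * (K * ((1 + A) * m powr (7/24 + \<beta> / 2)))"
      using fac lam K by (intro mult_left_mono) auto
    finally show ?thesis using ab_pos(1) by (simp add: field_simps)
  qed
  \<comment> \<open>A second use of the weighted inequality, now with the indicator of the level set
    as weight, turns the gradient bound into a bound for the integral of the part above k, which is
    at least \<open>h - k\<close> on the higher level set.\<close>
  define w1 :: "real^'n \<Rightarrow> real" where "w1 x = indicator (superlevel k) x" for x
  have w1I: "integrable M w1" "(LINT x|M. w1 x) = m"
    unfolding w1_def by (auto simp: fin.emeasure_finite less_top[symmetric] m_def superlevel_measure_def intro!: integrable_real_indicator)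
  have w1sq: "(norm (w1 x))^2 = w1 x" for x by (simp add: w1_def indicator_def)
  have sw1: "sq_int M w1" "sq_norm M w1 = m" unfolding sq_int_def sq_norm_def w1sq using w1I by auto
  have w1n: "0 \<le> w1 x" for x by (simp add: w1_def)
  have vI: "integrable M (\<lambda>x. w1 x * \<bar>?v x\<bar>)"
    using sq_int_mult_int[OF sw1(1) W0_sq_int(1)[OF sv]] w1n by simp
  have "(h - k) * superlevel_measure h = (LINT x|M. (h - k) * indicator (superlevel h) x)" by (simp add: superlevel_measure_def)
  also have "\<dots> \<le> (LINT x|M. w1 x * \<bar>?v x\<bar>)"
  proof (rule integral_mono[OF _ vI])
    show "integrable M (\<lambda>x. (h - k) * indicator (superlevel h) x)"
      by (intro integrable_mult_right integrable_real_indicator) (auto simp: fin.emeasure_finite less_top[symmetric])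
    show "(h - k) * indicator (superlevel h) x \<le> w1 x * \<bar>?v x\<bar>" for x
      using k(2) by (auto simp: w1_def superlevel_def indicator_def)
  qed
  also have "\<dots> \<le> K * (sqrt m powr (1 - \<beta>) * m powr \<beta> * G)"
    using W0_weight2[OF sv sw1(1) w1n b] by (simp add: K_def sw1(2) w1I(2) G_def)
  also have "sqrt m powr (1 - \<beta>) * m powr \<beta> = m powr (1/2 + \<beta> / 2)"
  proof -
    have "sqrt m powr (1 - \<beta>) = m powr (1/2 * (1 - \<beta>))" using m by (simp add: powr_half_sqrt[symmetric] powr_powr)
    then show ?thesis by (simp add: powr_add[symmetric] field_simps)
  qed
  also have "K * (m powr (1/2 + \<beta> / 2) * G) \<le> K * (m powr (1/2 + \<beta> / 2) * (lam * K / a^2 * ((1 + A) * m powr (7/24 + \<beta> / 2))))"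
    using Gle K by (intro mult_left_mono) auto
  also have "\<dots> = (lam * K^2 / a^2 * (1 + A)) * (m powr (1/2 + \<beta> / 2) * m powr (7/24 + \<beta> / 2))"
    by (simp add: power2_eq_square mult_ac)
  \<comment> \<open>The exponents add up to 19/24 + \<beta> = 1 + (\<beta> - 5/24).\<close>
  also have "m powr (1/2 + \<beta> / 2) * m powr (7/24 + \<beta> / 2) = m powr (1 + 1/150)"
    by (subst powr_add[symmetric]) (simp add: \<beta>_def)
  finally show ?thesis by (simp add: K_def \<beta>_def A_def m_def)
qed

text \<open>The bound involves \<open>lmax\<close>, \<open>a\<close> and the domain, but neither u
  nor \<open>lam\<close>; this makes it uniform along the sequence. The added ones ensure the
  positivity demanded by the iteration lemma.\<close>

lemma u_bound:
  assumes N: "CARD('n) \<le> 9" and lb: "lam \<le> lmax"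
  shows "AE x in M. u x \<le> 2 powr (1 + 1 / (1/150)) *
    (lmax * (sobolev_const (43/200))^2 / a^2 * (1 + 10240000 * measure M (space M)) + 1) * (measure M (space M) + 1) powr (1/150)"
    (is "AE x in M. u x \<le> 2 powr (1 + 1 / (1/150)) * ?C * ?m powr (1/150)")
proof -
  let ?D = "2 powr (1 + 1 / (1/150)) * ?C * ?m powr (1/150)"
  have Cpos: "?C > 0" using lam lb by (intro add_nonneg_pos mult_nonneg_nonneg divide_nonneg_nonneg) auto
  have A0: "0 \<le> (LINT x|M. exp (24/5 * u x))" by (intro integral_nonneg_AE) simp
  have "superlevel_measure ?D = 0"
  proof (rule stampacchia_iteration)
    fix h k :: real assume k: "0 \<le> k" "k < h"
    have "(lam * (sobolev_const (43/200))^2 / a^2 * (1 + (LINT x|M. exp (24/5 * u x)))) \<le> lmax * (sobolev_const (43/200))^2 / a^2 * (1 + 10240000 * measure M (space M))"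
      using lam lb exp_Lp(2) A0 by (intro mult_mono divide_right_mono add_left_mono) auto
    then have "(lam * (sobolev_const (43/200))^2 / a^2 * (1 + (LINT x|M. exp (24/5 * u x)))) * superlevel_measure k powr (1 + 1/150) \<le> ?C * superlevel_measure k powr (1 + 1/150)"
      by (intro mult_right_mono) auto
    with level_step[OF N k] show "(h - k) * superlevel_measure h \<le> ?C * superlevel_measure k powr (1 + 1/150)" by linarith
  next
    have "superlevel_measure 0 \<le> measure M (space M)" unfolding superlevel_measure_def by (rule fin.finite_measure_mono) (auto simp: superlevel_def)
    then show "superlevel_measure 0 \<le> ?m" by simp
    show "0 < ?m" by (simp add: add_nonneg_pos)
  qed (use Cpos superlevel_measure_nonneg superlevel_measure_antimono in auto)
  then have "emeasure M (superlevel ?D) = 0" by (simp add: superlevel_measure_def fin.emeasure_eq_measure)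
  then have "superlevel ?D \<in> null_sets M" using superlevel_sets by blast
  from AE_not_in[OF this] show ?thesis
    by (rule AE_mp) (auto simp: superlevel_def not_less)
qed

end

section \<open>From the given definitions to the bound for the extremal solution\<close>

context finsler_domain
begin

text \<open>The function vanishes almost everywhere, hence is the L2 limit of the constant sequence
  0 and admits the gradient 0. This is the boundary condition in
  \<open>weak_supersol\<close>.\<close>

lemma W0_min_zero:
  assumes z: "W0 z h" "AE x in M. 0 \<le> z x"
  shows "W0 (\<lambda>x. min (z x) 0) (\<lambda>x. 0)"
proof -
  note [measurable] = W0_meas(1)[OF z(1)]
  have ae: "AE x in M. min (z x) 0 = 0" using z(2) by eventually_elim simp
  have s: "sq_int M (\<lambda>x. min (z x) 0)"
    by (rule sq_int_bound[OF W0_sq_int(1)[OF z(1)], of _ 1]) (use ae in auto)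
  have "sq_norm M (\<lambda>x. 0 - min (z x) 0) = 0"
    unfolding sq_norm_def using ae by (intro integral_eq_zero_AE) auto
  then show ?thesis by (intro W0_limit[OF W0_zero s sq_int_zero]) (simp_all add: sq_norm_def)
qed

text \<open>A nonnegative solution tested with \<open>W0\<close> functions is in particular a weak
  supersolution, so minimality among supersolutions yields the comparison property of the
  locale.\<close>

lemma minimal_sol_imp_minimal_solution:
  assumes l: "lam > 0" and m: "minimal_sol \<Omega> F lam u"
  obtains g C where "minimal_solution \<Omega> F a b \<mu> \<Lambda> lam u g C"
proof -
  obtain g where g: "W012 \<Omega> u g" "integrable M (\<lambda>x. exp (u x))"
    "\<And>\<phi>. test_fun \<Omega> \<phi> \<Longrightarrow> (LINT x|M. Qflux F (g x) (grad \<phi> x)) = lam * (LINT x|M. exp (u x) * \<phi> x)"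
    using m unfolding minimal_sol_def weak_sol_def by blast
  have s: "W0 u g" by (rule W012_imp_W0[OF g(1)])
  have eq: "(LINT x|M. flux (g x) \<bullet> grad \<phi> x) = (LINT x|M. (lam * exp (u x)) * \<phi> x)" if "test_fun \<Omega> \<phi>" for \<phi>
    using g(3)[OF that] by (simp add: Qflux_eq mult.assoc)
  obtain C where C: "dual (\<lambda>x. lam * exp (u x)) C" "solves u g (\<lambda>x. lam * exp (u x))"
    using solves_of_test[OF s, of "\<lambda>x. lam * exp (u x)"] g(2) l eq by auto
  have "minimal_solution \<Omega> F a b \<mu> \<Lambda> lam u g C"
  proof (rule minimal_solution.intro[OF finsler_domain_axioms], rule minimal_solution_axioms.intro)
    fix z h
    assume z: "solves z h (\<lambda>x. lam * exp (z x))" "integrable M (\<lambda>x. exp (z x))" "AE x in M. 0 \<le> z x"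
    have sz: "W0 z h" by (rule solves_imp_W0[OF z(1)])
    have "weak_supersol \<Omega> F lam z"
      unfolding weak_supersol_def
    proof (rule exI[of _ h], intro conjI allI impI)
      show "weak_grad \<Omega> z h" using W0_imp_W012[OF sz] by (simp add: W012_def)
      show "integrable M (\<lambda>x. exp (z x))" by (rule z(2))
      show "\<exists>h. W012 \<Omega> (\<lambda>x. min (z x) 0) h" using W0_imp_W012[OF W0_min_zero[OF sz z(3)]] by blast
      fix \<phi> assume "test_fun \<Omega> \<phi>"
      from solves_eq[OF z(1) W0_test[OF this]]
      show "lam * (LINT x|M. exp (z x) * \<phi> x) \<le> (LINT x|M. Qflux F (h x) (grad \<phi> x))"
        by (simp add: Qflux_eq mult.assoc)
    qed
    then show "AE x in M. u x \<le> z x" using m by (simp add: minimal_sol_def)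
  qed (use l C in auto)
  then show thesis by (rule that)
qed

end

theorem theorem1p4:
  fixes \<Omega> :: "(real^'n::finite) set" and F :: "real^'n \<Rightarrow> real"
    and a b \<mu> \<Lambda> :: real
    and lam :: "nat \<Rightarrow> real" and us :: "nat \<Rightarrow> real^'n \<Rightarrow> real" and ustar :: "real^'n \<Rightarrow> real"
  assumes "2 \<le> CARD('n)" and "CARD('n) \<le> 9"
    and "open \<Omega>" and "connected \<Omega>" and "bounded \<Omega>" and "\<Omega> \<noteq> {}"
    and "admissible_F F a b \<mu> \<Lambda>"
    and "\<forall>n. lam n > 0" and "incseq lam" and "lam \<longlonglongrightarrow> lambda_star \<Omega> F"
    and "\<forall>n. minimal_sol \<Omega> F (lam n) (us n)"
    and "W012_conv \<Omega> us ustar"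
  shows "\<exists>C. AE x in lebesgue_on \<Omega>. exp (ustar x) \<le> C"
proof -
  interpret finsler_domain \<Omega> F a b \<mu> \<Lambda>
    by unfold_locales (use assms in auto)
  \<comment> \<open>An increasing sequence stays below its limit; this supplies one
    \<open>lmax\<close> for all n.\<close>
  have lb: "lam n \<le> lambda_star \<Omega> F" for n by (rule incseq_le[OF assms(9,10)])
  have "\<exists>D. \<forall>n. AE x in M. us n x \<le> D"
  proof (intro exI allI)
    fix n
    obtain g C where "minimal_solution \<Omega> F a b \<mu> \<Lambda> (lam n) (us n) g C"
      using minimal_sol_imp_minimal_solution[of "lam n" "us n"] assms(8,11) by blast
    from minimal_solution.u_bound[OF this assms(2) lb]
    show "AE x in M. us n x \<le> 2 powr (1 + 1 / (1/150)) *
      (lambda_star \<Omega> F * (sobolev_const (43/200))^2 / a^2 * (1 + 10240000 * measure M (space M)) + 1) * (measure M (space M) + 1) powr (1/150)" .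
  qed
  then obtain D where D: "\<forall>n. AE x in M. us n x \<le> D" by blast
  obtain gs g where c: "\<And>n. W012 \<Omega> (us n) (gs n)" "W012 \<Omega> ustar g"
    "(\<lambda>n. (LINT x|M. (us n x - ustar x)^2) + (LINT x|M. (norm (gs n x - g x))^2)) \<longlonglongrightarrow> 0"
    using assms(12) unfolding W012_conv_def by blast
  have s: "sq_int M (\<lambda>x. us n x - ustar x)" for n
    by (rule sq_int_diff[OF W0_sq_int(1)[OF W012_imp_W0[OF c(1)]] W0_sq_int(1)[OF W012_imp_W0[OF c(2)]]])
  have "(\<lambda>n. sq_norm M (\<lambda>x. us n x - ustar x)) \<longlonglongrightarrow> 0"
  proof (rule tendsto_zero_squeeze[OF c(3)])
    show "sq_norm M (\<lambda>x. us n x - ustar x) \<le> (LINT x|M. (us n x - ustar x)^2) + (LINT x|M. (norm (gs n x - g x))^2)" for n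
      using sq_norm_nonneg[of M "\<lambda>x. gs n x - g x"] by (simp add: sq_norm_def)
  qed simp
  \<comment> \<open>The uniform bound passes to the limit along a subsequence converging almost
    everywhere.\<close>
  from sq_norm_AE_subseq[OF s this] obtain r :: "nat \<Rightarrow> nat" where
    r: "AE x in M. (\<lambda>k. us (r k) x) \<longlonglongrightarrow> ustar x" by blast
  have "AE x in M. \<forall>n. us n x \<le> D" using D by (simp add: AE_all_countable)
  then have "AE x in M. exp (ustar x) \<le> exp D"
    using r
  proof eventually_elim
    case (elim x)
    have "ustar x \<le> D" by (rule LIMSEQ_le_const2[OF elim(2)]) (use elim(1) in blast)
    then show ?case by simp
  qed
  then show ?thesis by blast
qed

end
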